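(* Let $n\ge1$. There is a constant $C>0$, depending only on $n$, such that for all $\lambda_1,\dots,\lambda_n\in[1,+\infty)$, with $g=\mathrm{diag}(\lambda_1,\dots,\lambda_n,\lambda_1^{-1},\dots,\lambda_n^{-1})$, and for all $\phi_1,\phi_2\in L^2(\mathbb{R}^n)$, \[ \left(\int_{\mathbb{T}^n}\int_{\mathbb{T}^n}\left|\langle\rho(t_1gt_2)\phi_1,\phi_2\rangle\right|^2\,\mathrm{d}t_1\,\mathrm{d}t_2\right)^{1/2}\le C\,(\lambda_1\cdots\lambda_n)^{-1/2}\,\|\phi_1\|_2\|\phi_2\|_2 . \]
   Context: $G=\mathrm{Sp}(n,\mathbb{R})$ is the group of real $2n\times2n$ matrices $S$ with $S^TJS=J$, where $J=\begin{pmatrix} 0 & I \\ -I & 0 \end{pmatrix}$. The map $\iota(A+iB)=\begin{pmatrix} A & -B \\ B & A \end{pmatrix}$ from complex $n\times n$ matrices to real $2n\times2n$ matrices identifies the unitary group $\mathrm{U}(n,\mathbb{C})$ with $\mathrm{Sp}(n,\mathbb{R})\cap\mathrm{O}(2n,\mathbb{R})$. The torus $\mathbb{T}^n\subset G$ is $\iota\{\mathrm{diag}(e^{i\theta_1},\dots,e^{i\theta_n}):\theta_1,\dots,\theta_n\in[-\pi,\pi)\}$, with Haar measure of total mass 1. $\langle\cdot,\cdot\rangle$ is the inner product of $L^2(\mathbb{R}^n)$. $\rho:G\to\mathcal{U}(L^2(\mathbb{R}^n))$ is the (projective) metaplectic representation: $\rho(g)$ is the unitary operator, determined up to a scalar of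 modulus 1, such that $W(\rho(g)\phi_1,\rho(g)\phi_2)(z)=W(\phi_1,\phi_2)(g^{-1}z)$ for all $\phi_1,\phi_2\in L^2(\mathbb{R}^n)$ and $z\in\mathbb{C}^n$, where $z=x+iy\in\mathbb{C}^n$ is identified with $(x,y)\in\mathbb{R}^{2n}$ (as a column vector) and \[ W(\phi_1,\phi_2)(x+iy)=(2\pi)^{-n/2}\int_{\mathbb{R}^n}e^{-is\cdot y}\phi_1(x+\tfrac s2)\overline{\phi_2(x-\tfrac s2)}\,\mathrm{d}s \] is the cross-Wigner distribution. *)

theory Defs
  imports "HOL-Probability.Probability"
begin

text \<open>The index type \<open>'n + 'n\<close> is that of \<open>\<real>\<^sup>2\<^sup>n\<close>: \<open>Inl k\<close> is the coordinate \<open>x\<^sub>k\<close> and \<open>Inr k\<close>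
  is the coordinate \<open>y\<^sub>k\<close>. The rows of \<open>block A B C D\<close> are \<open>(A B)\<close> and \<open>(C D)\<close>.\<close>

definition block ::
  "'a^'n^'n \<Rightarrow> 'a^'n^'n \<Rightarrow> 'a^'n^'n \<Rightarrow> 'a^'n^'n \<Rightarrow> 'a^('n + 'n)^('n + 'n)" where
  "block A B C D = (\<chi> i j.
     case i of
       Inl k \<Rightarrow> (case j of Inl l \<Rightarrow> A $ k $ l | Inr l \<Rightarrow> B $ k $ l)
     | Inr k \<Rightarrow> (case j of Inl l \<Rightarrow> C $ k $ l | Inr l \<Rightarrow> D $ k $ l))"

definition diag :: "'a::zero^'n \<Rightarrow> 'a^'n^'n" where
  "diag v = (\<chi> i j. if i = j then v $ i else 0)"

definition symp_J :: "real^('n::finite + 'n)^('n + 'n)" where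
  "symp_J = block 0 (mat 1) (- mat 1) 0"

definition Sp :: "(real^('n::finite + 'n)^('n + 'n)) set" where
  "Sp = {S. transpose S ** symp_J ** S = symp_J}"

definition iota :: "complex^'n^'n \<Rightarrow> real^('n::finite + 'n)^('n + 'n)" where
  "iota M = block (\<chi> i j. Re (M $ i $ j)) (\<chi> i j. - Im (M $ i $ j))
                  (\<chi> i j. Im (M $ i $ j)) (\<chi> i j. Re (M $ i $ j))"

definition diag_symp :: "real^'n \<Rightarrow> real^('n::finite + 'n)^('n + 'n)" where
  "diag_symp l = block (diag l) 0 0 (diag (\<chi> k. inverse (l $ k)))"

definition real_of_cvec :: "complex^'n \<Rightarrow> real^('n::finite + 'n)" where
  "real_of_cvec z = (\<chi> i. case i of Inl k \<Rightarrow> Re (z $ k) | Inr k \<Rightarrow> Im (z $ k))"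

definition cvec_of_real :: "real^('n + 'n) \<Rightarrow> complex^'n::finite" where
  "cvec_of_real v = (\<chi> k. Complex (v $ Inl k) (v $ Inr k))"

definition angles :: "(real^'n) set" where
  "angles = {\<theta>. \<forall>k. - pi \<le> \<theta> $ k \<and> \<theta> $ k < pi}"

definition torus_elem :: "real^'n \<Rightarrow> real^('n::finite + 'n)^('n + 'n)" where
  "torus_elem \<theta> = iota (diag (\<chi> k. cis (\<theta> $ k)))"

definition torus :: "(real^('n::finite + 'n)^('n + 'n)) set" where
  "torus = torus_elem ` angles"

text \<open>The image on the torus of normalized Lebesgue measure on \<open>[-\<pi>,\<pi>)\<^sup>n\<close>. The lemmas
  \<open>prob_haar_torus\<close> and \<open>haar_torus_invariant\<close> below show that this is the
  translation-invariant Borel probability measure.\<close>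

definition haar_torus :: "(real^('n::finite + 'n)^('n + 'n)) measure" where
  "haar_torus = distr (uniform_measure lborel angles) (restrict_space borel torus) torus_elem"

text \<open>Elements of \<open>L\<^sup>2\<close> are given by Borel representatives, and equality in \<open>L\<^sup>2\<close> is
  equality almost everywhere.\<close>

definition L2 :: "('a::euclidean_space \<Rightarrow> complex) set" where
  "L2 = {f \<in> borel_measurable lborel. integrable lborel (\<lambda>x. (cmod (f x))\<^sup>2)}"

definition L2_eq :: "('a::euclidean_space \<Rightarrow> complex) \<Rightarrow> ('a \<Rightarrow> complex) \<Rightarrow> bool" where
  "L2_eq f g \<longleftrightarrow> (AE x in lborel. f x = g x)"

definition L2_inner :: "('a::euclidean_space \<Rightarrow> complex) \<Rightarrow> ('a \<Rightarrow> complex) \<Rightarrow> complex" where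
  "L2_inner f g = (LINT x|lborel. f x * cnj (g x))"

definition L2_norm :: "('a::euclidean_space \<Rightarrow> complex) \<Rightarrow> real" where
  "L2_norm f = sqrt (LINT x|lborel. (cmod (f x))\<^sup>2)"

text \<open>A map on representatives that induces a unitary operator on \<open>L\<^sup>2\<close>: well defined modulus
  null sets, linear, inner-product preserving and onto.\<close>

definition unitary_L2 ::
  "(('a::euclidean_space \<Rightarrow> complex) \<Rightarrow> ('a \<Rightarrow> complex)) \<Rightarrow> bool" where
  "unitary_L2 U \<longleftrightarrow>
     (\<forall>f\<in>L2. U f \<in> L2) \<and>
     (\<forall>f\<in>L2. \<forall>g\<in>L2. L2_eq f g \<longrightarrow> L2_eq (U f) (U g)) \<and>
     (\<forall>f\<in>L2. \<forall>g\<in>L2. L2_eq (U (\<lambda>x. f x + g x)) (\<lambda>x. U f x + U g x)) \<and>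
     (\<forall>c. \<forall>f\<in>L2. L2_eq (U (\<lambda>x. c * f x)) (\<lambda>x. c * U f x)) \<and>
     (\<forall>f\<in>L2. \<forall>g\<in>L2. L2_inner (U f) (U g) = L2_inner f g) \<and>
     (\<forall>g\<in>L2. \<exists>f\<in>L2. L2_eq (U f) g)"

definition cross_wigner ::
  "(real^'n \<Rightarrow> complex) \<Rightarrow> (real^'n \<Rightarrow> complex) \<Rightarrow> complex^'n::finite \<Rightarrow> complex" where
  "cross_wigner \<phi>1 \<phi>2 z =
     (let x = (\<chi> k. Re (z $ k)); y = (\<chi> k. Im (z $ k)) in
      of_real ((2 * pi) powr (- real CARD('n) / 2)) *
      (LINT s|lborel. exp (- (\<i> * of_real (s \<bullet> y))) *
                      \<phi>1 (x + s /\<^sub>R 2) * cnj (\<phi>2 (x - s /\<^sub>R 2))))"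

text \<open>\<open>metaplectic_op g U\<close> characterizes \<open>U = \<rho>(g)\<close> up to a scalar of modulus 1; accordingly
  \<open>metaplectic_rep \<rho>\<close> holds of every choice of these scalars. Values of \<open>\<rho>\<close> outside \<open>Sp\<close> are
  irrelevant.\<close>

definition metaplectic_op ::
  "real^('n::finite + 'n)^('n + 'n) \<Rightarrow> ((real^'n \<Rightarrow> complex) \<Rightarrow> (real^'n \<Rightarrow> complex)) \<Rightarrow> bool" where
  "metaplectic_op g U \<longleftrightarrow> unitary_L2 U \<and>
     (\<forall>\<phi>1\<in>L2. \<forall>\<phi>2\<in>L2. \<forall>z.
        cross_wigner (U \<phi>1) (U \<phi>2) z =
        cross_wigner \<phi>1 \<phi>2 (cvec_of_real (matrix_inv g *v real_of_cvec z)))"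

definition metaplectic_rep ::
  "(real^('n::finite + 'n)^('n + 'n) \<Rightarrow> (real^'n \<Rightarrow> complex) \<Rightarrow> (real^'n \<Rightarrow> complex)) \<Rightarrow> bool" where
  "metaplectic_rep \<rho> \<longleftrightarrow> (\<forall>g\<in>Sp. metaplectic_op g (\<rho> g))"

text \<open>The matrices \<open>t\<^sub>1 g t\<^sub>2\<close> at which \<open>\<rho>\<close> is evaluated do lie in \<open>Sp\<close>.\<close>

lemma sum_UNIV_Plus:
  fixes f :: "'a::finite + 'b::finite \<Rightarrow> 'c::comm_monoid_add"
  shows "(\<Sum>i\<in>UNIV. f i) = (\<Sum>k\<in>UNIV. f (Inl k)) + (\<Sum>k\<in>UNIV. f (Inr k))"
  by (simp add: UNIV_Plus_UNIV[symmetric] sum.Plus del: UNIV_Plus_UNIV)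

lemma Sp_mult: "S \<in> Sp \<Longrightarrow> T \<in> Sp \<Longrightarrow> S ** T \<in> Sp"
  by (simp add: Sp_def matrix_transpose_mul) (metis matrix_mul_assoc)

lemma block_diag_in_Sp:
  fixes a b c d :: "real^'n::finite"
  assumes "\<And>k. a $ k * d $ k - b $ k * c $ k = 1"
  shows "block (diag a) (diag b) (diag c) (diag d) \<in> Sp"
proof -
  let ?S = "block (diag a) (diag b) (diag c) (diag d)"
  have "(transpose ?S ** symp_J ** ?S) $ i $ j = symp_J $ i $ j" for i j
    using assms
    by (cases i; cases j)
       (auto simp: symp_J_def block_def diag_def mat_def transpose_def matrix_matrix_mult_def
          sum_UNIV_Plus if_distrib[of "\<lambda>x. x * _"] if_distrib[of "\<lambda>x. _ * x"]
          if_distrib[of uminus] algebra_simps cong: if_cong)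
  thus ?thesis by (simp add: Sp_def vec_eq_iff)
qed

lemma diag_symp_in_Sp:
  assumes "\<And>k. l $ k \<noteq> 0"
  shows "diag_symp l \<in> Sp"
proof -
  have "diag_symp l = block (diag l) (diag 0) (diag 0) (diag (\<chi> k. inverse (l $ k)))"
    by (simp add: diag_symp_def diag_def vec_eq_iff block_def split: sum.split)
  thus ?thesis using assms by (simp add: block_diag_in_Sp)
qed

lemma torus_elem_in_Sp: "torus_elem \<theta> \<in> Sp"
proof -
  have "torus_elem \<theta> = block (diag (\<chi> k. cos (\<theta> $ k))) (diag (\<chi> k. - sin (\<theta> $ k)))
      (diag (\<chi> k. sin (\<theta> $ k))) (diag (\<chi> k. cos (\<theta> $ k)))"
    by (simp add: torus_elem_def iota_def diag_def vec_eq_iff block_def split: sum.split)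
  moreover have "cos x * cos x - - sin x * sin x = 1" for x :: real
    using sin_cos_squared_add[of x] by (simp add: power2_eq_square)
  ultimately show ?thesis by (simp add: block_diag_in_Sp)
qed

lemma torus_elem_mult:
  fixes a b :: "real^'n::finite"
  shows "torus_elem a ** torus_elem b = torus_elem (a + b)"
proof -
  have "(torus_elem a ** torus_elem b) $ i $ j = torus_elem (a + b) $ i $ j" for i j
    by (cases i; cases j)
       (auto simp: torus_elem_def iota_def block_def diag_def matrix_matrix_mult_def sum_UNIV_Plus
          if_distrib[of Re] if_distrib[of Im] if_distrib[of uminus] if_distrib[of "\<lambda>x. x * _"]
          if_distrib[of "\<lambda>x. _ * x"] cos_add sin_add cong: if_cong)
  thus ?thesis by (simp add: vec_eq_iff)
qed

definition lattice_shift :: "int^'n \<Rightarrow> real^'n" where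
  "lattice_shift k = (\<chi> i. 2 * pi * of_int (k $ i))"

lemma torus_elem_periodic:
  fixes a :: "real^'n::finite"
  shows "torus_elem (a + lattice_shift k) = torus_elem a"
proof -
  have "cis (a $ i + 2 * pi * of_int (k $ i)) = cis (a $ i)" for i
    by (metis cis_multiple_2pi cis_mult Ints_of_int mult.right_neutral)
  thus ?thesis by (simp add: torus_elem_def lattice_shift_def)
qed

lemma ex1_lattice_shift:
  fixes \<theta> :: "real^'n::finite"
  shows "\<exists>!k. \<theta> - lattice_shift k \<in> angles"
proof -
  have "(- pi \<le> t - 2 * pi * of_int m \<and> t - 2 * pi * of_int m < pi) \<longleftrightarrow>
        m = \<lfloor>(t + pi) / (2 * pi)\<rfloor>" for t :: real and m :: int
  proof -
    have "m = \<lfloor>(t + pi) / (2 * pi)\<rfloor> \<longleftrightarrow>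
        of_int m \<le> (t + pi) / (2 * pi) \<and> (t + pi) / (2 * pi) < of_int m + 1"
      by linarith
    thus ?thesis by (simp add: field_simps)
  qed
  hence "\<theta> - lattice_shift k \<in> angles \<longleftrightarrow> k = (\<chi> i. \<lfloor>(\<theta> $ i + pi) / (2 * pi)\<rfloor>)" for k
    by (simp add: angles_def lattice_shift_def vec_eq_iff)
  thus ?thesis by auto
qed

lemma angles_measurable [measurable]: "(angles :: (real^'n::finite) set) \<in> sets borel"
  unfolding angles_def by measurable

lemma emeasure_angles:
  "emeasure lborel (angles :: (real^'n::finite) set) \<noteq> 0"
  "emeasure lborel (angles :: (real^'n::finite) set) \<noteq> \<infinity>"
proof -
  let ?p = "(\<chi> i. pi) :: real^'n"
  have 1: "box (- ?p) ?p \<subseteq> angles" and 2: "angles \<subseteq> cbox (- ?p) ?p"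
    by (auto simp: angles_def mem_box_cart less_imp_le)
  have "0 < emeasure lborel (box (- ?p) ?p)"
    by (auto simp: emeasure_lborel_box_eq Basis_vec_def inner_axis prod_pos
        intro!: prod_pos)
  also have "\<dots> \<le> emeasure lborel (angles :: (real^'n) set)"
    by (intro emeasure_mono 1) simp
  finally show "emeasure lborel (angles :: (real^'n::finite) set) \<noteq> 0" by simp
  have "emeasure lborel (angles :: (real^'n) set) \<le> emeasure lborel (cbox (- ?p) ?p)"
    by (intro emeasure_mono 2) simp
  also have "\<dots> < \<infinity>" by (simp add: emeasure_lborel_cbox_eq)
  finally show "emeasure lborel (angles :: (real^'n::finite) set) \<noteq> \<infinity>" by simp
qed

lemma emeasure_lborel_translate:
  fixes X :: "(real^'n::finite) set"
  assumes "X \<in> sets borel"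
  shows "emeasure lborel {\<theta>. b + \<theta> \<in> X} = emeasure lborel X"
proof -
  have "emeasure lborel X = emeasure (distr lborel borel ((+) b)) X"
    by (simp add: lborel_distr_plus)
  also have "\<dots> = emeasure lborel {\<theta>. b + \<theta> \<in> X}"
    using assms by (subst emeasure_distr) (auto simp: vimage_def)
  finally show ?thesis by simp
qed

lemma emeasure_angles_translate:
  fixes Q :: "(real^'n::finite) set"
  assumes Q [measurable]: "Q \<in> sets borel"
    and per: "\<And>\<theta> k. \<theta> + lattice_shift k \<in> Q \<longleftrightarrow> \<theta> \<in> Q"
  shows "emeasure lborel (angles \<inter> {\<theta>. a + \<theta> \<in> Q}) = emeasure lborel (angles \<inter> Q)"
proof -
  let ?s = "lattice_shift :: int^'n \<Rightarrow> real^'n"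
  define X where "X k = {\<theta>. \<theta> - a \<in> angles \<and> \<theta> \<in> Q \<and> \<theta> - ?s k \<in> angles}" for k
  define Y where "Y k = {\<theta>. \<theta> + ?s k - a \<in> angles \<and> \<theta> \<in> Q \<and> \<theta> \<in> angles}" for k
  have [measurable]: "X k \<in> sets borel" "Y k \<in> sets borel" for k
    unfolding X_def Y_def by measurable
  have neg: "?s (- k) = - ?s k" for k
    by (simp add: lattice_shift_def vec_eq_iff)
  have "disjoint_family X"
    unfolding disjoint_family_on_def X_def using ex1_lattice_shift by blast
  have "k = l" if "\<theta> + ?s k - a \<in> angles" "\<theta> + ?s l - a \<in> angles" for k l \<theta>
  proof -
    have "(\<theta> - a) - ?s (- k) \<in> angles" "(\<theta> - a) - ?s (- l) \<in> angles"
      using that by (simp_all add: neg algebra_simps)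
    hence "- k = - l" using ex1_lattice_shift by blast
    thus ?thesis by simp
  qed
  hence "disjoint_family Y"
    unfolding disjoint_family_on_def Y_def by blast
  have UX: "(\<Union>k. X k) = {\<theta>. \<theta> - a \<in> angles \<and> \<theta> \<in> Q}"
    unfolding X_def using ex1_lattice_shift by fast
  have "\<exists>k. \<theta> + ?s k - a \<in> angles" for \<theta>
  proof -
    obtain k where "(\<theta> - a) - ?s k \<in> angles" using ex1_lattice_shift by blast
    hence "\<theta> + ?s (- k) - a \<in> angles" by (simp add: neg algebra_simps)
    thus ?thesis by blast
  qed
  hence UY: "(\<Union>k. Y k) = angles \<inter> Q"
    unfolding Y_def by blast
  have XY: "emeasure lborel (X k) = emeasure lborel (Y k)" for k
  proof -
    have "{\<theta>. ?s k + \<theta> \<in> X k} = Y k"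
      using per by (auto simp: X_def Y_def add.commute)
    thus ?thesis using emeasure_lborel_translate[of "X k" "?s k"] by simp
  qed
  have "emeasure lborel (angles \<inter> {\<theta>. a + \<theta> \<in> Q}) =
      emeasure lborel {\<theta>. a + \<theta> \<in> (\<Union>k. X k)}"
    unfolding UX by (simp add: Int_def)
  also have "\<dots> = emeasure lborel (\<Union>k. X k)"
    unfolding UX by (rule emeasure_lborel_translate) measurable
  also have "\<dots> = (\<integral>\<^sup>+k. emeasure lborel (X k) \<partial>count_space UNIV)"
    by (rule emeasure_UN_countable) (use \<open>disjoint_family X\<close> in auto)
  also have "\<dots> = (\<integral>\<^sup>+k. emeasure lborel (Y k) \<partial>count_space UNIV)"
    by (simp add: XY)
  also have "\<dots> = emeasure lborel (\<Union>k. Y k)"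
    by (rule emeasure_UN_countable[symmetric]) (use \<open>disjoint_family Y\<close> in auto)
  finally show ?thesis unfolding UY .
qed

lemma torus_elem_in_torus: "torus_elem \<theta> \<in> torus"
proof -
  obtain k where "\<theta> - lattice_shift k \<in> angles" using ex1_lattice_shift by blast
  moreover have "torus_elem (\<theta> - lattice_shift k) = torus_elem \<theta>"
    using torus_elem_periodic[of "\<theta> - lattice_shift k" k] by simp
  ultimately show ?thesis unfolding torus_def by (metis image_eqI)
qed

lemma torus_elem_borel:
  "(torus_elem :: real^'n::finite \<Rightarrow> real^('n + 'n)^('n + 'n)) \<in> borel_measurable borel"
proof (rule borel_measurable_continuous_onI)
  have "continuous_on UNIV (\<lambda>\<theta> :: real^'n. torus_elem \<theta> $ i $ j)" for i j :: "'n + 'n"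
    by (cases i; cases j; cases "projl i = projl j"; cases "projr i = projr j";
        cases "projl i = projr j"; cases "projr i = projl j")
       (auto simp: torus_elem_def iota_def block_def diag_def intro!: continuous_intros)
  thus "continuous_on UNIV (torus_elem :: real^'n \<Rightarrow> real^('n + 'n)^('n + 'n))"
    using continuous_on_vec_lambda[OF continuous_on_vec_lambda,
        of UNIV "\<lambda>i j (\<theta> :: real^'n). torus_elem \<theta> $ i $ j"] by simp
qed

lemma torus_elem_measurable [measurable]:
  "torus_elem \<in> measurable borel (restrict_space borel torus)"
  by (intro measurable_restrict_space2 torus_elem_borel) (auto simp: torus_elem_in_torus)

lemma prob_haar_torus: "prob_space haar_torus"
  unfolding haar_torus_def
  by (rule prob_space.prob_space_distr[OF prob_space_uniform_measure])
     (use emeasure_angles in simp_all)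

lemma emeasure_haar_torus:
  fixes A :: "(real^('n::finite + 'n)^('n + 'n)) set"
  assumes "A \<in> sets (restrict_space borel torus)"
  shows "emeasure haar_torus A =
    emeasure lborel (angles \<inter> {\<theta>. torus_elem \<theta> \<in> A}) / emeasure lborel (angles :: (real^'n) set)"
proof -
  have 1: "{\<theta>. torus_elem \<theta> \<in> A} \<in> sets borel"
    using measurable_sets[OF torus_elem_measurable assms] by (simp add: vimage_def)
  have "emeasure haar_torus A = emeasure (uniform_measure lborel angles) {\<theta>. torus_elem \<theta> \<in> A}"
    unfolding haar_torus_def by (subst emeasure_distr) (use assms in \<open>simp_all add: vimage_def\<close>)
  thus ?thesis using 1 by simp
qed

lemma haar_torus_invariant:
  assumes "t \<in> torus"
  shows "distr haar_torus haar_torus (\<lambda>u. t ** u) = haar_torus"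
proof -
  obtain a where t: "t = torus_elem a" using assms unfolding torus_def by blast
  have sets_haar: "sets haar_torus = sets (restrict_space borel torus)"
    by (simp add: haar_torus_def)
  have "(\<lambda>u. t ** u) \<in> borel_measurable borel"
    by (intro borel_measurable_continuous_onI linear_continuous_on
        linear_conv_bounded_linear[THEN iffD1] linearI)
       (simp_all add: matrix_add_ldistrib vec_eq_iff matrix_matrix_mult_def sum_distrib_left
          sum.distrib algebra_simps)
  moreover have "t ** u \<in> torus" if "u \<in> torus" for u
    using that by (auto simp: t torus_def torus_elem_mult torus_elem_in_torus[unfolded torus_def])
  ultimately have "(\<lambda>u. t ** u) \<in> measurable (restrict_space borel torus) (restrict_space borel torus)"
    by (intro measurable_restrict_space3) auto
  hence m: "(\<lambda>u. t ** u) \<in> measurable haar_torus haar_torus"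
    by (simp add: haar_torus_def)
  show ?thesis
  proof (rule measure_eqI)
    fix A assume "A \<in> sets (distr haar_torus haar_torus (\<lambda>u. t ** u))"
    hence A: "A \<in> sets haar_torus" by simp
    define B where "B = (\<lambda>u. t ** u) -` A \<inter> space haar_torus"
    have B: "B \<in> sets haar_torus"
      unfolding B_def by (rule measurable_sets[OF m A])
    have "torus_elem \<theta> \<in> B \<longleftrightarrow> torus_elem (a + \<theta>) \<in> A" for \<theta>
      by (simp add: B_def t torus_elem_mult haar_torus_def space_restrict_space torus_elem_in_torus)
    moreover have "emeasure lborel (angles \<inter> {\<theta>. a + \<theta> \<in> {\<theta>. torus_elem \<theta> \<in> A}}) =
        emeasure lborel (angles \<inter> {\<theta>. torus_elem \<theta> \<in> A})"
    proof (rule emeasure_angles_translate)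
      show "{\<theta>. torus_elem \<theta> \<in> A} \<in> sets borel"
        using measurable_sets[OF torus_elem_measurable A[unfolded sets_haar]]
        by (simp add: vimage_def)
    qed (simp add: torus_elem_periodic)
    ultimately have "emeasure haar_torus B = emeasure haar_torus A"
      using A B by (simp add: emeasure_haar_torus sets_haar)
    thus "emeasure (distr haar_torus haar_torus (\<lambda>u. t ** u)) A = emeasure haar_torus A"
      using m A by (simp add: emeasure_distr B_def)
  qed simp
qed

end

theory Submission
  imports Defs "HOL-Computational_Algebra.Polynomial"
begin

text \<open>
  The coherent states \<open>E\<^sub>w\<close> span a dense subspace of \<open>L\<^sup>2\<close>, their cross-Wigner distributions are
  Gaussians on which the torus acts by \<open>w \<mapsto> t w\<close>, and a function is determined up to a phase by
  its Wigner distribution. Hence on linear combinations of coherent states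
  \<open>\<bar>\<langle>\<rho>(t\<^sub>1 g t\<^sub>2) \<phi>\<^sub>1, \<phi>\<^sub>2\<rangle>\<bar>\<close> is the modulus of an explicit analytic kernel in the coordinates of \<open>t\<^sub>1\<close>
  and \<open>t\<^sub>2\<close>, and Parseval on the torus reduces the theorem to a bound on the Taylor coefficients of
  \<open>exp (s p q + \<tau> (q\<^sup>2 - p\<^sup>2) / 2)\<close> with \<open>s = 2\<lambda> / (\<lambda>\<^sup>2 + 1)\<close> and \<open>s\<^sup>2 + \<tau>\<^sup>2 = 1\<close>. The quadratic form in
  the exponent is a rotation of \<open>p q\<close>, so the unitary invariance of the norm with
  \<open>\<parallel>p\<^sup>a q\<^sup>b\<parallel>\<^sup>2 = a! b!\<close> on binary forms bounds the normalized coefficients by 1; the decay comes from the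
  Gaussian prefactor \<open>sqrt s\<close>.
\<close>

section \<open>Bounded limits of trigonometric polynomials\<close>

text \<open>The obstacle is that \<open>\<rho>\<close> is known only through Wigner covariance, with
  a scalar of modulus 1 chosen freely at every group element. It therefore has no given regularity
  in the torus variables, and \<open>\<rho>(t1 g t2)\<close> cannot simply be factored. Only moduli
  of coefficients are determined. They have to be matched for whole linear combinations, since
  matching single coherent states would leave unrelated phases. The explicit kernels also supply the
  measurability of the integrand. The averaging helps because Parseval removes every cross term.
  What remains is a sum over multi-indices (a,b) of |m(a,b)|^2 |A(a)|^2 |B(b)|^2, where A and B are
  the moments of the two combinations. A uniform bound on |m(a,b)|^2 a! b! is then enough, because
  the sums of |A(a)|^2 / a! and |B(b)|^2 / b! are the squared norms up to powers of pi. The numbers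
  s and \<tau> are sech and tanh of log \<lambda>, which is why they lie on the unit circle. The
  estimate s \<le> 2 / \<lambda> gives the constant C = 2^(n/2).\<close>

inductive_set trig_poly :: "('a::euclidean_space \<Rightarrow> complex) set" where
  cis: "(\<lambda>x. cis (y \<bullet> x)) \<in> trig_poly"
| add: "f \<in> trig_poly \<Longrightarrow> g \<in> trig_poly \<Longrightarrow> (\<lambda>x. f x + g x) \<in> trig_poly"
| scale: "f \<in> trig_poly \<Longrightarrow> (\<lambda>x. c * f x) \<in> trig_poly"

lemma trig_poly_const: "(\<lambda>x. c) \<in> trig_poly"
  using trig_poly.scale[OF trig_poly.cis[of 0], of c] by simp

lemma trig_poly_mult:
  assumes "f \<in> trig_poly" "g \<in> trig_poly"
  shows "(\<lambda>x. f x * g x) \<in> trig_poly"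
  using assms(1)
proof induction
  case (cis y)
  show ?case
    using assms(2)
  proof induction
    case (cis y')
    show ?case using trig_poly.cis[of "y + y'"] by (simp add: cis_mult inner_add_left)
  next
    case (add f g)
    then show ?case using trig_poly.add by (simp add: distrib_left)
  next
    case (scale f c)
    then show ?case using trig_poly.scale[of _ c] by (simp add: mult.left_commute)
  qed
next
  case (add f g)
  then show ?case using trig_poly.add by (simp add: distrib_right)
next
  case (scale f c)
  then show ?case using trig_poly.scale[of _ c] by (simp add: mult.assoc)
qed

lemma trig_poly_sin: "(\<lambda>x. of_real (sin (y \<bullet> x + b))) \<in> trig_poly"
proof -
  have "(\<lambda>x. (cis b / (2 * \<i>)) * cis (y \<bullet> x) + (- cis (- b) / (2 * \<i>)) * cis (- y \<bullet> x)) \<in> trig_poly"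
    by (intro trig_poly.intros)
  also have "(\<lambda>x. (cis b / (2 * \<i>)) * cis (y \<bullet> x) + (- cis (- b) / (2 * \<i>)) * cis (- y \<bullet> x)) =
      (\<lambda>x. of_real (sin (y \<bullet> x + b)))"
  proof (rule ext)
    fix x
    define t where "t = y \<bullet> x + b"
    have "cis b * cis (y \<bullet> x) = cis t" "cis (- b) * cis (- y \<bullet> x) = cis (- t)"
      by (simp_all add: t_def cis_mult add.commute)
    then show "(cis b / (2 * \<i>)) * cis (y \<bullet> x) + (- cis (- b) / (2 * \<i>)) * cis (- y \<bullet> x) =
        of_real (sin (y \<bullet> x + b))"
      unfolding times_divide_eq_left mult_minus_left t_def[symmetric]
      by (auto simp: complex_eq_iff add.commute)
  qed
  finally show ?thesis .
qed

lemma trig_poly_polynomial: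
  assumes "real_polynomial_function p" "(\<lambda>x. of_real (f x)) \<in> trig_poly"
  shows "(\<lambda>x. of_real (p (f x))) \<in> trig_poly"
  using assms(1)
proof induction
  case (linear h)
  then have "h x = h 1 * x" for x
    using bounded_linear.linear[OF linear] linear_scale[of h x 1] by (simp add: mult.commute)
  then show ?case using trig_poly.scale[OF assms(2), of "of_real (h 1)"]
    by (metis (no_types, lifting) ext of_real_mult)
qed (auto intro: trig_poly.add trig_poly_mult trig_poly_const)

text \<open>The uniform bound stands beside pointwise convergence because the approximation is later
  carried through integrals by dominated convergence. It also survives products, which gives
  stability under intersection.\<close>

definition trig_approximable :: "'a::euclidean_space set \<Rightarrow> bool" where
  "trig_approximable A \<longleftrightarrow> (\<exists>F C. (\<forall>n::nat. F n \<in> trig_poly) \<and> (\<forall>n x. cmod (F n x) \<le> C) \<and>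
     (\<forall>x. (\<lambda>n. F n x) \<longlonglongrightarrow> indicator A x))"

lemma trig_approximable_Int:
  assumes "trig_approximable A" "trig_approximable B"
  shows "trig_approximable (A \<inter> B)"
proof -
  obtain F C where F: "\<And>n::nat. F n \<in> trig_poly" "\<And>n x. cmod (F n x) \<le> C"
      "\<And>x. (\<lambda>n. F n x) \<longlonglongrightarrow> indicator A x"
    using assms(1) unfolding trig_approximable_def by blast
  obtain G D where G: "\<And>n::nat. G n \<in> trig_poly" "\<And>n x. cmod (G n x) \<le> D"
      "\<And>x. (\<lambda>n. G n x) \<longlonglongrightarrow> indicator B x"
    using assms(2) unfolding trig_approximable_def by blast
  have "0 \<le> C" using F(2)[of 0 undefined] norm_ge_zero order_trans by blast
  then have "cmod (F n x * G n x) \<le> C * D" for n x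
    by (simp add: norm_mult F(2) G(2) mult_mono)
  moreover have "(\<lambda>n. F n x * G n x) \<longlonglongrightarrow> indicator (A \<inter> B) x" for x
    using tendsto_mult[OF F(3)[of x] G(3)[of x]] by (simp add: indicator_inter_arith)
  ultimately show ?thesis
    unfolding trig_approximable_def using trig_poly_mult[OF F(1) G(1)]
    by (intro exI[of _ "\<lambda>n x. F n x * G n x"] exI[of _ "C * D"]) auto
qed

text \<open>The ramps \<open>f n\<close> increase to the indicator of the positive half-line.
  Weierstrass replaces each by a polynomial on [-1,1] with error tending to 0, and a polynomial in a
  sine is a trigonometric polynomial.\<close>

lemma trig_approximable_sin_pos: "trig_approximable {x. 0 < sin (y \<bullet> x + b)}"
proof -
  define f where "f n s = min 1 (max 0 (real n * s))" for n and s :: real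
  have "\<exists>p. real_polynomial_function p \<and> (\<forall>s\<in>{-1..1}. \<bar>f n s - p s\<bar> < 1 / (1 + real n))" for n
  proof -
    have cont: "continuous_on {-1..1} (f n)" unfolding f_def by (intro continuous_intros)
    have pos: "0 < 1 / (1 + real n)" by simp
    show ?thesis
    proof (rule Stone_Weierstrass_real_polynomial_function[OF compact_Icc cont pos])
      fix g
      assume "real_polynomial_function g" "\<And>s. s \<in> {-1..1} \<Longrightarrow> \<bar>f n s - g s\<bar> < 1 / (1 + real n)"
      then show ?thesis by blast
    qed
  qed
  then obtain p where p: "\<And>n. real_polynomial_function (p n)"
      "\<And>n s. s \<in> {-1..1} \<Longrightarrow> \<bar>f n s - p n s\<bar> < 1 / (1 + real n)"
    by metis
  define F where "F n x = complex_of_real (p n (sin (y \<bullet> x + b)))" for n x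
  have "F n \<in> trig_poly" for n
    unfolding F_def by (rule trig_poly_polynomial[OF p(1) trig_poly_sin])
  moreover have "cmod (F n x) \<le> 2" for n x
  proof -
    define s where "s = sin (y \<bullet> x + b)"
    have "s \<in> {-1..1}" by (simp add: s_def)
    then have "\<bar>f n s - p n s\<bar> < 1 / (1 + real n)" by (rule p(2))
    moreover have "1 / (1 + real n) \<le> 1" by simp
    moreover have "\<bar>f n s\<bar> \<le> 1" by (auto simp: f_def)
    moreover have "\<bar>v\<bar> \<le> 2" if "\<bar>u - v\<bar> < w" "w \<le> 1" "\<bar>u\<bar> \<le> 1" for u v w :: real
      using that by linarith
    ultimately show ?thesis unfolding F_def norm_of_real s_def[symmetric] by blast
  qed
  moreover have "(\<lambda>n. F n x) \<longlonglongrightarrow> indicator {x. 0 < sin (y \<bullet> x + b)} x" for x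
  proof -
    define s where "s = sin (y \<bullet> x + b)"
    have *: "(\<lambda>n. 1 / (1 + real n)) \<longlonglongrightarrow> 0"
      using LIMSEQ_inverse_real_of_nat by (simp add: inverse_eq_divide)
    have "(\<lambda>n. f n s) \<longlonglongrightarrow> indicator {0<..} s"
    proof (cases "0 < s")
      case True
      obtain N where N: "1 / s < real N" using reals_Archimedean2 by blast
      have "f n s = 1" if "n \<ge> N" for n
      proof -
        have "1 / s < real n" using N that by linarith
        then have "1 < real n * s" using True by (simp add: field_simps)
        then show ?thesis by (simp add: f_def)
      qed
      then have "eventually (\<lambda>n. f n s = 1) sequentially"
        using eventually_at_top_linorder by blast
      then show ?thesis using True by (simp add: tendsto_eventually)
    next
      case False
      then have "f n s = 0" for n by (simp add: f_def mult_nonneg_nonpos)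
      then show ?thesis using False by simp
    qed
    moreover have "(\<lambda>n. p n s - f n s) \<longlonglongrightarrow> 0"
      by (rule Lim_null_comparison[OF _ *])
        (use p(2)[of s] in \<open>auto simp: s_def abs_minus_commute less_imp_le\<close>)
    ultimately have "(\<lambda>n. (p n s - f n s) + f n s) \<longlonglongrightarrow> 0 + indicator {0<..} s"
      by (intro tendsto_add)
    then have "(\<lambda>n. complex_of_real (p n s)) \<longlonglongrightarrow> of_real (indicator {0<..} s)"
      by (intro tendsto_of_real) simp
    then show ?thesis by (cases "0 < s") (simp_all add: F_def s_def)
  qed
  ultimately show ?thesis unfolding trig_approximable_def by blast
qed

text \<open>Trigonometric polynomials see only periodic sets directly, so a half-space is written as
  the limit inferior of the periodic sets \<open>H m\<close> with growing period. For large m the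
  scaled argument lies strictly between -pi and pi, where the sine has the sign of its
  argument.\<close>

lemma sigma_sets_trig_approximable:
  "sets (borel :: 'a::euclidean_space measure) \<subseteq> sigma_sets UNIV {A. trig_approximable A}"
proof -
  let ?S = "sigma UNIV {A :: 'a set. trig_approximable A}"
  have "{x. x \<bullet> i > a} \<in> sets ?S" for a and i :: 'a
  proof -
    define H where "H m = {x. 0 < sin ((i /\<^sub>R 2 ^ m) \<bullet> x + (- a / 2 ^ m))}" for m :: nat
    have H: "x \<in> H m \<longleftrightarrow> 0 < sin ((x \<bullet> i - a) / 2 ^ m)" for x m
      by (simp add: H_def inner_commute divide_inverse algebra_simps)
    have small: "\<exists>M. \<forall>m\<ge>M. c / 2 ^ m < pi" for c :: real
    proof -
      have "(\<lambda>m. c / 2 ^ m) \<longlonglongrightarrow> 0"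
        by (rule LIMSEQ_divide_realpow_zero) simp
      then have "eventually (\<lambda>m. c / 2 ^ m < pi) sequentially"
        by (rule order_tendstoD) simp
      then show ?thesis by (simp add: eventually_at_top_linorder)
    qed
    have "{x. x \<bullet> i > a} = (\<Union>M. \<Inter>m\<in>{M..}. H m)"
    proof (intro equalityI subsetI)
      fix x assume "x \<in> {x. x \<bullet> i > a}"
      then have pos: "0 < x \<bullet> i - a" by simp
      obtain M where "\<forall>m\<ge>M. (x \<bullet> i - a) / 2 ^ m < pi" using small by blast
      then have "\<forall>m\<ge>M. x \<in> H m" unfolding H using pos by (auto intro!: sin_gt_zero)
      then show "x \<in> (\<Union>M. \<Inter>m\<in>{M..}. H m)" by auto
    next
      fix x assume "x \<in> (\<Union>M. \<Inter>m\<in>{M..}. H m)"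
      then obtain M where M: "\<forall>m\<ge>M. x \<in> H m" by auto
      obtain M' where M': "\<forall>m\<ge>M'. (a - x \<bullet> i) / 2 ^ m < pi" using small by blast
      have "\<not> x \<bullet> i \<le> a"
      proof
        assume le: "x \<bullet> i \<le> a"
        have "0 < sin ((x \<bullet> i - a) / 2 ^ max M M')" using M H by simp
        moreover have "0 \<le> sin ((a - x \<bullet> i) / 2 ^ max M M')"
          using M' le by (intro sin_ge_zero) (auto simp: less_imp_le)
        moreover have "sin ((x \<bullet> i - a) / 2 ^ max M M') = - sin ((a - x \<bullet> i) / 2 ^ max M M')"
          by (metis minus_diff_eq minus_divide_left sin_minus)
        ultimately show False by simp
      qed
      then show "x \<in> {x. x \<bullet> i > a}" by simp
    qed
    moreover have "H m \<in> sets ?S" for m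
      unfolding H_def using trig_approximable_sin_pos[of "i /\<^sub>R 2 ^ m" "- a / 2 ^ m"]
      by (intro in_measure_of) blast+
    moreover from this have "(\<Inter>m\<in>{M..}. H m) \<in> sets ?S" for M :: nat
      by (intro sets.countable_INT) (auto simp del: sets_measure_of)
    then have "(\<Union>M. \<Inter>m\<in>{M..}. H m) \<in> sets ?S"
      by (intro sets.countable_UN image_subsetI)
    ultimately show ?thesis by (simp only:)
  qed
  then have "(\<lambda>(a, i). {x. a < x \<bullet> i}) ` (UNIV \<times> Basis) \<subseteq> sets ?S" by auto
  then have "sigma_sets UNIV ((\<lambda>(a, i). {x :: 'a. a < x \<bullet> i}) ` (UNIV \<times> Basis)) \<subseteq> sets ?S"
    using sets.sigma_sets_subset[of _ ?S] by simp
  then show ?thesis by (simp add: borel_eq_halfspace_greater)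
qed

text \<open>A pi-lambda argument: intersection-stable approximable sets generate the Borel sets, and
  \<open>Q\<close> passes to complements and countable disjoint unions. It serves twice, for the
  injectivity of the Fourier transform and for the density of the coherent states; each instance
  puts into \<open>Q\<close> the measurability or boundedness that its limits require.\<close>

lemma trig_class_indicator:
  fixes Q :: "('a::euclidean_space \<Rightarrow> complex) \<Rightarrow> bool"
  assumes cis: "\<And>y. Q (\<lambda>x. cis (y \<bullet> x))"
    and add: "\<And>f g. Q f \<Longrightarrow> Q g \<Longrightarrow> Q (\<lambda>x. f x + g x)"
    and scale: "\<And>f c. Q f \<Longrightarrow> Q (\<lambda>x. c * f x)"
    and lim: "\<And>F f C. (\<And>n::nat. Q (F n)) \<Longrightarrow> (\<And>n x. cmod (F n x) \<le> C) \<Longrightarrow>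
                (\<And>x. (\<lambda>n. F n x) \<longlonglongrightarrow> f x) \<Longrightarrow> Q f"
    and B: "B \<in> sets borel"
  shows "Q (indicator B)"
proof -
  have trig: "Q f" if "f \<in> trig_poly" for f
    using that by induction (auto intro: cis add scale)
  have base: "Q (indicator A)" if "trig_approximable A" for A
    using that trig lim unfolding trig_approximable_def by metis
  have one: "Q (\<lambda>x. 1)" using trig trig_poly_const by blast
  have "Int_stable {A :: 'a set. trig_approximable A}"
    by (auto intro!: Int_stableI trig_approximable_Int)
  moreover have "{A :: 'a set. trig_approximable A} \<subseteq> Pow UNIV" by simp
  moreover have "B \<in> sigma_sets UNIV {A. trig_approximable A}"
    using sigma_sets_trig_approximable B by blast
  ultimately show ?thesis
  proof (induction rule: sigma_sets_induct_disjoint)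
    case (basic A)
    then show ?case using base by simp
  next
    case empty
    then show ?case using scale[OF one, of 0] by (simp add: indicator_def[abs_def])
  next
    case (compl A)
    have "indicator (UNIV - A) = (\<lambda>x. 1 + (-1) * indicator A x :: complex)"
      by (auto simp: indicator_def)
    then show ?case using add[OF one scale[OF compl(2), of "- 1"]] by simp
  next
    case (union A)
    \<comment> \<open>Disjointness turns finite unions into sums; the countable union is then their
      pointwise limit, bounded by 1.\<close>
    have "Q (indicator (\<Union>i<n. A i))" for n
    proof (induction n)
      case 0
      then show ?case using scale[OF one, of 0] by (simp add: indicator_def[abs_def])
    next
      case (Suc n)
      have "(\<Union>i<n. A i) \<inter> A n = {}"
      proof -
        have "A i \<inter> A n = {}" if "i < n" for i
          using union(1) that unfolding disjoint_family_on_def by (metis UNIV_I less_irrefl)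
        then show ?thesis by blast
      qed
      then have "indicator (\<Union>i<Suc n. A i) = (\<lambda>x. indicator (\<Union>i<n. A i) x + indicator (A n) x :: complex)"
        by (auto simp: lessThan_Suc indicator_def fun_eq_iff)
      then show ?case using add[OF Suc union(3)] by simp
    qed
    moreover have "cmod (indicator (\<Union>i<n. A i) x) \<le> 1" for n x
      by (simp add: indicator_def)
    moreover have "(\<lambda>n. indicator (\<Union>i<n. A i) x) \<longlonglongrightarrow> (indicator (\<Union>i. A i) x :: complex)" for x
      by (rule LIMSEQ_indicator_UN)
    ultimately show ?case by (rule lim[where F="\<lambda>n. indicator (\<Union>i<n. A i)" and C=1])
  qed
qed

section \<open>The space of square-integrable functions and injectivity of the Fourier transform\<close>

lemma L2_measurable: "f \<in> L2 \<Longrightarrow> f \<in> borel_measurable borel"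
  by (simp add: L2_def)

lemma L2_integrable: "f \<in> L2 \<Longrightarrow> integrable lborel (\<lambda>x. (cmod (f x))\<^sup>2)"
  by (simp add: L2_def)

lemma L2_I: "f \<in> borel_measurable borel \<Longrightarrow> integrable lborel (\<lambda>x. (cmod (f x))\<^sup>2) \<Longrightarrow> f \<in> L2"
  by (simp add: L2_def)

lemma L2_bound:
  assumes g: "integrable lborel g" and f: "f \<in> borel_measurable borel"
    and le: "\<And>x. (cmod (f x))\<^sup>2 \<le> g x"
  shows "f \<in> L2"
proof (intro L2_I f)
  show "integrable lborel (\<lambda>x. (cmod (f x))\<^sup>2)"
    by (rule Bochner_Integration.integrable_bound[OF g]) (use f le in \<open>auto intro!: AE_I2 order_trans[OF le]\<close>)
qed

lemma borel_measurable_cnj [measurable]: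
  "f \<in> borel_measurable M \<Longrightarrow> (\<lambda>x. cnj (f x)) \<in> borel_measurable M"
  by (rule borel_measurable_continuous_on[of cnj]) (auto intro: continuous_intros)

lemma L2_mult_integrable:
  assumes "f \<in> L2" "g \<in> L2"
  shows "integrable lborel (\<lambda>x. f x * cnj (g x))"
proof (rule Bochner_Integration.integrable_bound)
  show "integrable lborel (\<lambda>x. (cmod (f x))\<^sup>2 + (cmod (g x))\<^sup>2)"
    using assms by (intro Bochner_Integration.integrable_add L2_integrable)
  have [measurable]: "f \<in> borel_measurable borel" "g \<in> borel_measurable borel"
    using assms by (auto intro: L2_measurable)
  show "(\<lambda>x. f x * cnj (g x)) \<in> borel_measurable lborel" by measurable
  have "a * b \<le> a\<^sup>2 + b\<^sup>2" if "0 \<le> a" "0 \<le> b" for a b :: real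
    using sum_squares_bound[of a b] that mult_nonneg_nonneg[of a b] by linarith
  then show "AE x in lborel. norm (f x * cnj (g x)) \<le> norm ((cmod (f x))\<^sup>2 + (cmod (g x))\<^sup>2)"
    by (intro AE_I2) (simp add: norm_mult)
qed

lemma L2_add:
  assumes "f \<in> L2" "g \<in> L2"
  shows "(\<lambda>x. f x + g x) \<in> L2"
proof (rule L2_bound)
  show "integrable lborel (\<lambda>x. 2 * (cmod (f x))\<^sup>2 + 2 * (cmod (g x))\<^sup>2)"
    using assms by (intro Bochner_Integration.integrable_add integrable_mult_right L2_integrable)
  show "(\<lambda>x. f x + g x) \<in> borel_measurable borel"
    using assms by (intro borel_measurable_add L2_measurable)
  show "(cmod (f x + g x))\<^sup>2 \<le> 2 * (cmod (f x))\<^sup>2 + 2 * (cmod (g x))\<^sup>2" for x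
    using power_mono[OF norm_triangle_ineq[of "f x" "g x"], of 2]
      sum_squares_bound[of "cmod (f x)" "cmod (g x)"] by (simp add: power2_sum)
qed

lemma L2_scale: "f \<in> L2 \<Longrightarrow> (\<lambda>x. c * f x) \<in> L2"
  by (auto simp: L2_def norm_mult power_mult_distrib)

lemma L2_diff: "f \<in> L2 \<Longrightarrow> g \<in> L2 \<Longrightarrow> (\<lambda>x. f x - g x) \<in> L2"
  using L2_add[of f "\<lambda>x. -1 * g x"] L2_scale[of g "-1"] by simp

lemma L2_zero: "(\<lambda>x. 0) \<in> L2"
  by (simp add: L2_def)

lemma L2_sum: "(\<And>i. i \<in> I \<Longrightarrow> f i \<in> L2) \<Longrightarrow> (\<lambda>x. \<Sum>i\<in>I. f i x) \<in> L2"
  by (induction I rule: infinite_finite_induct) (auto intro: L2_add L2_zero)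

lemma L2_eq_refl [simp]: "L2_eq f f"
  by (simp add: L2_eq_def)

lemma L2_eq_sym: "L2_eq f g \<Longrightarrow> L2_eq g f"
  by (simp add: L2_eq_def eq_commute)

lemma L2_eq_trans: "L2_eq f g \<Longrightarrow> L2_eq g h \<Longrightarrow> L2_eq f h"
  unfolding L2_eq_def by (elim AE_mp) (auto intro!: AE_I2)

lemma L2_inner_cong:
  assumes "f \<in> L2" "f' \<in> L2" "g \<in> L2" "g' \<in> L2" "L2_eq f f'" "L2_eq g g'"
  shows "L2_inner f g = L2_inner f' g'"
proof -
  note [measurable] = assms(1-4)[THEN L2_measurable]
  have "AE x in lborel. f x * cnj (g x) = f' x * cnj (g' x)"
    using assms(5,6) unfolding L2_eq_def by eventually_elim simp
  then show ?thesis
    unfolding L2_inner_def by (intro integral_cong_AE) measurable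
qed

lemma L2_inner_add_left:
  "f \<in> L2 \<Longrightarrow> g \<in> L2 \<Longrightarrow> h \<in> L2 \<Longrightarrow> L2_inner (\<lambda>x. f x + g x) h = L2_inner f h + L2_inner g h"
  unfolding L2_inner_def distrib_right
  by (intro Bochner_Integration.integral_add L2_mult_integrable)

lemma L2_inner_scale_left: "L2_inner (\<lambda>x. c * f x) h = c * L2_inner f h"
  unfolding L2_inner_def mult.assoc by simp

lemma L2_inner_cnj: "L2_inner g f = cnj (L2_inner f g)"
  unfolding L2_inner_def
  by (subst Bochner_Integration.integral_cnj[symmetric]) (simp add: mult.commute)

lemma L2_inner_add_right:
  "f \<in> L2 \<Longrightarrow> g \<in> L2 \<Longrightarrow> h \<in> L2 \<Longrightarrow> L2_inner h (\<lambda>x. f x + g x) = L2_inner h f + L2_inner h g"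
  by (simp add: L2_inner_cnj[of h] L2_inner_add_left)

lemma L2_inner_diff_left:
  "f \<in> L2 \<Longrightarrow> g \<in> L2 \<Longrightarrow> h \<in> L2 \<Longrightarrow> L2_inner (\<lambda>x. f x - g x) h = L2_inner f h - L2_inner g h"
  using L2_inner_add_left[of f "\<lambda>x. -1 * g x" h] L2_scale[of g "-1"] L2_inner_scale_left[of "-1" g h] by simp

lemma L2_inner_diff_right:
  "f \<in> L2 \<Longrightarrow> g \<in> L2 \<Longrightarrow> h \<in> L2 \<Longrightarrow> L2_inner h (\<lambda>x. f x - g x) = L2_inner h f - L2_inner h g"
  by (simp add: L2_inner_cnj[of h] L2_inner_diff_left)

lemma L2_inner_sum_left:
  assumes "\<And>i. i \<in> I \<Longrightarrow> f i \<in> L2" "h \<in> L2"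
  shows "L2_inner (\<lambda>x. \<Sum>i\<in>I. a i * f i x) h = (\<Sum>i\<in>I. a i * L2_inner (f i) h)"
  using assms(1)
proof (induction I rule: infinite_finite_induct)
  case (insert i I)
  then show ?case
    using L2_inner_add_left[of "\<lambda>x. a i * f i x" "\<lambda>x. \<Sum>i\<in>I. a i * f i x" h] assms(2)
    by (simp add: L2_scale L2_sum L2_inner_scale_left)
qed (simp_all add: L2_inner_def)

lemma L2_inner_sum_right:
  assumes "\<And>i. i \<in> I \<Longrightarrow> f i \<in> L2" "h \<in> L2"
  shows "L2_inner h (\<lambda>x. \<Sum>i\<in>I. a i * f i x) = (\<Sum>i\<in>I. cnj (a i) * L2_inner h (f i))"
  using L2_inner_sum_left[of I f h a, OF assms] by (simp add: L2_inner_cnj[of h] cnj_sum)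

lemma L2_norm_nonneg: "0 \<le> L2_norm f"
  by (simp add: L2_norm_def)

lemma L2_norm_square: "(L2_norm f)\<^sup>2 = (LINT x|lborel. (cmod (f x))\<^sup>2)"
  by (simp add: L2_norm_def)

lemma L2_inner_self: "L2_inner f f = of_real ((L2_norm f)\<^sup>2)"
  unfolding L2_inner_def L2_norm_square
  by (simp flip: complex_norm_square integral_complex_of_real)

lemma L2_norm_cong:
  assumes "f \<in> L2" "g \<in> L2" "L2_eq f g"
  shows "L2_norm f = L2_norm g"
  using L2_inner_cong[OF assms(1,2,1,2,3,3)] unfolding L2_inner_self of_real_eq_iff
  by (simp add: L2_norm_nonneg)

text \<open>Integrating the pointwise inequality 2ab \<le> e a^2 + b^2 / e gives a bound for every e
  > 0, which is then optimized in e.\<close>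

lemma L2_Cauchy_Schwarz:
  assumes f: "f \<in> L2" and g: "g \<in> L2"
  shows "cmod (L2_inner f g) \<le> L2_norm f * L2_norm g"
proof -
  have *: "2 * cmod (L2_inner f g) \<le> e * (L2_norm f)\<^sup>2 + (L2_norm g)\<^sup>2 / e" if e: "e > 0" for e
  proof -
    have "2 * cmod (L2_inner f g) \<le> 2 * (LINT x|lborel. cmod (f x * cnj (g x)))"
      unfolding L2_inner_def using integral_norm_bound by simp
    also have "\<dots> = (LINT x|lborel. 2 * cmod (f x * cnj (g x)))" by simp
    also have "\<dots> \<le> (LINT x|lborel. e * (cmod (f x))\<^sup>2 + (cmod (g x))\<^sup>2 / e)"
    proof (rule integral_mono)
      show "integrable lborel (\<lambda>x. 2 * cmod (f x * cnj (g x)))"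
        by (intro integrable_mult_right integrable_norm L2_mult_integrable f g)
      show "integrable lborel (\<lambda>x. e * (cmod (f x))\<^sup>2 + (cmod (g x))\<^sup>2 / e)"
        by (intro Bochner_Integration.integrable_add integrable_mult_right integrable_divide L2_integrable f g)
      show "2 * cmod (f x * cnj (g x)) \<le> e * (cmod (f x))\<^sup>2 + (cmod (g x))\<^sup>2 / e" for x
        using sum_squares_bound[of "sqrt e * cmod (f x)" "cmod (g x) / sqrt e"] e
        by (simp add: norm_mult power_mult_distrib power_divide)
    qed
    also have "\<dots> = e * (L2_norm f)\<^sup>2 + (L2_norm g)\<^sup>2 / e"
      unfolding L2_norm_square
      by (subst Bochner_Integration.integral_add)
        (auto intro!: integrable_mult_right integrable_divide L2_integrable f g)
    finally show ?thesis .
  qed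
  define a where "a = L2_norm f"
  define b where "b = L2_norm g"
  have ab: "0 \<le> a" "0 \<le> b" by (simp_all add: a_def b_def L2_norm_nonneg)
  \<comment> \<open>The optimal e is the quotient b / a of the norms. Adding d > 0 to both keeps it
    positive and finite when a norm vanishes; then d tends to 0.\<close>
  have "cmod (L2_inner f g) \<le> (a + d) * (b + d)" if d: "d > 0" for d
  proof -
    have "2 * cmod (L2_inner f g) \<le> (b + d) / (a + d) * a\<^sup>2 + b\<^sup>2 / ((b + d) / (a + d))"
      using *[of "(b + d) / (a + d)"] d ab by (simp add: a_def b_def)
    also have "\<dots> \<le> (b + d) / (a + d) * (a + d)\<^sup>2 + (b + d)\<^sup>2 / ((b + d) / (a + d))"
      using d ab by (intro add_mono mult_left_mono divide_right_mono power_mono) auto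
    also have "\<dots> = 2 * ((a + d) * (b + d))"
    proof -
      have "v / u * u\<^sup>2 + v\<^sup>2 / (v / u) = 2 * (u * v)" if "0 < u" "0 < v" for u v :: real
        using that by (simp add: power2_eq_square)
      then show ?thesis using d ab by simp
    qed
    finally show ?thesis by simp
  qed
  moreover have "((\<lambda>d. (a + d) * (b + d)) \<longlongrightarrow> (a + 0) * (b + 0)) (at_right 0)"
    by (intro tendsto_intros)
  ultimately show ?thesis
    unfolding a_def[symmetric] b_def[symmetric]
    by (intro tendsto_lowerbound[where F="at_right (0::real)" and f="\<lambda>d. (a + d) * (b + d)"])
      (auto simp: eventually_at_right_less intro!: eventually_at_rightI[of 0 1])
qed

lemma L2_norm_triangle:
  assumes f: "f \<in> L2" and g: "g \<in> L2"
  shows "L2_norm (\<lambda>x. f x + g x) \<le> L2_norm f + L2_norm g"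
proof -
  have "of_real ((L2_norm (\<lambda>x. f x + g x))\<^sup>2) =
      L2_inner f f + L2_inner f g + cnj (L2_inner f g) + L2_inner g g"
    unfolding L2_inner_self[symmetric] using L2_inner_cnj[of g f]
    by (simp add: L2_inner_add_left L2_inner_add_right f g L2_add)
  from arg_cong[OF this, of Re]
  have "(L2_norm (\<lambda>x. f x + g x))\<^sup>2 = (L2_norm f)\<^sup>2 + 2 * Re (L2_inner f g) + (L2_norm g)\<^sup>2"
    by (simp add: L2_inner_self)
  also have "\<dots> \<le> (L2_norm f + L2_norm g)\<^sup>2"
    using order_trans[OF complex_Re_le_cmod L2_Cauchy_Schwarz[OF f g]] by (simp add: power2_sum)
  finally show ?thesis
    by (rule power2_le_imp_le) (simp add: L2_norm_nonneg)
qed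

lemma L2_norm_scale: "L2_norm (\<lambda>x. c * f x) = cmod c * L2_norm f"
  by (simp add: L2_norm_def norm_mult power_mult_distrib real_sqrt_mult)

section \<open>Affine substitutions for Lebesgue measure\<close>

lemma nn_integral_lborel_affine:
  fixes t :: "'a::euclidean_space"
  assumes [measurable]: "f \<in> borel_measurable borel" and c: "c \<noteq> 0"
  shows "(\<integral>\<^sup>+x. f x \<partial>lborel) = ennreal (\<bar>c\<bar> ^ DIM('a)) * (\<integral>\<^sup>+x. f (t + c *\<^sub>R x) \<partial>lborel)"
  by (subst lborel_affine[OF c, of t])
    (simp add: nn_integral_density nn_integral_distr nn_integral_cmult)

lemma AE_lborel_affine:
  fixes t :: "'a::euclidean_space"
  assumes "AE x in lborel. P x" "c \<noteq> 0"
  shows "AE x in lborel. P (t + c *\<^sub>R x)"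
proof -
  obtain N where N: "{x. \<not> P x} \<subseteq> N" "emeasure lborel N = 0" "N \<in> sets borel"
    using AE_E[OF assms(1)] by auto
  have "ennreal (\<bar>c\<bar> ^ DIM('a)) * (\<integral>\<^sup>+x. indicator N (t + c *\<^sub>R x) \<partial>lborel) = 0"
    using N nn_integral_lborel_affine[of "indicator N" c t] assms(2) by simp
  then have "(\<integral>\<^sup>+x. indicator N (t + c *\<^sub>R x) \<partial>lborel) = 0"
    using assms(2) by (auto simp: ennreal_eq_0_iff power_le_zero_eq)
  moreover have [measurable]: "N \<in> sets borel" by fact
  ultimately have "AE x in lborel. indicator N (t + c *\<^sub>R x) = (0 :: ennreal)"
    by (subst (asm) nn_integral_0_iff_AE) auto
  then show ?thesis
    by eventually_elim (use N(1) in \<open>auto simp: indicator_def split: if_splits\<close>)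
qed

lemma integrable_lborel_affine:
  fixes t :: "'a::euclidean_space" and f :: "'a \<Rightarrow> 'b::{banach, second_countable_topology}"
  assumes "integrable lborel f" "c \<noteq> 0"
  shows "integrable lborel (\<lambda>x. f (t + c *\<^sub>R x))"
proof -
  have [measurable]: "f \<in> borel_measurable borel" using assms(1) by simp
  have "ennreal (\<bar>c\<bar> ^ DIM('a)) * (\<integral>\<^sup>+x. norm (f (t + c *\<^sub>R x)) \<partial>lborel) < \<infinity>"
    using nn_integral_lborel_affine[of "\<lambda>x. ennreal (norm (f x))" c t] assms
    by (simp add: integrable_iff_bounded)
  then have "(\<integral>\<^sup>+x. norm (f (t + c *\<^sub>R x)) \<partial>lborel) < \<infinity>"
    using assms(2) by (auto simp: ennreal_mult_less_top ennreal_eq_0_iff power_le_zero_eq)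
  then show ?thesis by (simp add: integrable_iff_bounded)
qed

lemma L2_affine:
  fixes t :: "'a::euclidean_space"
  assumes "f \<in> L2" "c \<noteq> 0"
  shows "(\<lambda>x. f (t + c *\<^sub>R x)) \<in> L2"
proof (rule L2_I)
  have [measurable]: "f \<in> borel_measurable borel" using assms(1) by (rule L2_measurable)
  show "(\<lambda>x. f (t + c *\<^sub>R x)) \<in> borel_measurable borel" by measurable
  show "integrable lborel (\<lambda>x. (cmod (f (t + c *\<^sub>R x)))\<^sup>2)"
    by (rule integrable_lborel_affine[OF L2_integrable[OF assms(1)] assms(2)])
qed

section \<open>Uniqueness of the Fourier transform of an integrable function\<close>

lemma AE_zero_if_indicator_integrals_zero_real:
  fixes h :: "'a \<Rightarrow> real"
  assumes h: "integrable M h" and z: "\<And>B. B \<in> sets M \<Longrightarrow> (LINT x|M. indicator B x * h x) = 0"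
  shows "AE x in M. h x = 0"
proof -
  have [measurable]: "h \<in> borel_measurable M" using h by simp
  define A where "A = {x \<in> space M. 0 \<le> h x}"
  define B where "B = {x \<in> space M. h x \<le> 0}"
  have [measurable]: "A \<in> sets M" "B \<in> sets M" unfolding A_def B_def by measurable
  have "integrable M (\<lambda>x. indicator A x * h x)" "integrable M (\<lambda>x. indicator B x * h x)"
    using integrable_mult_indicator[of A M h] integrable_mult_indicator[of B M h] h by auto
  moreover have "AE x in M. 0 \<le> indicator A x * h x" "AE x in M. 0 \<le> - (indicator B x * h x)"
    by (auto intro!: AE_I2 simp: A_def B_def indicator_def)
  ultimately have "AE x in M. indicator A x * h x = 0" "AE x in M. - (indicator B x * h x) = 0"
    using integral_nonneg_eq_0_iff_AE[of M "\<lambda>x. indicator A x * h x"]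
      integral_nonneg_eq_0_iff_AE[of M "\<lambda>x. - (indicator B x * h x)"] z[of A] z[of B] by auto
  moreover have "AE x in M. x \<in> space M" by (rule AE_space)
  ultimately show ?thesis
    by eventually_elim (auto simp: A_def B_def indicator_def split: if_splits)
qed

lemma AE_zero_if_indicator_integrals_zero:
  fixes h :: "'a \<Rightarrow> complex"
  assumes h: "integrable M h" and z: "\<And>B. B \<in> sets M \<Longrightarrow> (LINT x|M. indicator B x * h x) = 0"
  shows "AE x in M. h x = 0"
proof -
  have i: "integrable M (\<lambda>x. indicator B x * h x)" if "B \<in> sets M" for B
    
  proof -
    have "(\<lambda>x. indicator B x * h x) = (\<lambda>x. indicator B x *\<^sub>R h x)"
      by (auto simp: indicator_def fun_eq_iff)
    then show ?thesis using integrable_mult_indicator[OF that h] by simp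
  qed
  have Re_Im_ind: "Re (indicator B x * h x) = indicator B x * Re (h x)"
      "Im (indicator B x * h x) = indicator B x * Im (h x)" for B x
    by (auto simp: indicator_def)
  have "(LINT x|M. indicator B x * Re (h x)) = 0" if "B \<in> sets M" for B
    using integral_Re[OF i[OF that]] z[OF that] unfolding Re_Im_ind by simp
  moreover have "(LINT x|M. indicator B x * Im (h x)) = 0" if "B \<in> sets M" for B
    using integral_Im[OF i[OF that]] z[OF that] unfolding Re_Im_ind by simp
  ultimately have "AE x in M. Re (h x) = 0" "AE x in M. Im (h x) = 0"
    using h by (auto intro!: AE_zero_if_indicator_integrals_zero_real)
  then show ?thesis by eventually_elim (simp add: complex_eq_iff)
qed

text \<open>The bounded Borel functions whose integral against \<open>h\<close> is 0 contain the
  exponentials and are closed under bounded pointwise limits, by dominated convergence with majorant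
  \<open>C * norm (h x)\<close>. \<open>trig_class_indicator\<close> thus reaches all Borel
  indicators.\<close>

lemma Fourier_injective:
  fixes h :: "'a::euclidean_space \<Rightarrow> complex"
  assumes h: "integrable lborel h" and z: "\<And>y. (LINT x|lborel. cis (y \<bullet> x) * h x) = 0"
  shows "AE x in lborel. h x = 0"
proof (rule AE_zero_if_indicator_integrals_zero[OF h])
  fix B :: "'a set" assume "B \<in> sets lborel"
  have hm [measurable]: "h \<in> borel_measurable borel" using h by simp
  define Q where "Q f \<longleftrightarrow> f \<in> borel_measurable borel \<and> (\<exists>C. \<forall>x. cmod (f x) \<le> C) \<and>
      (LINT x|lborel. f x * h x) = 0" for f
  have int: "integrable lborel (\<lambda>x. f x * h x)" if Q: "Q f" for f
  proof -
    obtain C where C: "\<And>x. cmod (f x) \<le> C" using Q unfolding Q_def by blast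
    have [measurable]: "f \<in> borel_measurable borel" using Q unfolding Q_def by blast
    show ?thesis
    proof (rule Bochner_Integration.integrable_bound)
      show "integrable lborel (\<lambda>x. C * norm (h x))" using h by simp
      show "AE x in lborel. norm (f x * h x) \<le> norm (C * norm (h x))"
        
      proof (rule AE_I2)
        fix x
        have "cmod (f x * h x) \<le> C * cmod (h x)"
          unfolding norm_mult by (intro mult_right_mono C) simp
        then show "norm (f x * h x) \<le> norm (C * norm (h x))" by simp
      qed
    qed measurable
  qed
  have "Q (indicator B)"
  proof (rule trig_class_indicator)
    show "Q (\<lambda>x. cis (y \<bullet> x))" for y
      unfolding Q_def using z
      by (auto intro!: exI[of _ 1] borel_measurable_continuous_onI continuous_intros simp: cis_conv_exp)
  next
    fix f g assume Q: "Q f" "Q g"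
    have "(LINT x|lborel. (f x + g x) * h x) = 0"
      using Q int unfolding distrib_right by (subst Bochner_Integration.integral_add) (auto simp: Q_def)
    moreover have "\<exists>C. \<forall>x. cmod (f x + g x) \<le> C"
    proof -
      obtain C D where "\<And>x. cmod (f x) \<le> C" "\<And>x. cmod (g x) \<le> D" using Q unfolding Q_def by blast
      then show ?thesis by (intro exI[of _ "C + D"]) (meson add_mono norm_triangle_ineq order_trans)
    qed
    ultimately show "Q (\<lambda>x. f x + g x)" using Q unfolding Q_def by auto
  next
    fix f c assume Q: "Q f"
    then obtain C where "\<And>x. cmod (f x) \<le> C" unfolding Q_def by blast
    then have "cmod (c * f x) \<le> cmod c * C" for x by (simp add: norm_mult mult_left_mono)
    then show "Q (\<lambda>x. c * f x)" using Q unfolding Q_def by (auto simp: mult.assoc)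
  next
    fix F :: "nat \<Rightarrow> 'a \<Rightarrow> complex" and f C
    assume Q: "\<And>n. Q (F n)" and C: "\<And>n x. cmod (F n x) \<le> C" and lim: "\<And>x. (\<lambda>n. F n x) \<longlonglongrightarrow> f x"
    have [measurable]: "F n \<in> borel_measurable borel" for n using Q unfolding Q_def by blast
    have fm [measurable]: "f \<in> borel_measurable borel"
      by (rule borel_measurable_LIMSEQ_metric[OF _ lim]) measurable
    have "(\<lambda>n. LINT x|lborel. F n x * h x) \<longlonglongrightarrow> (LINT x|lborel. f x * h x)"
    proof (rule integral_dominated_convergence)
      show "integrable lborel (\<lambda>x. C * norm (h x))" using h by simp
      show "AE x in lborel. (\<lambda>n. F n x * h x) \<longlonglongrightarrow> f x * h x"
        by (intro AE_I2 tendsto_mult lim tendsto_const)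
      show "AE x in lborel. norm (F n x * h x) \<le> C * norm (h x)" for n
        using C by (intro AE_I2) (auto simp: norm_mult intro!: mult_right_mono)
    qed measurable
    moreover have "(LINT x|lborel. F n x * h x) = 0" for n using Q unfolding Q_def by blast
    ultimately have "(LINT x|lborel. f x * h x) = 0" using LIMSEQ_unique[OF _ tendsto_const] by force
    moreover have "cmod (f x) \<le> C" for x
      using C by (intro tendsto_upperbound[OF tendsto_norm[OF lim]]) auto
    ultimately show "Q f" unfolding Q_def using fm by blast
  qed (use \<open>B \<in> sets lborel\<close> in simp)
  then show "(LINT x|lborel. indicator B x * h x) = 0" by (simp add: Q_def)
qed

section \<open>The Wigner distribution determines a function up to a phase\<close>

lemma wigner_slice_integrable:
  assumes "f \<in> L2" "g \<in> L2"
  shows "integrable lborel (\<lambda>s. f (x + s /\<^sub>R 2) * cnj (g (x - s /\<^sub>R 2)))"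
  using L2_mult_integrable[OF L2_affine[OF assms(1), of "inverse 2" x] L2_affine[OF assms(2), of "- inverse 2" x]]
  by simp

lemma cross_wigner_cong:
  assumes "f \<in> L2" "f' \<in> L2" "g \<in> L2" "g' \<in> L2" "L2_eq f f'" "L2_eq g g'"
  shows "cross_wigner f g z = cross_wigner f' g' z"
proof -
  note [measurable] = assms(1-4)[THEN L2_measurable]
  have "(LINT s|lborel. exp (- (\<i> * of_real (s \<bullet> y))) * f (x + s /\<^sub>R 2) * cnj (g (x - s /\<^sub>R 2))) =
      (LINT s|lborel. exp (- (\<i> * of_real (s \<bullet> y))) * f' (x + s /\<^sub>R 2) * cnj (g' (x - s /\<^sub>R 2)))" for x y
  proof (rule integral_cong_AE)
    have "AE s in lborel. f (x + inverse 2 *\<^sub>R s) = f' (x + inverse 2 *\<^sub>R s)"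
      using AE_lborel_affine[of "\<lambda>x. f x = f' x" "inverse 2" x] assms(5) by (simp add: L2_eq_def)
    moreover have "AE s in lborel. g (x + (- inverse 2) *\<^sub>R s) = g' (x + (- inverse 2) *\<^sub>R s)"
      using AE_lborel_affine[of "\<lambda>x. g x = g' x" "- inverse 2" x] assms(6) by (simp add: L2_eq_def)
    ultimately show "AE s in lborel. exp (- (\<i> * of_real (s \<bullet> y))) * f (x + s /\<^sub>R 2) * cnj (g (x - s /\<^sub>R 2)) =
        exp (- (\<i> * of_real (s \<bullet> y))) * f' (x + s /\<^sub>R 2) * cnj (g' (x - s /\<^sub>R 2))"
      by eventually_elim simp
  qed measurable
  then show ?thesis unfolding cross_wigner_def Let_def by simp
qed

text \<open>For fixed x the Wigner distribution is, up to a constant and a sign, the Fourier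
  transform of the slice in s, so the difference of the two slices has vanishing transform. This
  holds for every x, not merely almost every x.\<close>

lemma wigner_slices_AE_eq:
  assumes f: "f1 \<in> L2" "f2 \<in> L2"
    and W: "\<And>z. cross_wigner f1 f1 z = cross_wigner f2 f2 z"
  shows "AE s in lborel. f1 (x + s /\<^sub>R 2) * cnj (f1 (x - s /\<^sub>R 2)) = f2 (x + s /\<^sub>R 2) * cnj (f2 (x - s /\<^sub>R 2))"
proof -
  define h where "h f s = f (x + s /\<^sub>R 2) * cnj (f (x - s /\<^sub>R 2))" for f :: "real^'a \<Rightarrow> complex" and s
  have int: "integrable lborel (h f1)" "integrable lborel (h f2)"
    unfolding h_def by (rule wigner_slice_integrable[OF f(1) f(1)], rule wigner_slice_integrable[OF f(2) f(2)])
  have int': "integrable lborel (\<lambda>s. cis (y \<bullet> s) * h f s)" if "integrable lborel (h f)" for f y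
  proof (rule Bochner_Integration.integrable_bound[OF that])
    have "(\<lambda>s. cis (y \<bullet> s)) \<in> borel_measurable lborel"
      by (auto intro!: borel_measurable_continuous_onI continuous_intros simp: cis_conv_exp)
    then show "(\<lambda>s. cis (y \<bullet> s) * h f s) \<in> borel_measurable lborel"
      using that by (intro borel_measurable_times) simp_all
  qed (simp add: norm_mult)
  have "AE s in lborel. h f1 s - h f2 s = 0"
  proof (rule Fourier_injective)
    fix y
    \<comment> \<open>The imaginary part is -y so that the factor exp(-i s . Im z) becomes
      \<open>cis (y \<bullet> s)\<close>, the sign convention of
      \<open>Fourier_injective\<close>.\<close>
    define z where "z = (\<chi> k. Complex (x $ k) (- y $ k))"
    have z: "(\<chi> k. Re (z $ k)) = x" "(\<chi> k. Im (z $ k)) = - y"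
      by (simp_all add: z_def vec_eq_iff)
    have "cross_wigner f f z = of_real ((2 * pi) powr (- real CARD('a) / 2)) * (LINT s|lborel. cis (y \<bullet> s) * h f s)" for f
      unfolding cross_wigner_def Let_def z h_def
      by (simp add: cis_conv_exp inner_commute mult.assoc)
    then have "(LINT s|lborel. cis (y \<bullet> s) * h f1 s) = (LINT s|lborel. cis (y \<bullet> s) * h f2 s)"
      using W[of z] by simp
    then show "(LINT s|lborel. cis (y \<bullet> s) * (h f1 s - h f2 s)) = 0"
      unfolding right_diff_distrib using int' int by simp
  qed (use int in simp)
  then show ?thesis by (simp add: h_def)
qed

text \<open>In the coordinates \<open>u = x + s/2\<close>, \<open>v = x - s/2\<close> the Wigner distribution of \<open>f\<close> is a partial
  Fourier transform of \<open>f(u) cnj(f(v))\<close>, so it determines \<open>f\<close> up to a unimodular factor.\<close>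

lemma tensor_AE_eq_if_wigner_eq:
  assumes f: "f1 \<in> L2" "f2 \<in> L2"
    and W: "\<And>z. cross_wigner f1 f1 z = cross_wigner f2 f2 z"
  shows "AE u in lborel. AE v in lborel. f1 u * cnj (f1 v) = f2 u * cnj (f2 v)"
proof -
  note [measurable] = f[THEN L2_measurable]
  \<comment> \<open>The indicator of the exceptional set of pairs (u, v). As a nonnegative
    measurable function it can be moved through changes of variables and Tonelli, which is how a
    null set in each slice becomes a null set in the product.\<close>
  define I where "I u v = (if f1 u * cnj (f1 v) = f2 u * cnj (f2 v) then 0 else 1 :: ennreal)" for u v
  have [measurable]: "(\<lambda>p. I (fst p) (snd p)) \<in> borel_measurable (borel \<Otimes>\<^sub>M borel)"
    unfolding I_def by measurable
  have Im [measurable]: "(\<lambda>x. I (g x) (h x)) \<in> borel_measurable M"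
    if [measurable]: "g \<in> measurable M borel" "h \<in> measurable M borel" for g h and M :: "'z measure"
    unfolding I_def by measurable
  have "(\<integral>\<^sup>+u. \<integral>\<^sup>+v. I u v \<partial>lborel \<partial>lborel) = (\<integral>\<^sup>+u. \<integral>\<^sup>+s. I u (u + (-1) *\<^sub>R s) \<partial>lborel \<partial>lborel)"
  proof (rule nn_integral_cong)
    fix u :: "real^'a"
    have "(\<lambda>v. I u v) \<in> borel_measurable borel" by measurable
    from nn_integral_lborel_affine[OF this, of "-1" u]
    show "(\<integral>\<^sup>+v. I u v \<partial>lborel) = (\<integral>\<^sup>+s. I u (u + (-1) *\<^sub>R s) \<partial>lborel)" by simp
  qed
  also have "\<dots> = (\<integral>\<^sup>+s. \<integral>\<^sup>+u. I u (u + (-1) *\<^sub>R s) \<partial>lborel \<partial>lborel)"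
    by (rule lborel_pair.Fubini'[symmetric]) measurable
  \<comment> \<open>After v = u - s the order of integration was exchanged, since the shift u = x +
    s/2 depends on s. Both substitutions have scaling factor of modulus 1, so no Jacobian
    appears.\<close>
  also have "\<dots> = (\<integral>\<^sup>+s. \<integral>\<^sup>+x. I (s /\<^sub>R 2 + 1 *\<^sub>R x) (s /\<^sub>R 2 + 1 *\<^sub>R x + (-1) *\<^sub>R s) \<partial>lborel \<partial>lborel)"
  proof (rule nn_integral_cong)
    fix s :: "real^'a"
    show "(\<integral>\<^sup>+u. I u (u + (-1) *\<^sub>R s) \<partial>lborel) =
        (\<integral>\<^sup>+x. I (s /\<^sub>R 2 + 1 *\<^sub>R x) (s /\<^sub>R 2 + 1 *\<^sub>R x + (-1) *\<^sub>R s) \<partial>lborel)"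
    proof -
      have "(\<lambda>u. I u (u + (-1) *\<^sub>R s)) \<in> borel_measurable borel" by measurable
      from nn_integral_lborel_affine[OF this, of 1 "s /\<^sub>R 2"] show ?thesis by simp
    qed
  qed
  also have "\<dots> = (\<integral>\<^sup>+x. \<integral>\<^sup>+s. I (s /\<^sub>R 2 + 1 *\<^sub>R x) (s /\<^sub>R 2 + 1 *\<^sub>R x + (-1) *\<^sub>R s) \<partial>lborel \<partial>lborel)"
    by (rule lborel_pair.Fubini') measurable
  also have "\<dots> = (\<integral>\<^sup>+x. 0 \<partial>(lborel :: (real^'a) measure))"
  proof (rule nn_integral_cong)
    fix x :: "real^'a"
    have "s /\<^sub>R 2 + 1 *\<^sub>R x = x + s /\<^sub>R 2" "s /\<^sub>R 2 + 1 *\<^sub>R x + (-1) *\<^sub>R s = x - s /\<^sub>R 2" for s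
      by (simp_all add: vec_eq_iff field_simps)
    then have shift: "I (s /\<^sub>R 2 + 1 *\<^sub>R x) (s /\<^sub>R 2 + 1 *\<^sub>R x + (-1) *\<^sub>R s) = I (x + s /\<^sub>R 2) (x - s /\<^sub>R 2)" for s
      by (simp only:)
    have "AE s in lborel. I (x + s /\<^sub>R 2) (x - s /\<^sub>R 2) = 0"
      using wigner_slices_AE_eq[OF f W, of x] by eventually_elim (simp add: I_def)
    then show "(\<integral>\<^sup>+s. I (s /\<^sub>R 2 + 1 *\<^sub>R x) (s /\<^sub>R 2 + 1 *\<^sub>R x + (-1) *\<^sub>R s) \<partial>lborel) = 0"
      unfolding shift by (subst nn_integral_0_iff_AE) measurable
  qed
  finally have "(\<integral>\<^sup>+u. \<integral>\<^sup>+v. I u v \<partial>lborel \<partial>lborel) = 0" by simp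
  then have "AE u in lborel. (\<integral>\<^sup>+v. I u v \<partial>lborel) = 0"
    by (subst (asm) nn_integral_0_iff_AE) measurable
  then show ?thesis
  proof eventually_elim
    case (elim u)
    then have "AE v in lborel. I u v = 0"
      by (subst (asm) nn_integral_0_iff_AE) measurable
    then show ?case by eventually_elim (simp add: I_def split: if_splits)
  qed
qed

text \<open>The number |<f,g>|^2 is a double integral of f(u) cnj(f(v)) against cnj(g(u)) g(v),
  hence depends on f only through that tensor. This is how determination up to a phase is used: the
  phase itself is never constructed.\<close>

lemma cmod_L2_inner_eq_if_wigner_eq:
  assumes f: "f1 \<in> L2" "f2 \<in> L2" and g: "g \<in> L2"
    and W: "\<And>z. cross_wigner f1 f1 z = cross_wigner f2 f2 z"
  shows "cmod (L2_inner f1 g) = cmod (L2_inner f2 g)"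
proof -
  note [measurable] = f[THEN L2_measurable] L2_measurable[OF g]
  have "AE u in lborel. (f1 u * cnj (g u)) * L2_inner g f1 = (f2 u * cnj (g u)) * L2_inner g f2"
    using tensor_AE_eq_if_wigner_eq[OF f W]
  proof eventually_elim
    case (elim u)
    have *: "(f u * cnj (g u)) * L2_inner g f = (LINT v|lborel. cnj (g u) * g v * (f u * cnj (f v)))"
      for f :: "real^'a \<Rightarrow> complex"
      unfolding L2_inner_def by (subst integral_mult_right_zero[symmetric]) (simp add: mult_ac)
    show ?case unfolding *
      by (rule integral_cong_AE) (measurable, use elim in \<open>eventually_elim, simp\<close>)
  qed
  then have "(LINT u|lborel. (f1 u * cnj (g u)) * L2_inner g f1) = (LINT u|lborel. (f2 u * cnj (g u)) * L2_inner g f2)"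
    by (intro integral_cong_AE) measurable
  then have "L2_inner f1 g * cnj (L2_inner f1 g) = L2_inner f2 g * cnj (L2_inner f2 g)"
    by (simp add: L2_inner_def[of _ g, symmetric] L2_inner_cnj[of g])
  then have "(cmod (L2_inner f1 g))\<^sup>2 = (cmod (L2_inner f2 g))\<^sup>2"
    unfolding complex_norm_square[symmetric] of_real_eq_iff .
  then show ?thesis by simp
qed

section \<open>Gaussian integrals and coherent states\<close>

text \<open>The characteristic function of the standard normal distribution, with the density's
  normalization removed.\<close>

lemma integral_std_normal_iexp:
  "has_bochner_integral lborel (\<lambda>x. exp (\<i> * of_real (t * x) - of_real (x\<^sup>2) / 2)) (of_real (sqrt (2 * pi) * exp (- t\<^sup>2 / 2)))"
proof -
  have eq: "exp (\<i> * of_real (t * x) - of_real (x\<^sup>2) / 2) = of_real (sqrt (2 * pi)) * (std_normal_density x *\<^sub>R iexp (t * x))" for x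
  proof -
    have "complex_of_real (std_normal_density x) = exp (- (of_real (x\<^sup>2) / 2)) / of_real (sqrt (2 * pi))"
      by (simp add: std_normal_density_def exp_of_real[symmetric])
    moreover have "exp (\<i> * of_real (t * x) - of_real (x\<^sup>2) / 2) = iexp (t * x) * exp (- (of_real (x\<^sup>2) / 2))"
      by (simp only: exp_add[symmetric] diff_conv_add_uminus)
    ultimately show ?thesis
      unfolding scaleR_conv_of_real by (simp only: mult_ac) simp
  qed
  have int: "integrable lborel (\<lambda>x. std_normal_density x *\<^sub>R iexp (t * x))"
  proof (rule Bochner_Integration.integrable_bound)
    show "integrable lborel std_normal_density" using integrable_std_normal_moment[of 0] by simp
  qed (auto simp: std_normal_density_def)
  have "(CLINT x|lborel. std_normal_density x *\<^sub>R iexp (t * x)) = char std_normal_distribution t"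
    unfolding char_def by (subst integral_density) (auto simp: std_normal_density_def)
  also have "\<dots> = of_real (exp (- t\<^sup>2 / 2))" by (simp add: char_std_normal_distribution)
  finally have "has_bochner_integral lborel (\<lambda>x. std_normal_density x *\<^sub>R iexp (t * x)) (of_real (exp (- t\<^sup>2 / 2)))"
    using int by (simp add: has_bochner_integral_iff)
  from has_bochner_integral_mult_right[OF this, of "of_real (sqrt (2 * pi))"]
  show ?thesis unfolding eq by simp
qed

text \<open>The substitution x = p / (2a) + u / c is real, with p the real part of \<open>b\<close>
  and c^2 = 2a. It completes the square for p and leaves the imaginary part q as the frequency q / c
  of \<open>integral_std_normal_iexp\<close>, so the line of integration is not moved into the
  complex plane.\<close>

lemma gaussian_integral_1:
  fixes a :: real and b :: complex
  assumes a: "0 < a"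
  shows "has_bochner_integral lborel (\<lambda>x. exp (b * of_real x - of_real (a * x\<^sup>2)))
    (of_real (sqrt (pi / a)) * exp (b\<^sup>2 / of_real (4 * a)))"
proof -
  define p q where "p = Re b" and "q = Im b"
  have b: "b = of_real p + \<i> * of_real q" by (simp add: p_def q_def complex_eq_iff)
  define c where "c = sqrt (2 * a)"
  have c: "c > 0" "c\<^sup>2 = 2 * a" using a by (simp_all add: c_def)
  define K where "K = exp (of_real (p\<^sup>2 / (4 * a)) + \<i> * of_real (p * q / (2 * a)))"
  have eq: "exp (b * of_real (p / (2 * a) + (1 / c) * u) - of_real (a * (p / (2 * a) + (1 / c) * u)\<^sup>2)) =
      K * exp (\<i> * of_real ((q / c) * u) - of_real (u\<^sup>2) / 2)" for u
  proof -
    have "b * of_real (p / (2 * a) + (1 / c) * u) - of_real (a * (p / (2 * a) + (1 / c) * u)\<^sup>2) =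
        (of_real (p\<^sup>2 / (4 * a)) + \<i> * of_real (p * q / (2 * a))) + (\<i> * of_real ((q / c) * u) - of_real (u\<^sup>2) / 2)"
    proof -
      have "p * (p / (2 * a) + (1 / c) * u) - a * (p / (2 * a) + (1 / c) * u)\<^sup>2 = p\<^sup>2 / (4 * a) - u\<^sup>2 / 2"
      proof -
        have a': "a = c\<^sup>2 / 2" using c by simp
        show ?thesis unfolding a' using c(1) by (simp add: field_simps power2_eq_square)
      qed
      then show ?thesis
        unfolding b by (simp add: complex_eq_iff algebra_simps add_divide_distrib)
    qed
    then show ?thesis unfolding K_def by (simp only: exp_add)
  qed
  have "has_bochner_integral lborel (\<lambda>u. K * exp (\<i> * of_real ((q / c) * u) - of_real (u\<^sup>2) / 2))
      (K * of_real (sqrt (2 * pi) * exp (- (q / c)\<^sup>2 / 2)))"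
    by (intro has_bochner_integral_mult_right integral_std_normal_iexp)
  moreover have "K * of_real (sqrt (2 * pi) * exp (- (q / c)\<^sup>2 / 2)) =
      (of_real (sqrt (pi / a)) * exp (b\<^sup>2 / of_real (4 * a))) /\<^sub>R \<bar>1 / c\<bar>"
  proof -
    have "sqrt (2 * pi) = c * sqrt (pi / a)"
      unfolding c_def using a by (simp flip: real_sqrt_mult)
    have "b\<^sup>2 / of_real (4 * a) =
        (of_real (p\<^sup>2 / (4 * a)) + \<i> * of_real (p * q / (2 * a))) + of_real (- (q / c)\<^sup>2 / 2)"
    proof -
      have *: "(q / c)\<^sup>2 = q\<^sup>2 / (2 * a)" using c by (simp add: power_divide)
      show ?thesis unfolding b * using a by (simp add: complex_eq_iff power2_eq_square field_simps)
    qed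
    then have e: "exp (b\<^sup>2 / of_real (4 * a)) = K * of_real (exp (- (q / c)\<^sup>2 / 2))"
      unfolding K_def by (simp only: exp_add exp_of_real)
    moreover note \<open>sqrt (2 * pi) = c * sqrt (pi / a)\<close>
    ultimately show ?thesis
      unfolding e using c(1) by (simp add: scaleR_conv_of_real)
  qed
  ultimately have "has_bochner_integral lborel
      (\<lambda>u. exp (b * of_real (p / (2 * a) + (1 / c) * u) - of_real (a * (p / (2 * a) + (1 / c) * u)\<^sup>2)))
      ((of_real (sqrt (pi / a)) * exp (b\<^sup>2 / of_real (4 * a))) /\<^sub>R \<bar>1 / c\<bar>)"
    unfolding eq by simp
  then show ?thesis
    using lborel_has_bochner_integral_real_affine_iff[of "1 / c"
        "\<lambda>x. exp (b * of_real x - of_real (a * x\<^sup>2))" _ "p / (2 * a)"] c(1) by simp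
qed

text \<open>By \<open>lborel_eq\<close>, Lebesgue measure is the image of a product measure indexed
  by \<open>Basis\<close>. The bijection \<open>e\<close> reindexes that product by the coordinates
  of the vector type.\<close>

lemma has_bochner_integral_lborel_prod:
  fixes f :: "'n::finite \<Rightarrow> real \<Rightarrow> complex"
  assumes f: "\<And>k. has_bochner_integral lborel (f k) (I k)"
  shows "has_bochner_integral lborel (\<lambda>x :: real^'n. \<Prod>k\<in>UNIV. f k (x $ k)) (\<Prod>k\<in>UNIV. I k)"
proof -
  define e :: "'n \<Rightarrow> real^'n" where "e k = axis k 1" for k
  have inj: "inj e" by (auto simp: inj_def e_def axis_eq_axis)
  have Basis: "Basis = range e" by (auto simp: Basis_vec_def e_def)
  have re: "(\<Prod>b\<in>Basis. G (inv e b) b) = (\<Prod>k\<in>UNIV. G k (e k))" for G :: "'n \<Rightarrow> real^'n \<Rightarrow> complex"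
    unfolding Basis using inj by (subst prod.reindex) (simp_all add: inv_f_f)
  interpret product_sigma_finite "\<lambda>_ :: real^'n. lborel :: real measure"
    by standard
  have fi: "integrable lborel (f k)" "integral\<^sup>L lborel (f k) = I k" for k
    using f[of k] by (simp_all add: has_bochner_integral_iff)
  have [measurable]: "f k \<in> borel_measurable borel" for k
    using borel_measurable_integrable[OF fi(1)[of k]] by simp
  let ?T = "\<lambda>g. \<Sum>b\<in>Basis. g b *\<^sub>R (b :: real^'n)"
  let ?F = "\<lambda>x :: real^'n. \<Prod>k\<in>UNIV. f k (x $ k)"
  have T: "?F (?T g) = (\<Prod>b\<in>Basis. f (inv e b) (g b))" for g
  proof -
    have "?T g $ k = g (e k)" for k
      using inner_sum_left_Basis[of "e k" g] by (simp add: Basis e_def inner_axis)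
    then show ?thesis using re[of "\<lambda>k b. f k (g b)"] by simp
  qed
  have Tm: "?T \<in> measurable (\<Pi>\<^sub>M b\<in>Basis. lborel) borel" by measurable
  have Fm: "?F \<in> borel_measurable borel" by measurable
  have "integrable (\<Pi>\<^sub>M b\<in>Basis. lborel) (\<lambda>g. \<Prod>b\<in>Basis. f (inv e b) (g b))"
    by (rule product_integrable_prod) (simp_all add: fi)
  moreover have "(\<integral>g. (\<Prod>b\<in>Basis. f (inv e b) (g b)) \<partial>(\<Pi>\<^sub>M b\<in>Basis. lborel)) = (\<Prod>k\<in>UNIV. I k)"
    using re[of "\<lambda>k b. I k"] by (subst product_integral_prod) (simp_all add: fi)
  ultimately show ?thesis
    unfolding lborel_eq[where 'a="real^'n"] has_bochner_integral_iff integrable_distr_eq[OF Tm Fm] integral_distr[OF Tm Fm] T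
    by blast
qed

lemma gaussian_integral:
  fixes a :: "'n::finite \<Rightarrow> real" and b c d :: "'n \<Rightarrow> complex"
  assumes a: "\<And>k. 0 < a k"
  shows "has_bochner_integral lborel
    (\<lambda>x :: real^'n. \<Prod>k\<in>UNIV. d k * exp (c k + b k * of_real (x $ k) - of_real (a k * (x $ k)\<^sup>2)))
    (\<Prod>k\<in>UNIV. d k * of_real (sqrt (pi / a k)) * exp (c k + (b k)\<^sup>2 / of_real (4 * a k)))"
proof (rule has_bochner_integral_lborel_prod)
  fix k
  have "has_bochner_integral lborel (\<lambda>x. (d k * exp (c k)) * exp (b k * of_real x - of_real (a k * x\<^sup>2)))
    ((d k * exp (c k)) * (of_real (sqrt (pi / a k)) * exp ((b k)\<^sup>2 / of_real (4 * a k))))"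
    by (intro has_bochner_integral_mult_right gaussian_integral_1 a)
  moreover have "(d k * exp (c k)) * exp (b k * of_real x - of_real (a k * x\<^sup>2)) =
      d k * exp (c k + b k * of_real x - of_real (a k * x\<^sup>2))" for x
    by (simp only: mult.assoc exp_add[symmetric] add_diff_eq)
  moreover have "(d k * exp (c k)) * (of_real (sqrt (pi / a k)) * exp ((b k)\<^sup>2 / of_real (4 * a k))) =
      d k * of_real (sqrt (pi / a k)) * exp (c k + (b k)\<^sup>2 / of_real (4 * a k))"
    by (simp add: exp_add)
  ultimately show "has_bochner_integral lborel (\<lambda>x. d k * exp (c k + b k * of_real x - of_real (a k * x\<^sup>2)))
      (d k * of_real (sqrt (pi / a k)) * exp (c k + (b k)\<^sup>2 / of_real (4 * a k)))"
    by (simp only:)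
qed

text \<open>For l = 1 this is, up to a power of pi, the Bargmann kernel, the generating function of
  the Hermite functions. It is left unnormalized so that it is holomorphic in w and overlaps are
  exponentials of w cnj(v). For general l it is the unitary dilation of that state, the expected
  image under \<open>diag_symp l\<close>.\<close>

definition squeezed :: "real^'n \<Rightarrow> complex^'n \<Rightarrow> real^'n::finite \<Rightarrow> complex" where
  "squeezed l w x = (\<Prod>k\<in>UNIV. of_real (1 / sqrt (l $ k)) *
     exp (of_real (sqrt 2) * w $ k * of_real (x $ k / l $ k) - of_real ((x $ k / l $ k)\<^sup>2 / 2) - (w $ k)\<^sup>2 / 2))"

definition coherent :: "complex^'n \<Rightarrow> real^'n::finite \<Rightarrow> complex" where
  "coherent = squeezed 1"

lemma squeezed_borel [measurable]: "squeezed l w \<in> borel_measurable borel"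
  unfolding squeezed_def[abs_def] by measurable

lemma squeezed_L2:
  assumes l: "\<And>k. 0 < l $ k"
  shows "squeezed l w \<in> L2"
proof (rule L2_I)
  have "integrable lborel (\<lambda>x :: real^'a. \<Prod>k\<in>UNIV. of_real (1 / l $ k) * exp ((- (w $ k)\<^sup>2 / 2 - (cnj (w $ k))\<^sup>2 / 2) +
      (of_real (sqrt 2 / l $ k) * (w $ k + cnj (w $ k))) * of_real (x $ k) - of_real (1 / (l $ k)\<^sup>2 * (x $ k)\<^sup>2)))"
    by (rule integrable.intros, rule gaussian_integral) (use l in \<open>simp add: less_imp_neq[symmetric]\<close>)
  moreover have "of_real ((cmod (squeezed l w x))\<^sup>2) = (\<Prod>k\<in>UNIV. of_real (1 / l $ k) * exp ((- (w $ k)\<^sup>2 / 2 - (cnj (w $ k))\<^sup>2 / 2) +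
      (of_real (sqrt 2 / l $ k) * (w $ k + cnj (w $ k))) * of_real (x $ k) - of_real (1 / (l $ k)\<^sup>2 * (x $ k)\<^sup>2)))" for x
    unfolding complex_norm_square squeezed_def cnj_prod prod.distrib[symmetric]
  proof (rule prod.cong[OF refl])
    fix k
    have lk: "l $ k > 0" "sqrt (l $ k) > 0" using l by auto
    show "of_real (1 / sqrt (l $ k)) *
        exp (of_real (sqrt 2) * w $ k * of_real (x $ k / l $ k) - of_real ((x $ k / l $ k)\<^sup>2 / 2) - (w $ k)\<^sup>2 / 2) *
        cnj (of_real (1 / sqrt (l $ k)) *
        exp (of_real (sqrt 2) * w $ k * of_real (x $ k / l $ k) - of_real ((x $ k / l $ k)\<^sup>2 / 2) - (w $ k)\<^sup>2 / 2)) =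
       of_real (1 / l $ k) * exp ((- (w $ k)\<^sup>2 / 2 - (cnj (w $ k))\<^sup>2 / 2) +
      (of_real (sqrt 2 / l $ k) * (w $ k + cnj (w $ k))) * of_real (x $ k) - of_real (1 / (l $ k)\<^sup>2 * (x $ k)\<^sup>2))"
      (is "?a * exp ?e * cnj (?a * exp ?e) = ?b * exp ?f")
    proof -
      have "?a * exp ?e * cnj (?a * exp ?e) = (?a * cnj ?a) * exp (?e + cnj ?e)"
        by (simp only: complex_cnj_mult exp_cnj exp_add mult_ac)
      also have "?a * cnj ?a = ?b" using lk by (simp flip: of_real_mult)
      also have "?e + cnj ?e = ?f" by (simp add: power_divide algebra_simps add_divide_distrib)
      finally show ?thesis .
    qed
  qed
  ultimately have "integrable lborel (\<lambda>x. complex_of_real ((cmod (squeezed l w x))\<^sup>2))" by simp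
  then show "integrable lborel (\<lambda>x. (cmod (squeezed l w x))\<^sup>2)"
    by (simp only: complex_of_real_integrable_eq)
qed simp

lemma coherent_L2: "coherent w \<in> L2"
  unfolding coherent_def by (rule squeezed_L2) simp

text \<open>Completing the square produces the two coefficients 2l / (l^2 + 1) and (l^2 - 1) / (l^2
  + 1), whose squares add up to 1. The first one also sits under the square root in front; all decay
  in l comes from there.\<close>

lemma L2_inner_squeezed_coherent:
  assumes l: "\<And>k. 0 < l $ k"
  shows "L2_inner (squeezed l w) (coherent v) =
    (\<Prod>k\<in>UNIV. of_real (sqrt (pi * (2 * l $ k / ((l $ k)\<^sup>2 + 1)))) *
      exp (of_real (2 * l $ k / ((l $ k)\<^sup>2 + 1)) * (w $ k * cnj (v $ k)) +
           of_real (((l $ k)\<^sup>2 - 1) / ((l $ k)\<^sup>2 + 1)) * ((cnj (v $ k))\<^sup>2 - (w $ k)\<^sup>2) / 2))"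
proof -
  \<comment> \<open>Each factor of the integrand is \<open>D k\<close> times the exponential of a
    quadratic polynomial with coefficients \<open>C k\<close>, \<open>B k\<close> and
    \<open>- A k\<close>. The last one adds the two widths 1/2 and 1 / (2 l^2).\<close>
  define A where "A k = ((l $ k)\<^sup>2 + 1) / (2 * (l $ k)\<^sup>2)" for k
  define B where "B k = of_real (sqrt 2) * (w $ k / of_real (l $ k) + cnj (v $ k))" for k
  define C where "C k = - (w $ k)\<^sup>2 / 2 - (cnj (v $ k))\<^sup>2 / 2" for k
  define D where "D k = complex_of_real (1 / sqrt (l $ k))" for k
  have "squeezed l w x * cnj (coherent v x) =
      (\<Prod>k\<in>UNIV. D k * exp (C k + B k * of_real (x $ k) - of_real (A k * (x $ k)\<^sup>2)))" for x
    unfolding coherent_def squeezed_def cnj_prod prod.distrib[symmetric]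
  proof (rule prod.cong[OF refl])
    fix k
    define X where "X = x $ k"
    have lk: "l $ k > 0" using l by auto
    have "of_real (sqrt 2) * w $ k * of_real (X / l $ k) - of_real ((X / l $ k)\<^sup>2 / 2) - (w $ k)\<^sup>2 / 2 +
        (of_real (sqrt 2) * cnj (v $ k) * of_real X - of_real (X\<^sup>2 / 2) - (cnj (v $ k))\<^sup>2 / 2) =
        C k + B k * of_real X - of_real (A k * X\<^sup>2)"
    proof -
      have "(X / l $ k)\<^sup>2 / 2 + X\<^sup>2 / 2 = A k * X\<^sup>2"
        using lk by (simp add: A_def field_simps)
      then have "complex_of_real ((X / l $ k)\<^sup>2 / 2) + of_real (X\<^sup>2 / 2) = of_real (A k * X\<^sup>2)"
        by (simp only: of_real_add[symmetric])
      moreover have "of_real (sqrt 2) * w $ k * of_real (X / l $ k) + of_real (sqrt 2) * cnj (v $ k) * of_real X =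
          B k * of_real X"
        unfolding B_def by (simp add: algebra_simps)
      moreover have comb: "a - e - c + (b - f - d) = (- c - d) + g - h" if "e + f = h" "a + b = g"
        for a b c d e f g h :: complex
        unfolding that[symmetric] by simp
      ultimately show ?thesis unfolding C_def minus_divide_left[symmetric] by (intro comb)
    qed
    then show "of_real (1 / sqrt (l $ k)) *
        exp (of_real (sqrt 2) * w $ k * of_real (x $ k / l $ k) - of_real ((x $ k / l $ k)\<^sup>2 / 2) - (w $ k)\<^sup>2 / 2) *
        cnj (of_real (1 / sqrt ((1 :: real^'a) $ k)) *
        exp (of_real (sqrt 2) * v $ k * of_real (x $ k / (1 :: real^'a) $ k) - of_real ((x $ k / (1 :: real^'a) $ k)\<^sup>2 / 2) - (v $ k)\<^sup>2 / 2)) =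
       D k * exp (C k + B k * of_real (x $ k) - of_real (A k * (x $ k)\<^sup>2))"
      unfolding X_def[symmetric] D_def
      by (simp add: exp_cnj exp_add[symmetric])
  qed
  moreover have "has_bochner_integral lborel
    (\<lambda>x :: real^'a. \<Prod>k\<in>UNIV. D k * exp (C k + B k * of_real (x $ k) - of_real (A k * (x $ k)\<^sup>2)))
    (\<Prod>k\<in>UNIV. D k * of_real (sqrt (pi / A k)) * exp (C k + (B k)\<^sup>2 / of_real (4 * A k)))"
  proof (rule gaussian_integral)
    show "0 < A k" for k using l[of k] by (simp add: A_def add_pos_pos)
  qed
  ultimately have "L2_inner (squeezed l w) (coherent v) =
      (\<Prod>k\<in>UNIV. D k * of_real (sqrt (pi / A k)) * exp (C k + (B k)\<^sup>2 / of_real (4 * A k)))"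
    unfolding L2_inner_def by (simp add: has_bochner_integral_integral_eq)
  also have "\<dots> = (\<Prod>k\<in>UNIV. of_real (sqrt (pi * (2 * l $ k / ((l $ k)\<^sup>2 + 1)))) *
      exp (of_real (2 * l $ k / ((l $ k)\<^sup>2 + 1)) * (w $ k * cnj (v $ k)) +
           of_real (((l $ k)\<^sup>2 - 1) / ((l $ k)\<^sup>2 + 1)) * ((cnj (v $ k))\<^sup>2 - (w $ k)\<^sup>2) / 2))"
  proof (rule prod.cong[OF refl])
    fix k
    define L where "L = l $ k"
    have L: "L > 0" "L\<^sup>2 + 1 > 0" "L\<^sup>2 + 1 \<noteq> 0" using l by (auto simp: L_def add_nonneg_pos add_nonneg_eq_0_iff)
    have "1 / sqrt L * sqrt (pi / A k) = sqrt (pi * (2 * L / (L\<^sup>2 + 1)))"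
    proof -
      have "1 / sqrt L * sqrt (pi / A k) = sqrt (1 / L * (pi / A k))"
        by (simp only: real_sqrt_mult real_sqrt_divide real_sqrt_one)
      also have "1 / L * (pi / A k) = pi * (2 * L / (L\<^sup>2 + 1))"
        unfolding A_def L_def[symmetric] using L by (simp add: power2_eq_square)
      finally show ?thesis .
    qed
    then have 1: "D k * of_real (sqrt (pi / A k)) = of_real (sqrt (pi * (2 * L / (L\<^sup>2 + 1))))"
      unfolding D_def L_def[symmetric] by (simp only: of_real_mult[symmetric])
    have 2: "C k + (B k)\<^sup>2 / of_real (4 * A k) = of_real (2 * L / (L\<^sup>2 + 1)) * (w $ k * cnj (v $ k)) +
           of_real ((L\<^sup>2 - 1) / (L\<^sup>2 + 1)) * ((cnj (v $ k))\<^sup>2 - (w $ k)\<^sup>2) / 2"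
    proof -
      define s where "s = complex_of_real L"
      have "complex_of_real (L\<^sup>2 + 1) \<noteq> 0" using L(3) unfolding of_real_eq_0_iff .
      then have s: "s \<noteq> 0" "s\<^sup>2 + 1 \<noteq> 0"
        using L unfolding s_def by simp_all
      have sq2: "(complex_of_real (sqrt 2))\<^sup>2 = 2"
        by (simp flip: of_real_power)
      have "4 * A k = 2 * (L\<^sup>2 + 1) / L\<^sup>2"
        unfolding A_def L_def[symmetric] using L by (simp add: field_simps)
      then have A4: "complex_of_real (4 * A k) = 2 * (s\<^sup>2 + 1) / s\<^sup>2"
        unfolding s_def by simp
      have "(B k)\<^sup>2 / of_real (4 * A k) = 2 * (w $ k / s + cnj (v $ k))\<^sup>2 / (2 * (s\<^sup>2 + 1) / s\<^sup>2)"
        unfolding B_def A4 power_mult_distrib sq2 L_def[symmetric] s_def ..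
      also have "\<dots> = (w $ k + s * cnj (v $ k))\<^sup>2 / (s\<^sup>2 + 1)"
      proof -
        have "w $ k / s + cnj (v $ k) = (w $ k + s * cnj (v $ k)) / s" using s by (simp add: field_simps)
        moreover have "2 * (u / s)\<^sup>2 / (2 * T / s\<^sup>2) = u\<^sup>2 / T" for u T
          using s(1) by (simp add: power_divide)
        ultimately show ?thesis by (simp only:)
      qed
      finally have BA: "(B k)\<^sup>2 / of_real (4 * A k) = (w $ k + s * cnj (v $ k))\<^sup>2 / (s\<^sup>2 + 1)" .
      \<comment> \<open>Here \<open>s\<close> is the dilation parameter l itself, not the
        coefficient 2l / (l^2 + 1). The identity is proved after multiplication by T.\<close>
      have "- a\<^sup>2 / 2 - b\<^sup>2 / 2 + (a + s * b)\<^sup>2 / T = 2 * s / T * (a * b) + (s\<^sup>2 - 1) / T * (b\<^sup>2 - a\<^sup>2) / 2"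
        if T: "T = s\<^sup>2 + 1" "T \<noteq> 0" for a b T :: complex
      proof -
        have "(- a\<^sup>2 / 2 - b\<^sup>2 / 2 + (a + s * b)\<^sup>2 / T) * T = (- a\<^sup>2 / 2 - b\<^sup>2 / 2) * T + (a + s * b)\<^sup>2"
          using T(2) by (simp add: distrib_right)
        also have "\<dots> = 2 * s * (a * b) + (s\<^sup>2 - 1) * (b\<^sup>2 - a\<^sup>2) / 2"
          unfolding T(1) by (simp add: power2_eq_square field_simps)
        also have "\<dots> = (2 * s / T * (a * b) + (s\<^sup>2 - 1) / T * (b\<^sup>2 - a\<^sup>2) / 2) * T"
          using T(2) by (simp add: distrib_right)
        finally show ?thesis using T(2) by simp
      qed
      from this[OF refl s(2)] show ?thesis
        unfolding BA unfolding C_def s_def by simp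
    qed
    show "D k * of_real (sqrt (pi / A k)) * exp (C k + (B k)\<^sup>2 / of_real (4 * A k)) =
      of_real (sqrt (pi * (2 * l $ k / ((l $ k)\<^sup>2 + 1)))) *
      exp (of_real (2 * l $ k / ((l $ k)\<^sup>2 + 1)) * (w $ k * cnj (v $ k)) +
           of_real (((l $ k)\<^sup>2 - 1) / ((l $ k)\<^sup>2 + 1)) * ((cnj (v $ k))\<^sup>2 - (w $ k)\<^sup>2) / 2)"
      using 1 2 unfolding L_def by (simp only:)
  qed
  finally show ?thesis .
qed

lemma L2_inner_coherent:
  "L2_inner (coherent w) (coherent v) = (\<Prod>k\<in>UNIV. of_real (sqrt pi) * exp (w $ k * cnj (v $ k)))"
  using L2_inner_squeezed_coherent[of 1 w v] by (simp add: coherent_def)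

text \<open>The point \<open>\<zeta>\<close> is the image of z under the inverse of
  \<open>diag_symp l\<close>, and l enters the right side only through it. Dilation covariance can
  therefore be read off by comparison with the case l = 1.\<close>

lemma cross_wigner_squeezed:
  fixes l :: "real^'n::finite" and z :: "complex^'n"
  assumes l: "\<And>k. 0 < l $ k"
  defines "\<zeta> \<equiv> (\<lambda>k. Complex (Re (z $ k) / l $ k) (l $ k * Im (z $ k)))"
  shows "cross_wigner (squeezed l w) (squeezed l v) z =
    of_real ((2 * pi) powr (- real CARD('n) / 2)) *
    (\<Prod>k\<in>UNIV. of_real (2 * sqrt pi) *
      exp (of_real (sqrt 2) * (w $ k * cnj (\<zeta> k) + cnj (v $ k) * \<zeta> k) - \<zeta> k * cnj (\<zeta> k) - w $ k * cnj (v $ k)))"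
proof -
  define x :: "real^'n" where "x = (\<chi> k. Re (z $ k))"
  define y :: "real^'n" where "y = (\<chi> k. Im (z $ k))"
  define A where "A k = 1 / (4 * (l $ k)\<^sup>2)" for k
  define B where "B k = of_real (sqrt 2 / (2 * l $ k)) * (w $ k - cnj (v $ k)) - \<i> * of_real (y $ k)" for k
  define C where "C k = of_real (sqrt 2 * x $ k / l $ k) * (w $ k + cnj (v $ k)) - of_real ((x $ k / l $ k)\<^sup>2)
      - (w $ k)\<^sup>2 / 2 - (cnj (v $ k))\<^sup>2 / 2" for k
  define D where "D k = complex_of_real (1 / l $ k)" for k
  have "exp (- (\<i> * of_real (s \<bullet> y))) * squeezed l w (x + s /\<^sub>R 2) * cnj (squeezed l v (x - s /\<^sub>R 2)) =
      (\<Prod>k\<in>UNIV. D k * exp (C k + B k * of_real (s $ k) - of_real (A k * (s $ k)\<^sup>2)))" for s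
  proof -
    have e: "exp (- (\<i> * of_real (s \<bullet> y))) = (\<Prod>k\<in>UNIV. exp (- (\<i> * of_real (s $ k * y $ k))))"
      by (simp add: inner_vec_def sum_distrib_left sum_negf[symmetric] exp_sum)
    show ?thesis
      unfolding squeezed_def cnj_prod e prod.distrib[symmetric]
    proof (rule prod.cong[OF refl])
      fix k
      define X where "X = x $ k"
      define Y where "Y = y $ k"
      define S where "S = s $ k"
      define L where "L = l $ k"
      have xs: "(x + s /\<^sub>R 2) $ k = X + S / 2" "(x - s /\<^sub>R 2) $ k = X - S / 2"
        by (simp_all add: X_def S_def)
      define e1 where "e1 = of_real (sqrt 2) * w $ k * of_real ((X + S / 2) / L) -
          of_real (((X + S / 2) / L)\<^sup>2 / 2) - (w $ k)\<^sup>2 / 2"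
      define e2 where "e2 = of_real (sqrt 2) * v $ k * of_real ((X - S / 2) / L) -
          of_real (((X - S / 2) / L)\<^sup>2 / 2) - (v $ k)\<^sup>2 / 2"
      have lk: "L > 0" using l by (auto simp: L_def)
      have 1: "- (\<i> * of_real (S * Y)) + e1 + cnj e2 = C k + B k * of_real S - of_real (A k * S\<^sup>2)"
      proof -
        have "((X + S / 2) / L)\<^sup>2 / 2 + ((X - S / 2) / L)\<^sup>2 / 2 = (X / L)\<^sup>2 + A k * S\<^sup>2"
          unfolding A_def L_def[symmetric] using lk by (simp add: field_simps power2_eq_square)
        then have "complex_of_real (((X + S / 2) / L)\<^sup>2 / 2) + of_real (((X - S / 2) / L)\<^sup>2 / 2) =
            of_real ((X / L)\<^sup>2) + of_real (A k * S\<^sup>2)"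
          by (simp only: of_real_add[symmetric])
        then have q: "of_real (((X - S / 2) / L)\<^sup>2 / 2) =
            of_real ((X / L)\<^sup>2) + of_real (A k * S\<^sup>2) - complex_of_real (((X + S / 2) / L)\<^sup>2 / 2)"
          by (simp only: algebra_simps)
        have "of_real (sqrt 2) * w $ k * of_real ((X + S / 2) / L) +
            of_real (sqrt 2) * cnj (v $ k) * of_real ((X - S / 2) / L) =
            of_real (sqrt 2 * X / L) * (w $ k + cnj (v $ k)) + of_real (sqrt 2 / (2 * L)) * (w $ k - cnj (v $ k)) * of_real S"
          using lk by (simp add: field_simps)
        then have r: "of_real (sqrt 2) * cnj (v $ k) * of_real ((X - S / 2) / L) =
            of_real (sqrt 2 * X / L) * (w $ k + cnj (v $ k)) + of_real (sqrt 2 / (2 * L)) * (w $ k - cnj (v $ k)) * of_real S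
            - of_real (sqrt 2) * w $ k * of_real ((X + S / 2) / L)"
          by (simp only: algebra_simps)
        have c2: "cnj e2 = of_real (sqrt 2) * cnj (v $ k) * of_real ((X - S / 2) / L) -
            of_real (((X - S / 2) / L)\<^sup>2 / 2) - (cnj (v $ k))\<^sup>2 / 2"
          unfolding e2_def by simp
        show ?thesis
          unfolding c2 q r e1_def B_def C_def X_def[symmetric] Y_def[symmetric] S_def[symmetric] L_def[symmetric]
            of_real_mult[of S Y]
          by (simp only: algebra_simps add_minus_cancel minus_add_cancel)
      qed
      have 2: "complex_of_real (1 / sqrt L) * cnj (of_real (1 / sqrt L)) = D k"
        unfolding D_def L_def[symmetric] using lk by (simp flip: of_real_mult)
      have 3: "exp (- (\<i> * of_real (S * Y))) * (of_real (1 / sqrt L) * exp e1) * cnj (of_real (1 / sqrt L) * exp e2) =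
          (of_real (1 / sqrt L) * cnj (of_real (1 / sqrt L))) * exp (- (\<i> * of_real (S * Y)) + e1 + cnj e2)"
        by (simp only: complex_cnj_mult exp_cnj exp_add mult_ac)
      show "exp (- (\<i> * of_real (s $ k * y $ k))) * (of_real (1 / sqrt (l $ k)) * exp (of_real (sqrt 2) * w $ k * of_real ((x + s /\<^sub>R 2) $ k / l $ k) -
          of_real (((x + s /\<^sub>R 2) $ k / l $ k)\<^sup>2 / 2) - (w $ k)\<^sup>2 / 2)) * cnj (of_real (1 / sqrt (l $ k)) * exp (of_real (sqrt 2) * v $ k * of_real ((x - s /\<^sub>R 2) $ k / l $ k) -
          of_real (((x - s /\<^sub>R 2) $ k / l $ k)\<^sup>2 / 2) - (v $ k)\<^sup>2 / 2)) =
          D k * exp (C k + B k * of_real (s $ k) - of_real (A k * (s $ k)\<^sup>2))"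
        unfolding xs L_def[symmetric] e1_def[symmetric] e2_def[symmetric] S_def[symmetric] Y_def[symmetric] 3 2 1
        by (rule refl)
    qed
  qed
  moreover have "has_bochner_integral lborel
    (\<lambda>s :: real^'n. \<Prod>k\<in>UNIV. D k * exp (C k + B k * of_real (s $ k) - of_real (A k * (s $ k)\<^sup>2)))
    (\<Prod>k\<in>UNIV. D k * of_real (sqrt (pi / A k)) * exp (C k + (B k)\<^sup>2 / of_real (4 * A k)))"
  proof (rule gaussian_integral)
    show "0 < A k" for k using l[of k] by (simp add: A_def)
  qed
  ultimately have "cross_wigner (squeezed l w) (squeezed l v) z = of_real ((2 * pi) powr (- real CARD('n) / 2)) *
      (\<Prod>k\<in>UNIV. D k * of_real (sqrt (pi / A k)) * exp (C k + (B k)\<^sup>2 / of_real (4 * A k)))"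
    unfolding cross_wigner_def Let_def x_def[symmetric] y_def[symmetric]
    by (simp add: has_bochner_integral_integral_eq)
  also have "(\<Prod>k\<in>UNIV. D k * of_real (sqrt (pi / A k)) * exp (C k + (B k)\<^sup>2 / of_real (4 * A k))) =
      (\<Prod>k\<in>UNIV. of_real (2 * sqrt pi) *
      exp (of_real (sqrt 2) * (w $ k * cnj (\<zeta> k) + cnj (v $ k) * \<zeta> k) - \<zeta> k * cnj (\<zeta> k) - w $ k * cnj (v $ k)))"
  proof (rule prod.cong[OF refl])
    fix k
    define L where "L = l $ k"
    have L: "L > 0" using l by (auto simp: L_def)
    define X where "X = complex_of_real (x $ k / L)"
    define Y where "Y = complex_of_real (L * y $ k)"
    have z: "\<zeta> k = X + \<i> * Y" "cnj (\<zeta> k) = X - \<i> * Y"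
      by (simp_all add: \<zeta>_def X_def Y_def x_def y_def L_def complex_eq_iff)
    have "1 / L * sqrt (pi / A k) = 2 * sqrt pi"
    proof -
      have "pi / A k = pi * (2 * L)\<^sup>2" unfolding A_def L_def[symmetric] by (simp only: power_mult_distrib) simp
      then have "sqrt (pi / A k) = sqrt pi * (2 * L)" using L by (simp add: real_sqrt_mult)
      then show ?thesis using L by simp
    qed
    then have 1: "D k * of_real (sqrt (pi / A k)) = of_real (2 * sqrt pi)"
      unfolding D_def L_def[symmetric] by (simp only: of_real_mult[symmetric])
    have sq2: "(complex_of_real (sqrt 2))\<^sup>2 = 2"
      by (simp flip: of_real_power)
    define q where "q = complex_of_real (sqrt 2)"
    have "B k = (q / 2 * (w $ k - cnj (v $ k)) - \<i> * Y) / of_real L"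
      unfolding B_def L_def[symmetric] q_def Y_def using L by (simp add: field_simps)
    moreover have "complex_of_real (4 * A k) = 1 / (of_real L)\<^sup>2"
      unfolding A_def L_def[symmetric] by simp
    ultimately have "(B k)\<^sup>2 / of_real (4 * A k) = (q / 2 * (w $ k - cnj (v $ k)) - \<i> * Y)\<^sup>2"
      using L by (simp only: power_divide) simp
    also have "\<dots> = (w $ k - cnj (v $ k))\<^sup>2 / 2 - \<i> * Y * q * (w $ k - cnj (v $ k)) - Y\<^sup>2"
    proof -
      have "(q / 2 * d - \<i> * Y)\<^sup>2 = q\<^sup>2 / 4 * d\<^sup>2 - \<i> * Y * q * d + \<i>\<^sup>2 * Y\<^sup>2" for d
        by (simp add: power2_eq_square field_simps)
      then show ?thesis using sq2 unfolding q_def[symmetric] by simp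
    qed
    finally have 2: "(B k)\<^sup>2 / of_real (4 * A k) =
        (w $ k - cnj (v $ k))\<^sup>2 / 2 - \<i> * Y * q * (w $ k - cnj (v $ k)) - Y\<^sup>2" .
    have 3: "C k = q * X * (w $ k + cnj (v $ k)) - X\<^sup>2 - (w $ k)\<^sup>2 / 2 - (cnj (v $ k))\<^sup>2 / 2"
      unfolding C_def q_def X_def L_def by simp
    have "(X + \<i> * Y) * (X - \<i> * Y) = X\<^sup>2 + Y\<^sup>2" by (simp add: power2_eq_square algebra_simps)
    moreover have "(w $ k - cnj (v $ k))\<^sup>2 / 2 = (w $ k)\<^sup>2 / 2 + (cnj (v $ k))\<^sup>2 / 2 - w $ k * cnj (v $ k)"
      by (simp add: power2_eq_square field_simps)
    ultimately have "C k + (B k)\<^sup>2 / of_real (4 * A k) =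
      q * (w $ k * cnj (\<zeta> k) + cnj (v $ k) * \<zeta> k) - \<zeta> k * cnj (\<zeta> k) - w $ k * cnj (v $ k)"
      unfolding 2 3 z(2) unfolding z(1) by (simp add: algebra_simps)
    then show "D k * of_real (sqrt (pi / A k)) * exp (C k + (B k)\<^sup>2 / of_real (4 * A k)) =
      of_real (2 * sqrt pi) *
      exp (of_real (sqrt 2) * (w $ k * cnj (\<zeta> k) + cnj (v $ k) * \<zeta> k) - \<zeta> k * cnj (\<zeta> k) - w $ k * cnj (v $ k))"
      unfolding 1 q_def by (simp only:)
  qed
  finally show ?thesis .
qed

section \<open>Metaplectic coefficients of coherent states\<close>

lemma matrix_inv_eqI:
  fixes A B :: "real^'n^'n"
  assumes "A ** B = mat 1" "B ** A = mat 1"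
  shows "matrix_inv A = B"
proof -
  have "A ** matrix_inv A = mat 1 \<and> matrix_inv A ** A = mat 1"
    unfolding matrix_inv_def by (rule someI[of _ B]) (use assms in blast)
  then show ?thesis by (metis assms(2) matrix_mul_assoc matrix_mul_lid matrix_mul_rid)
qed

definition rotate_vec :: "real^'n \<Rightarrow> complex^'n \<Rightarrow> complex^'n" where
  "rotate_vec \<theta> w = (\<chi> k. cis (\<theta> $ k) * w $ k)"

definition contract_vec :: "real^'n \<Rightarrow> complex^'n \<Rightarrow> complex^'n" where
  "contract_vec l z = (\<chi> k. Complex (Re (z $ k) / l $ k) (l $ k * Im (z $ k)))"

lemma cvec_of_real_of_cvec [simp]: "cvec_of_real (real_of_cvec z) = z"
  by (simp add: cvec_of_real_def real_of_cvec_def vec_eq_iff)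

lemma torus_elem_mult_vec: "torus_elem \<theta> *v real_of_cvec z = real_of_cvec (rotate_vec \<theta> z)"
proof -
  have "(torus_elem \<theta> *v real_of_cvec z) $ i = real_of_cvec (rotate_vec \<theta> z) $ i" for i
    by (cases i)
      (auto simp: torus_elem_def iota_def block_def diag_def matrix_vector_mult_def sum_UNIV_Plus
        real_of_cvec_def rotate_vec_def if_distrib[of Re] if_distrib[of Im] if_distrib[of uminus]
        if_distrib[of "\<lambda>x. x * _"] cong: if_cong)
  then show ?thesis by (simp add: vec_eq_iff)
qed

lemma diag_symp_mult_vec:
  "diag_symp (\<chi> k. inverse (l $ k)) *v real_of_cvec z = real_of_cvec (contract_vec l z)"
proof -
  have "(diag_symp (\<chi> k. inverse (l $ k)) *v real_of_cvec z) $ i = real_of_cvec (contract_vec l z) $ i" for i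
    by (cases i)
      (auto simp: diag_symp_def block_def diag_def matrix_vector_mult_def sum_UNIV_Plus
        real_of_cvec_def contract_vec_def divide_inverse
        if_distrib[of "\<lambda>x. x * _"] cong: if_cong)
  then show ?thesis by (simp add: vec_eq_iff)
qed

lemma torus_elem_0: "torus_elem (0 :: real^'n::finite) = mat 1"
proof -
  have "torus_elem (0 :: real^'n) $ i $ j = mat 1 $ i $ j" for i j
    by (cases i; cases j) (auto simp: torus_elem_def iota_def block_def diag_def mat_def)
  then show ?thesis by (simp add: vec_eq_iff)
qed

lemma torus_elem_inverse: "torus_elem \<theta> ** torus_elem (- \<theta>) = mat 1" "torus_elem (- \<theta>) ** torus_elem \<theta> = mat 1"
  by (simp_all add: torus_elem_mult torus_elem_0)

lemma diag_symp_inverse: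
  assumes "\<And>k. l $ k \<noteq> 0"
  shows "diag_symp l ** diag_symp (\<chi> k. inverse (l $ k)) = mat 1" (is ?A)
    and "diag_symp (\<chi> k. inverse (l $ k)) ** diag_symp l = mat 1" (is ?B)
proof -
  have "(diag_symp l ** diag_symp (\<chi> k. inverse (l $ k))) $ i $ j = mat 1 $ i $ j"
    "(diag_symp (\<chi> k. inverse (l $ k)) ** diag_symp l) $ i $ j = mat 1 $ i $ j" for i j
    using assms by (cases i; cases j; auto simp: diag_symp_def block_def diag_def matrix_matrix_mult_def
        sum_UNIV_Plus mat_def if_distrib[of "\<lambda>x. x * _"] if_distrib[of "\<lambda>x. _ * x"] cong: if_cong)+
  then show ?A ?B by (simp_all add: vec_eq_iff)
qed

lemma matrix_inv_torus_elem: "matrix_inv (torus_elem \<theta>) = torus_elem (- \<theta>)"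
  by (intro matrix_inv_eqI torus_elem_inverse)

lemma matrix_inv_torus_diag_torus:
  assumes "\<And>k. l $ k \<noteq> 0"
  shows "matrix_inv (torus_elem \<theta>1 ** diag_symp l ** torus_elem \<theta>2) =
    torus_elem (- \<theta>2) ** diag_symp (\<chi> k. inverse (l $ k)) ** torus_elem (- \<theta>1)"
proof (rule matrix_inv_eqI)
  note inv = torus_elem_inverse diag_symp_inverse[OF assms]
  have "torus_elem \<theta>1 ** diag_symp l ** torus_elem \<theta>2 ** (torus_elem (- \<theta>2) ** diag_symp (\<chi> k. inverse (l $ k)) ** torus_elem (- \<theta>1)) =
      torus_elem \<theta>1 ** (diag_symp l ** (torus_elem \<theta>2 ** torus_elem (- \<theta>2)) ** diag_symp (\<chi> k. inverse (l $ k))) ** torus_elem (- \<theta>1)"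
    by (simp only: matrix_mul_assoc)
  then show "torus_elem \<theta>1 ** diag_symp l ** torus_elem \<theta>2 ** (torus_elem (- \<theta>2) ** diag_symp (\<chi> k. inverse (l $ k)) ** torus_elem (- \<theta>1)) = mat 1"
    by (simp add: inv)
  have "torus_elem (- \<theta>2) ** diag_symp (\<chi> k. inverse (l $ k)) ** torus_elem (- \<theta>1) ** (torus_elem \<theta>1 ** diag_symp l ** torus_elem \<theta>2) =
      torus_elem (- \<theta>2) ** (diag_symp (\<chi> k. inverse (l $ k)) ** (torus_elem (- \<theta>1) ** torus_elem \<theta>1) ** diag_symp l) ** torus_elem \<theta>2"
    by (simp only: matrix_mul_assoc)
  then show "torus_elem (- \<theta>2) ** diag_symp (\<chi> k. inverse (l $ k)) ** torus_elem (- \<theta>1) ** (torus_elem \<theta>1 ** diag_symp l ** torus_elem \<theta>2) = mat 1"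
    by (simp add: inv)
qed

text \<open>Evaluation at the rotated point absorbs the inverse matrix of the covariance
  relation.\<close>

lemma metaplectic_torus_wigner:
  assumes "metaplectic_op (torus_elem \<theta>) U" "f \<in> L2" "g \<in> L2"
  shows "cross_wigner (U f) (U g) (rotate_vec \<theta> z) = cross_wigner f g z"
proof -
  have "rotate_vec (- \<theta>) (rotate_vec \<theta> z) = z"
    by (simp add: rotate_vec_def vec_eq_iff mult.assoc[symmetric] cis_mult)
  then show ?thesis
    using assms unfolding metaplectic_op_def by (simp add: matrix_inv_torus_elem torus_elem_mult_vec)
qed

lemma metaplectic_torus_diag_torus_wigner:
  assumes "metaplectic_op (torus_elem \<theta>1 ** diag_symp l ** torus_elem \<theta>2) U" "f \<in> L2" "g \<in> L2"
    and "\<And>k. l $ k \<noteq> 0"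
  shows "cross_wigner (U f) (U g) (rotate_vec \<theta>1 z) = cross_wigner f g (rotate_vec (- \<theta>2) (contract_vec l z))"
proof -
  have "rotate_vec (- \<theta>1) (rotate_vec \<theta>1 z) = z"
    by (simp add: rotate_vec_def vec_eq_iff mult.assoc[symmetric] cis_mult)
  then show ?thesis
    using assms unfolding metaplectic_op_def
    by (simp add: matrix_inv_torus_diag_torus torus_elem_mult_vec diag_symp_mult_vec flip: matrix_vector_mul_assoc)
qed

lemma cross_wigner_sum:
  fixes f :: "'i \<Rightarrow> real^'n::finite \<Rightarrow> complex" and g :: "'j \<Rightarrow> real^'n \<Rightarrow> complex"
  assumes f: "\<And>i. i \<in> I \<Longrightarrow> f i \<in> L2" and g: "\<And>j. j \<in> J \<Longrightarrow> g j \<in> L2"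
  shows "cross_wigner (\<lambda>x. \<Sum>i\<in>I. a i * f i x) (\<lambda>x. \<Sum>j\<in>J. b j * g j x) z =
    (\<Sum>i\<in>I. \<Sum>j\<in>J. a i * cnj (b j) * cross_wigner (f i) (g j) z)"
proof -
  define e :: "real^'n \<Rightarrow> real^'n \<Rightarrow> complex" where "e y s = exp (- (\<i> * of_real (s \<bullet> y)))" for y s
  have int: "integrable lborel (\<lambda>s. a i * cnj (b j) * (e y s * f i (x + s /\<^sub>R 2) * cnj (g j (x - s /\<^sub>R 2))))"
    if "i \<in> I" "j \<in> J" for i j x y
  proof (intro integrable_mult_right Bochner_Integration.integrable_bound[OF wigner_slice_integrable[OF f[OF that(1)] g[OF that(2)], of x]])
    note [measurable] = L2_measurable[OF f[OF that(1)]] L2_measurable[OF g[OF that(2)]]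
    have "(\<lambda>s. e y s) \<in> borel_measurable borel"
      unfolding e_def by (intro borel_measurable_continuous_onI continuous_intros)
    then show "(\<lambda>s. e y s * f i (x + s /\<^sub>R 2) * cnj (g j (x - s /\<^sub>R 2))) \<in> borel_measurable lborel"
      by measurable
  qed (simp add: norm_mult e_def)
  have eq: "e y s * (\<Sum>i\<in>I. a i * f i (x + s /\<^sub>R 2)) * cnj (\<Sum>j\<in>J. b j * g j (x - s /\<^sub>R 2)) =
      (\<Sum>i\<in>I. \<Sum>j\<in>J. a i * cnj (b j) * (e y s * f i (x + s /\<^sub>R 2) * cnj (g j (x - s /\<^sub>R 2))))" for x y s
    by (simp add: sum_product sum_distrib_left sum_distrib_right cnj_sum mult_ac)
  have "(LINT s|lborel. e y s * (\<Sum>i\<in>I. a i * f i (x + s /\<^sub>R 2)) * cnj (\<Sum>j\<in>J. b j * g j (x - s /\<^sub>R 2))) =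
      (\<Sum>i\<in>I. \<Sum>j\<in>J. a i * cnj (b j) * (LINT s|lborel. e y s * f i (x + s /\<^sub>R 2) * cnj (g j (x - s /\<^sub>R 2))))" for x y
    unfolding eq using int
    by (simp add: Bochner_Integration.integral_sum Bochner_Integration.integrable_sum del: integral_mult_right integrable_mult_right_iff)
  then show ?thesis
    unfolding cross_wigner_def Let_def e_def by (simp add: sum_distrib_left mult_ac)
qed

lemma cross_wigner_coherent:
  fixes z :: "complex^'n::finite"
  shows "cross_wigner (coherent w) (coherent v) z =
    of_real ((2 * pi) powr (- real CARD('n) / 2)) *
    (\<Prod>k\<in>UNIV. of_real (2 * sqrt pi) *
      exp (of_real (sqrt 2) * (w $ k * cnj (z $ k) + cnj (v $ k) * z $ k) - z $ k * cnj (z $ k) - w $ k * cnj (v $ k)))"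
  unfolding coherent_def by (subst cross_wigner_squeezed) (simp_all add: complex.collapse)

text \<open>The exponent involves z, w, v only through w cnj(z), cnj(v) z, |z|^2 and w cnj(v).
  Rotating z backwards therefore has the same effect as rotating both labels forwards.\<close>

lemma cross_wigner_coherent_rotate:
  "cross_wigner (coherent w) (coherent v) (rotate_vec (- \<theta>) z) =
   cross_wigner (coherent (rotate_vec \<theta> w)) (coherent (rotate_vec \<theta> v)) z"
proof -
  have c: "cis t * cis (- t) = 1" for t by (simp add: cis_mult)
  have "of_real (sqrt 2) * (w $ k * cnj (cis (- t) * zk) + cnj (v $ k) * (cis (- t) * zk)) - (cis (- t) * zk) * cnj (cis (- t) * zk) - w $ k * cnj (v $ k) =
     of_real (sqrt 2) * ((cis t * w $ k) * cnj zk + cnj (cis t * v $ k) * zk) - zk * cnj zk - (cis t * w $ k) * cnj (cis t * v $ k)" for k t zk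
  proof -
    have "(cis (- t) * zk) * cnj (cis (- t) * zk) = (cis t * cis (- t)) * (zk * cnj zk)"
      "(cis t * w $ k) * cnj (cis t * v $ k) = (cis t * cis (- t)) * (w $ k * cnj (v $ k))"
      by (simp_all only: complex_cnj_mult cis_cnj minus_minus mult_ac)
    then have *: "(cis (- t) * zk) * cnj (cis (- t) * zk) = zk * cnj zk"
      "(cis t * w $ k) * cnj (cis t * v $ k) = w $ k * cnj (v $ k)"
      unfolding c by simp_all
    show ?thesis unfolding * by (simp add: cis_cnj mult_ac)
  qed
  then show ?thesis
    unfolding cross_wigner_coherent by (simp only: rotate_vec_def vec_lambda_beta vector_uminus_component)
qed

lemma cross_wigner_squeezed_contract:
  assumes "\<And>k. 0 < l $ k"
  shows "cross_wigner (coherent w) (coherent v) (contract_vec l z) =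
    cross_wigner (squeezed l w) (squeezed l v) z"
  unfolding cross_wigner_coherent cross_wigner_squeezed[OF assms] by (simp add: contract_vec_def)

lemma unitary_L2_D:
  assumes "unitary_L2 U"
  shows "f \<in> L2 \<Longrightarrow> U f \<in> L2"
    and "f \<in> L2 \<Longrightarrow> g \<in> L2 \<Longrightarrow> L2_eq f g \<Longrightarrow> L2_eq (U f) (U g)"
    and "f \<in> L2 \<Longrightarrow> g \<in> L2 \<Longrightarrow> L2_eq (U (\<lambda>x. f x + g x)) (\<lambda>x. U f x + U g x)"
    and "f \<in> L2 \<Longrightarrow> L2_eq (U (\<lambda>x. c * f x)) (\<lambda>x. c * U f x)"
    and "f \<in> L2 \<Longrightarrow> g \<in> L2 \<Longrightarrow> L2_inner (U f) (U g) = L2_inner f g"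
    and "g \<in> L2 \<Longrightarrow> \<exists>f\<in>L2. L2_eq (U f) g"
  using assms unfolding unitary_L2_def by blast+

text \<open>The candidates \<open>\<psi>1\<close> and \<open>\<psi>2\<close> are what the dilated
  second rotation and the inverse of the first rotation should make of the two vectors. Equality of
  Wigner distributions, checked on complete sums with all cross terms, replaces equality of vectors
  and costs one global phase per vector, which the modulus ignores.\<close>

lemma metaplectic_coefficient_combination:
  fixes \<rho> :: "real^('n::finite + 'n)^('n + 'n) \<Rightarrow> (real^'n \<Rightarrow> complex) \<Rightarrow> (real^'n \<Rightarrow> complex)"
  assumes rep: "metaplectic_rep \<rho>" and l: "\<And>k. 0 < l $ k"
  shows "cmod (L2_inner (\<rho> (torus_elem \<theta>1 ** diag_symp l ** torus_elem \<theta>2) (\<lambda>x. \<Sum>i\<in>I. a i * coherent (w i) x))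
      (\<lambda>x. \<Sum>j\<in>J. b j * coherent (v j) x)) =
    cmod (\<Sum>i\<in>I. \<Sum>j\<in>J. a i * cnj (b j) *
      L2_inner (squeezed l (rotate_vec \<theta>2 (w i))) (coherent (rotate_vec (- \<theta>1) (v j))))"
proof -
  define S where "S = torus_elem \<theta>1 ** diag_symp l ** torus_elem \<theta>2"
  define \<phi>1 where "\<phi>1 = (\<lambda>x. \<Sum>i\<in>I. a i * coherent (w i) x)"
  define \<phi>2 where "\<phi>2 = (\<lambda>x. \<Sum>j\<in>J. b j * coherent (v j) x)"
  define \<psi>1 where "\<psi>1 = (\<lambda>x. \<Sum>i\<in>I. a i * squeezed l (rotate_vec \<theta>2 (w i)) x)"
  define \<psi>2 where "\<psi>2 = (\<lambda>x. \<Sum>j\<in>J. b j * coherent (rotate_vec (- \<theta>1) (v j)) x)"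
  have l0: "l $ k \<noteq> 0" for k using l[of k] by simp
  have L2: "\<phi>1 \<in> L2" "\<phi>2 \<in> L2" "\<psi>1 \<in> L2" "\<psi>2 \<in> L2"
    unfolding \<phi>1_def \<phi>2_def \<psi>1_def \<psi>2_def
    by (intro L2_sum L2_scale coherent_L2 squeezed_L2 l)+
  have "diag_symp l \<in> Sp" by (rule diag_symp_in_Sp) (use l0 in simp)
  then have "S \<in> Sp" unfolding S_def by (intro Sp_mult torus_elem_in_Sp)
  then have S: "metaplectic_op S (\<rho> S)" using rep unfolding metaplectic_rep_def by blast
  have T: "metaplectic_op (torus_elem \<theta>1) (\<rho> (torus_elem \<theta>1))"
    using rep torus_elem_in_Sp unfolding metaplectic_rep_def by blast
  have US: "unitary_L2 (\<rho> S)" and UT: "unitary_L2 (\<rho> (torus_elem \<theta>1))"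
    using S T unfolding metaplectic_op_def by blast+
  \<comment> \<open>Surjectivity of the operator of the first rotation gives a vector playing the
    role of the dilated and rotated \<open>\<phi>1\<close>. This avoids multiplying operators of a
    merely projective representation.\<close>
  obtain f where f: "f \<in> L2" "L2_eq (\<rho> (torus_elem \<theta>1) f) (\<rho> S \<phi>1)"
    using unitary_L2_D(6)[OF UT unitary_L2_D(1)[OF US L2(1)]] by blast
  note UL2 = unitary_L2_D(1)[OF US L2(1)] unitary_L2_D(1)[OF UT f(1)] unitary_L2_D(1)[OF UT L2(4)]
  have rot: "rotate_vec \<theta>1 (rotate_vec (- \<theta>1) z) = z" for z
    by (simp add: rotate_vec_def vec_eq_iff mult.assoc[symmetric] cis_mult)
  \<comment> \<open>\<open>\<psi>2\<close> carries the labels rotated by -\<theta>1, so applying the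
    rotation operator restores the Wigner distribution of \<open>\<phi>2\<close>.\<close>
  have W2: "cross_wigner \<phi>2 \<phi>2 z = cross_wigner (\<rho> (torus_elem \<theta>1) \<psi>2) (\<rho> (torus_elem \<theta>1) \<psi>2) z" for z
  proof -
    have "cross_wigner (\<rho> (torus_elem \<theta>1) \<psi>2) (\<rho> (torus_elem \<theta>1) \<psi>2) (rotate_vec \<theta>1 (rotate_vec (- \<theta>1) z)) =
        cross_wigner \<psi>2 \<psi>2 (rotate_vec (- \<theta>1) z)"
      by (rule metaplectic_torus_wigner[OF T L2(4) L2(4)])
    also have "\<dots> = cross_wigner \<phi>2 \<phi>2 z"
      unfolding \<phi>2_def \<psi>2_def
      by (simp add: cross_wigner_sum coherent_L2 cross_wigner_coherent_rotate rot)
    finally show ?thesis unfolding rot by simp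
  qed
  \<comment> \<open>Covariance under the first rotation and under the whole product cancels
    \<theta>1. What remains is the pullback by the contraction and the second rotation, which is the
    Wigner distribution of \<open>\<psi>1\<close>.\<close>
  have W1: "cross_wigner f f z = cross_wigner \<psi>1 \<psi>1 z" for z
  proof -
    have "cross_wigner f f z = cross_wigner (\<rho> (torus_elem \<theta>1) f) (\<rho> (torus_elem \<theta>1) f) (rotate_vec \<theta>1 z)"
      by (rule metaplectic_torus_wigner[OF T f(1) f(1), symmetric])
    also have "\<dots> = cross_wigner (\<rho> S \<phi>1) (\<rho> S \<phi>1) (rotate_vec \<theta>1 z)"
      by (rule cross_wigner_cong[OF UL2(2) UL2(1) UL2(2) UL2(1) f(2) f(2)])
    also have "\<dots> = cross_wigner \<phi>1 \<phi>1 (rotate_vec (- \<theta>2) (contract_vec l z))"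
      by (rule metaplectic_torus_diag_torus_wigner[OF S[unfolded S_def] L2(1) L2(1) l0, folded S_def])
    also have "\<dots> = cross_wigner \<psi>1 \<psi>1 z"
      unfolding \<phi>1_def \<psi>1_def
      by (simp add: cross_wigner_sum coherent_L2 squeezed_L2 l cross_wigner_coherent_rotate cross_wigner_squeezed_contract)
    finally show ?thesis .
  qed
  have "cmod (L2_inner (\<rho> S \<phi>1) \<phi>2) = cmod (L2_inner \<phi>2 (\<rho> S \<phi>1))"
    by (subst L2_inner_cnj) simp
  also have "\<dots> = cmod (L2_inner (\<rho> (torus_elem \<theta>1) \<psi>2) (\<rho> S \<phi>1))"
    by (rule cmod_L2_inner_eq_if_wigner_eq[OF L2(2) UL2(3) UL2(1) W2])
  also have "L2_inner (\<rho> (torus_elem \<theta>1) \<psi>2) (\<rho> S \<phi>1) = L2_inner (\<rho> (torus_elem \<theta>1) \<psi>2) (\<rho> (torus_elem \<theta>1) f)"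
    by (rule L2_inner_cong[OF UL2(3) UL2(3) UL2(1) UL2(2) L2_eq_refl L2_eq_sym[OF f(2)]])
  also have "\<dots> = L2_inner \<psi>2 f"
    by (rule unitary_L2_D(5)[OF UT L2(4) f(1)])
  also have "cmod \<dots> = cmod (L2_inner f \<psi>2)"
    by (subst L2_inner_cnj) simp
  also have "\<dots> = cmod (L2_inner \<psi>1 \<psi>2)"
    by (rule cmod_L2_inner_eq_if_wigner_eq[OF f(1) L2(3) L2(4) W1])
  also have "L2_inner \<psi>1 \<psi>2 = (\<Sum>i\<in>I. \<Sum>j\<in>J. a i * cnj (b j) *
      L2_inner (squeezed l (rotate_vec \<theta>2 (w i))) (coherent (rotate_vec (- \<theta>1) (v j))))"
  proof -
    have "L2_inner \<psi>1 \<psi>2 = (\<Sum>i\<in>I. a i * L2_inner (squeezed l (rotate_vec \<theta>2 (w i))) \<psi>2)"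
      unfolding \<psi>1_def by (rule L2_inner_sum_left[OF squeezed_L2[OF l] L2(4)])
    also have "\<dots> = (\<Sum>i\<in>I. a i * (\<Sum>j\<in>J. cnj (b j) *
      L2_inner (squeezed l (rotate_vec \<theta>2 (w i))) (coherent (rotate_vec (- \<theta>1) (v j)))))"
      unfolding \<psi>2_def by (subst L2_inner_sum_right[OF coherent_L2 squeezed_L2[OF l]]) simp
    finally show ?thesis by (simp add: sum_distrib_left mult.assoc)
  qed
  finally show ?thesis unfolding S_def \<phi>1_def \<phi>2_def .
qed

section \<open>Binary forms under rotation\<close>

text \<open>The binary form s p q + \<tau> (q^2 - p^2) / 2 dehomogenized in q / p.\<close>

definition quad_poly :: "real \<Rightarrow> real \<Rightarrow> real poly" where
  "quad_poly s \<tau> = [:- \<tau> / 2, s, \<tau> / 2:]"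

lemma degree_quad_poly_power: "degree (quad_poly s \<tau> ^ d) \<le> 2 * d"
proof -
  have "degree (quad_poly s \<tau>) \<le> 2" by (simp add: quad_poly_def)
  then show ?thesis using degree_power_le[of "quad_poly s \<tau>" d] by (meson le_trans mult_le_mono1)
qed

text \<open>Infinitesimal rotation of a binary form of degree \<open>2d\<close>, dehomogenized: the vector field
  \<open>z \<partial>\<^sub>w - w \<partial>\<^sub>z\<close> acts on polynomials in \<open>x = z / w\<close> as \<open>2d x p - (1 + x\<^sup>2) p'\<close>, and it is
  skew for the inner product with \<open>\<parallel>z\<^sup>j w\<^sup>m\<parallel>\<^sup>2 = j! m!\<close>.\<close>

lemma DERIV_coeff_quad_poly_power:
  "((\<lambda>\<psi>. coeff (quad_poly (cos \<psi>) (sin \<psi>) ^ d) j) has_real_derivative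
    coeff (of_nat (2 * d) * [:0, 1:] * quad_poly (cos \<psi>) (sin \<psi>) ^ d -
      [:1, 0, 1:] * pderiv (quad_poly (cos \<psi>) (sin \<psi>) ^ d)) j / 2) (at \<psi>)"
proof (induction d arbitrary: j)
  case 0
  show ?case by simp
next
  case (Suc d)
  let ?R = "\<lambda>\<psi>. quad_poly (cos \<psi>) (sin \<psi>)"
  \<comment> \<open>The derivative of the quadratic form in \<psi>. A rotation of the variables by
    an angle turns the form by twice that angle, whence the factor 1/2 in front of the vector
    field.\<close>
  define R' where "R' = [:- cos \<psi> / 2, - sin \<psi>, cos \<psi> / 2:]"
  define P where "P = ?R \<psi> ^ d"
  define G where "G d p = of_nat (2 * d) * [:0, 1:] * p - [:1, 0, 1:] * pderiv p" for d and p :: "real poly"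
  have R: "((\<lambda>\<psi>. coeff (?R \<psi>) i) has_real_derivative coeff R' i) (at \<psi>)" for i
  proof -
    consider "i = 0" | "i = Suc 0" | "i = Suc (Suc 0)" | m where "i = Suc (Suc (Suc m))"
      by (metis not0_implies_Suc)
    then show ?thesis
      by cases (auto simp: quad_poly_def R'_def intro!: derivative_eq_intros)
  qed
  have D: "((\<lambda>\<psi>. \<Sum>i\<le>j. coeff (?R \<psi>) i * coeff (?R \<psi> ^ d) (j - i)) has_real_derivative
      (\<Sum>i\<le>j. coeff R' i * coeff P (j - i) + coeff (G d P) (j - i) / 2 * coeff (?R \<psi>) i)) (at \<psi>)"
    unfolding G_def P_def by (intro DERIV_sum DERIV_mult' DERIV_mult R Suc)
  have E1: "(\<Sum>i\<le>j. coeff R' i * coeff P (j - i) + coeff (G d P) (j - i) / 2 * coeff (?R \<psi>) i) =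
      coeff (smult 2 R' * P + ?R \<psi> * G d P) j / 2"
    unfolding coeff_add coeff_mult by (simp add: sum.distrib sum_divide_distrib add_divide_distrib mult.commute)
  \<comment> \<open>The operator \<open>G\<close> is a derivation on forms once the degree is
    tracked: the new quadratic factor contributes \<open>[:0, 2:]\<close> to the multiplication
    term, and the derivative splits by the product rule.\<close>
  have E2: "smult 2 R' * P + ?R \<psi> * G d P = G (Suc d) (?R \<psi> * P)"
  proof -
    have 1: "smult 2 R' = [:0, 2:] * ?R \<psi> - [:1, 0, 1:] * pderiv (?R \<psi>)"
      by (simp add: R'_def quad_poly_def pderiv_pCons)
    have 2: "(of_nat (2 * Suc d) :: real poly) * [:0, 1:] = [:0, 2:] + of_nat (2 * d) * [:0, 1:]"
      by (simp add: of_nat_poly algebra_simps)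
    show ?thesis
      unfolding G_def pderiv_mult 1 2 by (simp only: algebra_simps)
  qed
  have "((\<lambda>\<psi>. coeff (?R \<psi> * ?R \<psi> ^ d) j) has_real_derivative coeff (G (Suc d) (?R \<psi> * P)) j / 2) (at \<psi>)"
    using D unfolding E1 E2 by (simp only: coeff_mult)
  then show ?case
    unfolding G_def P_def power_Suc .
qed

text \<open>The weighted sum is the squared norm of a rotated form, and skewness of the rotation
  field makes its derivative vanish. At angle 0 the form is the single monomial (pq)^d, which gives
  the value.\<close>

lemma sum_coeff_quad_poly_power:
  fixes d :: nat
  defines "c \<equiv> \<lambda>\<psi>. coeff (quad_poly (cos \<psi>) (sin \<psi>) ^ d)"
  shows "(\<Sum>j\<le>2 * d. fact j * fact (2 * d - j) * (c \<psi> j)\<^sup>2) = (fact d)\<^sup>2"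
proof -
  define N where "N \<psi> = (\<Sum>j\<le>2 * d. fact j * fact (2 * d - j) * (c \<psi> j)\<^sup>2)" for \<psi>
  have "(N has_real_derivative 0) (at \<psi>)" for \<psi>
  proof -
    define p where "p = quad_poly (cos \<psi>) (sin \<psi>) ^ d"
    define g where "g = of_nat (2 * d) * [:0, 1:] * p - [:1, 0, 1:] * pderiv p"
    have c: "((\<lambda>\<psi>. c \<psi> j) has_real_derivative coeff g j / 2) (at \<psi>)" for j
      unfolding c_def g_def p_def by (rule DERIV_coeff_quad_poly_power)
    have cp: "c \<psi> = coeff p" by (simp add: c_def p_def)
    \<comment> \<open>Skewness in coordinates: the derivative pairs neighbouring coefficients with
      equal weights, so its terms are differences of consecutive \<open>T\<close>. The sum
      telescopes to 0 because \<open>T 0\<close> is 0 by definition and the coefficient of index 2d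
      + 1 exceeds the degree.\<close>
    define T where "T j = (case j of 0 \<Rightarrow> 0 | Suc i \<Rightarrow> fact (Suc i) * fact (2 * d - i) * coeff p (Suc i) * coeff p i)" for j
    have "(N has_real_derivative (\<Sum>j\<le>2 * d. fact j * fact (2 * d - j) * (2 * coeff p j * (coeff g j / 2)))) (at \<psi>)"
      unfolding N_def[abs_def] cp[symmetric]
      by (rule DERIV_sum) (auto intro!: derivative_eq_intros c)
    moreover have step: "fact j * fact (2 * d - j) * (2 * coeff p j * (coeff g j / 2)) = T j - T (Suc j)"
      if j: "j \<le> 2 * d" for j
    proof (cases j)
      case 0
      have "coeff g 0 = - coeff p 1"
        by (simp add: g_def coeff_mult coeff_pderiv mult.assoc)
      then show ?thesis using 0 by (simp add: T_def)
    next
      case (Suc i)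
      have e1: "coeff g (Suc i) = real (2 * d - i) * coeff p i - real (Suc (Suc i)) * coeff p (Suc (Suc i))"
      proof -
        have "of_nat (2 * d) * [:0, 1:] * p = smult (of_nat (2 * d)) (pCons 0 p)"
          by (simp add: of_nat_poly)
        then have "coeff (of_nat (2 * d) * [:0, 1:] * p) (Suc i) = real (2 * d) * coeff p i"
          by simp
        moreover have "[:1, 0, 1:] * pderiv p = pderiv p + pCons 0 (pCons 0 (pderiv p))"
          by simp
        then have "coeff ([:1, 0, 1:] * pderiv p) (Suc i) = real (Suc (Suc i)) * coeff p (Suc (Suc i)) + real i * coeff p i"
          by (cases i) (simp_all add: coeff_pderiv)
        ultimately show ?thesis
          unfolding g_def using Suc j by (simp add: of_nat_diff algebra_simps)
      qed
      have e2: "fact (2 * d - i) = real (2 * d - i) * fact (2 * d - Suc i)"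
        using Suc j by (simp add: fact_reduce)
      have e3: "fact (Suc (Suc i)) = real (Suc (Suc i)) * fact (Suc i)" by simp
      show ?thesis
        unfolding Suc T_def nat.case e1 e2 e3 by (simp add: field_simps del: fact_Suc of_nat_Suc)
    qed
    moreover have "(\<Sum>j\<le>2 * d. fact j * fact (2 * d - j) * (2 * coeff p j * (coeff g j / 2))) = 0"
    proof -
      have "T (Suc (2 * d)) = 0"
        using coeff_eq_0[of p "Suc (2 * d)"] degree_quad_poly_power[of "cos \<psi>" "sin \<psi>" d]
        by (simp add: T_def p_def del: mult_Suc_right)
      moreover have "T 0 = 0" by (simp add: T_def)
      moreover have "(\<Sum>j<Suc (2 * d). T j - T (Suc j)) = T 0 - T (Suc (2 * d))"
        by (rule sum_lessThan_telescope')
      moreover have "(\<Sum>j\<le>2 * d. fact j * fact (2 * d - j) * (2 * coeff p j * (coeff g j / 2))) =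
          (\<Sum>j<Suc (2 * d). T j - T (Suc j))"
        unfolding lessThan_Suc_atMost by (intro sum.cong refl step) simp
      ultimately show ?thesis by (simp only:)
    qed
    ultimately show ?thesis by (simp only:)
  qed
  then have "N \<psi> = N 0" by (rule DERIV_isconst_all[rule_format])
  also have "N 0 = (\<Sum>j\<le>2 * d. if j = d then fact d * fact d else 0)"
  proof -
    have "quad_poly 1 0 ^ d = monom 1 d"
      by (simp add: quad_poly_def monom_altdef)
    then show ?thesis unfolding N_def c_def by (intro sum.cong) auto
  qed
  also have "\<dots> = (fact d)\<^sup>2" by (simp add: power2_eq_square)
  finally show ?thesis unfolding N_def .
qed

text \<open>A single term of the conserved sum is at most the whole. The division by d! is that of
  the exponential series, and it exactly cancels the norm of (pq)^d.\<close>

lemma coeff_quad_poly_power_bound: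
  assumes "s\<^sup>2 + \<tau>\<^sup>2 = 1" "j \<le> 2 * d"
  shows "(coeff (quad_poly s \<tau> ^ d) j / fact d)\<^sup>2 * (fact (2 * d - j) * fact j) \<le> 1"
proof -
  obtain \<psi> where \<psi>: "s = cos \<psi>" "\<tau> = sin \<psi>"
    using assms(1) sincos_total_2pi by metis
  have "fact j * fact (2 * d - j) * (coeff (quad_poly s \<tau> ^ d) j)\<^sup>2 \<le> (fact d)\<^sup>2"
    unfolding sum_coeff_quad_poly_power[of d \<psi>, symmetric] \<psi>
    using assms(2) by (intro member_le_sum) auto
  then show ?thesis by (simp add: power_divide divide_simps mult_ac)
qed

text \<open>For nonzero p this is homogenization of the polynomial power in q / p. Both sides are
  continuous in p, which covers p = 0.\<close>

lemma quad_form_power: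
  fixes p q :: complex
  shows "(of_real s * (p * q) + of_real \<tau> * (q\<^sup>2 - p\<^sup>2) / 2) ^ d =
    (\<Sum>j\<le>2 * d. of_real (coeff (quad_poly s \<tau> ^ d) j) * p ^ (2 * d - j) * q ^ j)"
proof -
  define R where "R = map_poly complex_of_real (quad_poly s \<tau>)"
  have cR: "coeff (R ^ d) j = of_real (coeff (quad_poly s \<tau> ^ d) j)" for j
    by (induction d arbitrary: j) (simp_all add: coeff_mult R_def coeff_map_poly)
  have *: "(of_real s * (p * q) + of_real \<tau> * (q\<^sup>2 - p\<^sup>2) / 2) ^ d =
    (\<Sum>j\<le>2 * d. of_real (coeff (quad_poly s \<tau> ^ d) j) * p ^ (2 * d - j) * q ^ j)" if p: "p \<noteq> 0" for p
  proof -
    have "of_real s * (p * q) + of_real \<tau> * (q\<^sup>2 - p\<^sup>2) / 2 = p\<^sup>2 * poly R (q / p)"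
      using p by (simp add: R_def quad_poly_def map_poly_pCons power2_eq_square field_simps)
    then have "(of_real s * (p * q) + of_real \<tau> * (q\<^sup>2 - p\<^sup>2) / 2) ^ d = p ^ (2 * d) * poly (R ^ d) (q / p)"
      by (simp add: power_mult_distrib power_mult)
    also have "poly (R ^ d) (q / p) = (\<Sum>j\<le>2 * d. coeff (R ^ d) j * (q / p) ^ j)"
    proof -
      have "degree (R ^ d) \<le> 2 * d"
        by (rule degree_le) (use cR degree_quad_poly_power[of s \<tau> d] in \<open>simp add: coeff_eq_0\<close>)
      then show ?thesis unfolding poly_altdef by (intro sum.mono_neutral_left) (auto simp: coeff_eq_0)
    qed
    also have "p ^ (2 * d) * \<dots> = (\<Sum>j\<le>2 * d. of_real (coeff (quad_poly s \<tau> ^ d) j) * p ^ (2 * d - j) * q ^ j)"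
      unfolding sum_distrib_left cR
      by (intro sum.cong refl) (use p in \<open>simp add: power_diff power_divide\<close>)
    finally show ?thesis .
  qed
  show ?thesis
  proof (cases "p = 0")
    case True
    let ?f = "\<lambda>p. (of_real s * (p * q) + of_real \<tau> * (q\<^sup>2 - p\<^sup>2) / 2) ^ d"
    let ?g = "\<lambda>p. (\<Sum>j\<le>2 * d. of_real (coeff (quad_poly s \<tau> ^ d) j) * p ^ (2 * d - j) * q ^ j)"
    have 1: "?f \<midarrow>0\<rightarrow> ?f 0" by (intro tendsto_intros) simp_all
    have 2: "?g \<midarrow>0\<rightarrow> ?g 0" by (intro tendsto_intros)
    have "eventually (\<lambda>p. ?f p = ?g p) (at 0)"
      using * by (auto simp: eventually_at_filter)
    then show ?thesis
      unfolding True by (rule LIM_unique[OF Lim_transform_eventually[OF 1] 2])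
  qed (rule *)
qed

text \<open>Cutting the exponential series gives a polynomial, so Parseval can be applied to finite
  sums. The coefficient bound is the same for all \<open>N\<close>, and this uniformity survives the
  limit.\<close>

lemma quad_kernel_truncation:
  assumes "s\<^sup>2 + \<tau>\<^sup>2 = 1"
  obtains \<mu> :: "nat \<Rightarrow> nat \<Rightarrow> real"
  where "\<And>a b. (\<mu> a b)\<^sup>2 * (fact a * fact b) \<le> 1"
    and "\<And>p q :: complex. (\<Sum>d<N. (of_real s * (p * q) + of_real \<tau> * (q\<^sup>2 - p\<^sup>2) / 2) ^ d /\<^sub>R fact d) =
      (\<Sum>(a, b)\<in>{..<2 * N} \<times> {..<2 * N}. of_real (\<mu> a b) * p ^ a * q ^ b)"
proof
  \<comment> \<open>The power d contributes exactly the monomials of total degree 2d, so (a, b)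
    determines d as half of a + b. Odd degrees and degrees beyond the truncation get coefficient
    0.\<close>
  define \<mu> where "\<mu> a b = (if even (a + b) \<and> (a + b) div 2 < N
    then coeff (quad_poly s \<tau> ^ ((a + b) div 2)) b / fact ((a + b) div 2) else 0)" for a b
  show "(\<mu> a b)\<^sup>2 * (fact a * fact b) \<le> 1" for a b
    using coeff_quad_poly_power_bound[OF assms, of b "(a + b) div 2"] by (auto simp: \<mu>_def)
  fix p q :: complex
  have "(\<Sum>d<N. (of_real s * (p * q) + of_real \<tau> * (q\<^sup>2 - p\<^sup>2) / 2) ^ d /\<^sub>R fact d) =
      (\<Sum>d<N. \<Sum>j\<le>2 * d. of_real (coeff (quad_poly s \<tau> ^ d) j / fact d) * p ^ (2 * d - j) * q ^ j)"
    unfolding quad_form_power scaleR_sum_right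
    by (intro sum.cong refl) (simp add: scaleR_conv_of_real divide_inverse)
  also have "\<dots> = (\<Sum>(d, j)\<in>Sigma {..<N} (\<lambda>d. {..2 * d}). of_real (coeff (quad_poly s \<tau> ^ d) j / fact d) * p ^ (2 * d - j) * q ^ j)"
    by (rule sum.Sigma) auto
  also have "\<dots> = (\<Sum>(a, b)\<in>{(a, b). even (a + b) \<and> (a + b) div 2 < N}. of_real (\<mu> a b) * p ^ a * q ^ b)"
    by (rule sum.reindex_bij_witness[where i = "\<lambda>(a, b). ((a + b) div 2, b)" and j = "\<lambda>(d, j). (2 * d - j, j)"])
      (auto simp: \<mu>_def)
  \<comment> \<open>Padding with zeros to a square box makes the index set a product, which allows
    the product over the coordinates to be expanded.\<close>
  also have "\<dots> = (\<Sum>(a, b)\<in>{..<2 * N} \<times> {..<2 * N}. of_real (\<mu> a b) * p ^ a * q ^ b)"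
    by (rule sum.mono_neutral_left) (auto simp: \<mu>_def split: if_splits)
  finally show "(\<Sum>d<N. (of_real s * (p * q) + of_real \<tau> * (q\<^sup>2 - p\<^sup>2) / 2) ^ d /\<^sub>R fact d) =
      (\<Sum>(a, b)\<in>{..<2 * N} \<times> {..<2 * N}. of_real (\<mu> a b) * p ^ a * q ^ b)" .
qed

section \<open>Parseval on the torus\<close>

text \<open>Used for two limits: letting the truncation of the exponential grow, and approximating
  arbitrary vectors by combinations of coherent states. Neither use provides an integrable
  majorant.\<close>

lemma Fatou_bound:
  fixes f :: "nat \<Rightarrow> 'a \<Rightarrow> real"
  assumes [measurable]: "\<And>n. f n \<in> borel_measurable M"
    and lim: "\<And>x. x \<in> space M \<Longrightarrow> (\<lambda>n. f n x) \<longlonglongrightarrow> g x"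
    and le: "\<And>n. (\<integral>\<^sup>+x. ennreal (f n x) \<partial>M) \<le> ennreal (r n)"
    and r: "r \<longlonglongrightarrow> s"
  shows "(\<integral>\<^sup>+x. ennreal (g x) \<partial>M) \<le> ennreal s"
proof -
  have "(\<integral>\<^sup>+x. ennreal (g x) \<partial>M) = (\<integral>\<^sup>+x. liminf (\<lambda>n. ennreal (f n x)) \<partial>M)"
    by (intro nn_integral_cong lim_imp_Liminf[symmetric] tendsto_ennrealI lim) simp_all
  also have "\<dots> \<le> liminf (\<lambda>n. \<integral>\<^sup>+x. ennreal (f n x) \<partial>M)"
    by (rule nn_integral_liminf) measurable
  also have "\<dots> \<le> liminf (\<lambda>n. ennreal (r n))"
    by (intro Liminf_mono always_eventually allI le)
  also have "\<dots> = ennreal s"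
    by (intro lim_imp_Liminf tendsto_ennrealI r) simp
  finally show ?thesis .
qed

text \<open>The phase e^(i \<theta>_k) is read off the cosine and sine entries of the matrix rather
  than from an angle, so it is continuous on all matrices and multiplicative on the torus.\<close>

definition torus_coord :: "real^('n::finite + 'n)^('n + 'n) \<Rightarrow> 'n \<Rightarrow> complex" where
  "torus_coord t k = Complex (t $ Inl k $ Inl k) (t $ Inr k $ Inl k)"

lemma torus_coord_torus_elem: "torus_coord (torus_elem \<theta>) k = cis (\<theta> $ k)"
  by (simp add: torus_coord_def torus_elem_def iota_def block_def diag_def complex_eq_iff)

lemma space_haar_torus: "space haar_torus = torus"
  by (simp add: haar_torus_def space_restrict_space)

lemma sets_haar_torus: "sets haar_torus = sets (restrict_space borel torus)"
  by (simp add: haar_torus_def)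

lemma torus_coord_mult:
  assumes "t \<in> torus"
  shows "torus_coord (torus_elem \<theta> ** t) k = cis (\<theta> $ k) * torus_coord t k"
proof -
  obtain \<theta>' where "t = torus_elem \<theta>'" using assms unfolding torus_def by blast
  then show ?thesis by (simp add: torus_elem_mult torus_coord_torus_elem cis_mult)
qed

lemma cmod_torus_coord: "t \<in> torus \<Longrightarrow> cmod (torus_coord t k) = 1"
  by (auto simp: torus_def torus_coord_torus_elem)

lemma torus_coord_measurable [measurable]: "(\<lambda>t. torus_coord t k) \<in> borel_measurable haar_torus"
proof -
  have "(\<lambda>t :: real^('a + 'a)^('a + 'a). torus_coord t k) \<in> borel_measurable borel"
    unfolding torus_coord_def Complex_eq by (intro borel_measurable_continuous_onI continuous_intros)
  then have "(\<lambda>t. torus_coord t k) \<in> borel_measurable (restrict_space borel torus)"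
    by (rule measurable_restrict_space1)
  then show ?thesis using measurable_cong_sets[OF sets_haar_torus refl] by blast
qed

text \<open>The character with exponent \<alpha> - \<beta>. The two exponents are kept apart because
  such products arise from a monomial times the conjugate of another.\<close>

definition torus_char :: "('n::finite \<Rightarrow> nat) \<Rightarrow> ('n \<Rightarrow> nat) \<Rightarrow> real^('n + 'n)^('n + 'n) \<Rightarrow> complex" where
  "torus_char \<alpha> \<beta> t = (\<Prod>k\<in>UNIV. torus_coord t k ^ \<alpha> k * cnj (torus_coord t k) ^ \<beta> k)"

lemma torus_char_measurable [measurable]: "torus_char \<alpha> \<beta> \<in> borel_measurable haar_torus"
  unfolding torus_char_def[abs_def] by measurable

lemma cmod_torus_char: "t \<in> torus \<Longrightarrow> cmod (torus_char \<alpha> \<beta> t) = 1"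
  by (simp add: torus_char_def norm_mult norm_power cmod_torus_coord flip: prod_norm)

text \<open>For distinct exponents, a suitable translation multiplies the character by -1, so the
  invariant integral equals its own negative.\<close>

lemma integral_torus_char:
  fixes \<alpha> \<beta> :: "'n::finite \<Rightarrow> nat"
  shows "(LINT t|haar_torus. torus_char \<alpha> \<beta> t) = (if \<alpha> = \<beta> then 1 else 0)"
proof (cases "\<alpha> = \<beta>")
  case True
  interpret prob_space "haar_torus :: (real^('n + 'n)^('n + 'n)) measure" by (rule prob_haar_torus)
  have "(LINT t|haar_torus. torus_char \<alpha> \<beta> t) = (LINT t|(haar_torus :: (real^('n + 'n)^('n + 'n)) measure). 1)"
  proof (rule Bochner_Integration.integral_cong[OF refl])
    fix t :: "real^('n + 'n)^('n + 'n)" assume "t \<in> space haar_torus"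
    then have "torus_coord t k * cnj (torus_coord t k) = 1" for k
      by (simp add: space_haar_torus cmod_torus_coord flip: complex_norm_square)
    then show "torus_char \<alpha> \<beta> t = 1" by (simp add: torus_char_def True flip: power_mult_distrib)
  qed
  then show ?thesis using True by (simp add: prob_space)
next
  case False
  then obtain k where k: "\<alpha> k \<noteq> \<beta> k" by blast
  \<comment> \<open>Only a coordinate where the exponents differ is rotated, by the angle that makes
    the total phase equal to pi.\<close>
  define \<theta> :: "real^'n" where "\<theta> = (\<chi> i. if i = k then pi / (real (\<alpha> k) - real (\<beta> k)) else 0)"
  define s where "s = torus_elem \<theta>"
  have [measurable]: "(\<lambda>u. s ** u) \<in> measurable haar_torus haar_torus"
  proof -
    have "(\<lambda>u. s ** u) \<in> borel_measurable borel"
      by (intro borel_measurable_continuous_onI linear_continuous_on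
          linear_conv_bounded_linear[THEN iffD1] linearI)
        (simp_all add: matrix_add_ldistrib vec_eq_iff matrix_matrix_mult_def sum_distrib_left
          sum.distrib algebra_simps)
    moreover have "s ** u \<in> torus" if "u \<in> torus" for u
      using that unfolding s_def torus_def by (auto simp: torus_elem_mult torus_elem_in_torus[unfolded torus_def])
    ultimately have "(\<lambda>u. s ** u) \<in> measurable (restrict_space borel torus) (restrict_space borel torus)"
      by (intro measurable_restrict_space3) auto
    then show ?thesis using measurable_cong_sets[OF sets_haar_torus sets_haar_torus] by blast
  qed
  have "(\<Prod>i\<in>UNIV. cis (\<theta> $ i) ^ \<alpha> i * cnj (cis (\<theta> $ i)) ^ \<beta> i) = (\<Prod>i\<in>UNIV. if i = k then - 1 else 1)"
  proof (rule prod.cong[OF refl])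
    fix i
    show "cis (\<theta> $ i) ^ \<alpha> i * cnj (cis (\<theta> $ i)) ^ \<beta> i = (if i = k then - 1 else 1)"
    proof (cases "i = k")
      case True
      have "cis (\<theta> $ k) ^ \<alpha> k * cnj (cis (\<theta> $ k)) ^ \<beta> k = cis ((real (\<alpha> k) - real (\<beta> k)) * \<theta> $ k)"
        unfolding cis_cnj Complex.DeMoivre cis_mult by (rule arg_cong[where f = cis]) (simp add: algebra_simps)
      also have "(real (\<alpha> k) - real (\<beta> k)) * \<theta> $ k = pi" using k by (simp add: \<theta>_def)
      finally show ?thesis using True by simp
    qed (simp add: \<theta>_def)
  qed
  also have "\<dots> = - 1" by simp
  finally have m: "(\<Prod>i\<in>UNIV. cis (\<theta> $ i) ^ \<alpha> i * cnj (cis (\<theta> $ i)) ^ \<beta> i) = - 1" .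
  have "torus_char \<alpha> \<beta> (s ** t) = - torus_char \<alpha> \<beta> t" if "t \<in> torus" for t
  proof -
    have "torus_char \<alpha> \<beta> (s ** t) = (\<Prod>i\<in>UNIV. cis (\<theta> $ i) ^ \<alpha> i * cnj (cis (\<theta> $ i)) ^ \<beta> i) * torus_char \<alpha> \<beta> t"
      unfolding torus_char_def prod.distrib[symmetric]
      by (intro prod.cong refl) (simp add: s_def torus_coord_mult that power_mult_distrib mult_ac)
    then show ?thesis unfolding m by simp
  qed
  then have eq: "torus_char \<alpha> \<beta> (s ** t) = - torus_char \<alpha> \<beta> t" if "t \<in> space haar_torus" for t
    using that by (simp add: space_haar_torus)
  have "(LINT t|haar_torus. torus_char \<alpha> \<beta> t) = (LINT t|distr haar_torus haar_torus (\<lambda>u. s ** u). torus_char \<alpha> \<beta> t)"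
    unfolding s_def by (subst haar_torus_invariant[OF torus_elem_in_torus]) (rule refl)
  also have "\<dots> = (LINT t|haar_torus. torus_char \<alpha> \<beta> (s ** t))"
    by (rule integral_distr) measurable
  also have "\<dots> = (LINT t|haar_torus. - torus_char \<alpha> \<beta> t)"
    by (rule Bochner_Integration.integral_cong[OF refl eq])
  finally show ?thesis using False by simp
qed

lemma integral_pair_mult:
  fixes f :: "'a \<Rightarrow> complex" and g :: "'b \<Rightarrow> complex"
  assumes "prob_space M" "prob_space N"
    and [measurable]: "f \<in> borel_measurable M" "g \<in> borel_measurable N"
    and bd: "\<And>x. x \<in> space M \<Longrightarrow> cmod (f x) \<le> B" "\<And>x. x \<in> space N \<Longrightarrow> cmod (g x) \<le> C"
  shows "has_bochner_integral (M \<Otimes>\<^sub>M N) (\<lambda>p. f (fst p) * g (snd p)) (integral\<^sup>L M f * integral\<^sup>L N g)"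
proof -
  interpret M: prob_space M by fact
  interpret N: prob_space N by fact
  interpret P: pair_prob_space M N by standard
  have int: "integrable (M \<Otimes>\<^sub>M N) (\<lambda>p. f (fst p) * g (snd p))"
  proof (rule P.integrable_const_bound[of _ "B * C"])
    show "AE p in M \<Otimes>\<^sub>M N. norm (f (fst p) * g (snd p)) \<le> B * C"
    proof (rule AE_I2)
      fix p assume "p \<in> space (M \<Otimes>\<^sub>M N)"
      then have "cmod (f (fst p)) \<le> B" "cmod (g (snd p)) \<le> C" using bd by (auto simp: space_pair_measure)
      then show "norm (f (fst p) * g (snd p)) \<le> B * C"
        unfolding norm_mult by (intro mult_mono) (use norm_ge_zero order_trans in blast)+
    qed
  qed measurable
  then have "integrable (M \<Otimes>\<^sub>M N) (\<lambda>(x, y). f x * g y)" by (simp add: case_prod_beta')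
  from P.integral_fst'[OF this] int show ?thesis
    by (simp add: has_bochner_integral_iff case_prod_beta')
qed

abbreviation (input) haar_torus2 :: "((real^('n::finite + 'n)^('n + 'n)) \<times> (real^('n + 'n)^('n + 'n))) measure" where
  "haar_torus2 \<equiv> haar_torus \<Otimes>\<^sub>M haar_torus"

text \<open>Distinct indices give distinct pairs of exponents by \<open>inj\<close>, hence
  orthogonal monomials on the product torus. The nonnegative integral is used because that is what
  \<open>Fatou_bound\<close> takes.\<close>

lemma torus_Parseval:
  fixes c :: "'g \<Rightarrow> complex" and \<alpha> \<beta> :: "'g \<Rightarrow> 'n::finite \<Rightarrow> nat"
  assumes fin: "finite \<Gamma>" and inj: "inj_on (\<lambda>\<gamma>. (\<alpha> \<gamma>, \<beta> \<gamma>)) \<Gamma>"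
  shows "(\<integral>\<^sup>+p. ennreal ((cmod (\<Sum>\<gamma>\<in>\<Gamma>. c \<gamma> * (\<Prod>k\<in>UNIV. torus_coord (snd p) k ^ \<alpha> \<gamma> k) *
      (\<Prod>k\<in>UNIV. torus_coord (fst p) k ^ \<beta> \<gamma> k)))\<^sup>2) \<partial>haar_torus2) = ennreal (\<Sum>\<gamma>\<in>\<Gamma>. (cmod (c \<gamma>))\<^sup>2)"
proof -
  define F where "F p = (\<Sum>\<gamma>\<in>\<Gamma>. c \<gamma> * (\<Prod>k\<in>UNIV. torus_coord (snd p) k ^ \<alpha> \<gamma> k) *
      (\<Prod>k\<in>UNIV. torus_coord (fst p) k ^ \<beta> \<gamma> k))" for p :: "(real^('n + 'n)^('n + 'n)) \<times> (real^('n + 'n)^('n + 'n))"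
  have F: "of_real ((cmod (F p))\<^sup>2) = (\<Sum>\<gamma>\<in>\<Gamma>. \<Sum>\<delta>\<in>\<Gamma>. (c \<gamma> * cnj (c \<delta>)) *
      (torus_char (\<beta> \<gamma>) (\<beta> \<delta>) (fst p) * torus_char (\<alpha> \<gamma>) (\<alpha> \<delta>) (snd p)))" for p
    unfolding complex_norm_square F_def cnj_sum sum_product
    by (intro sum.cong refl) (simp add: torus_char_def prod.distrib mult_ac)
  have "has_bochner_integral haar_torus2 (\<lambda>p. \<Sum>\<gamma>\<in>\<Gamma>. \<Sum>\<delta>\<in>\<Gamma>. (c \<gamma> * cnj (c \<delta>)) *
      (torus_char (\<beta> \<gamma>) (\<beta> \<delta>) (fst p) * torus_char (\<alpha> \<gamma>) (\<alpha> \<delta>) (snd p)))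
    (\<Sum>\<gamma>\<in>\<Gamma>. \<Sum>\<delta>\<in>\<Gamma>. (c \<gamma> * cnj (c \<delta>)) *
      (integral\<^sup>L haar_torus (torus_char (\<beta> \<gamma>) (\<beta> \<delta>)) * integral\<^sup>L haar_torus (torus_char (\<alpha> \<gamma>) (\<alpha> \<delta>))))"
    by (intro has_bochner_integral_sum has_bochner_integral_mult_right integral_pair_mult[where B=1 and C=1] prob_haar_torus)
      (simp_all add: space_haar_torus cmod_torus_char)
  moreover have "(\<Sum>\<gamma>\<in>\<Gamma>. \<Sum>\<delta>\<in>\<Gamma>. (c \<gamma> * cnj (c \<delta>)) *
      (integral\<^sup>L haar_torus (torus_char (\<beta> \<gamma>) (\<beta> \<delta>)) * integral\<^sup>L haar_torus (torus_char (\<alpha> \<gamma>) (\<alpha> \<delta>)))) =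
      of_real (\<Sum>\<gamma>\<in>\<Gamma>. (cmod (c \<gamma>))\<^sup>2)"
  proof -
    have "(\<Sum>\<delta>\<in>\<Gamma>. (c \<gamma> * cnj (c \<delta>)) *
      (integral\<^sup>L haar_torus (torus_char (\<beta> \<gamma>) (\<beta> \<delta>)) * integral\<^sup>L haar_torus (torus_char (\<alpha> \<gamma>) (\<alpha> \<delta>)))) =
      of_real ((cmod (c \<gamma>))\<^sup>2)" if "\<gamma> \<in> \<Gamma>" for \<gamma>
    proof -
      have "(\<Sum>\<delta>\<in>\<Gamma>. (c \<gamma> * cnj (c \<delta>)) *
      (integral\<^sup>L haar_torus (torus_char (\<beta> \<gamma>) (\<beta> \<delta>)) * integral\<^sup>L haar_torus (torus_char (\<alpha> \<gamma>) (\<alpha> \<delta>)))) =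
        (\<Sum>\<delta>\<in>\<Gamma>. if \<delta> = \<gamma> then c \<gamma> * cnj (c \<delta>) else 0)"
        using inj_onD[OF inj _ that] by (intro sum.cong refl) (auto simp: integral_torus_char)
      then show ?thesis using fin that by (simp only: sum.delta complex_norm_square) simp
    qed
    then show ?thesis by simp
  qed
  ultimately have "has_bochner_integral haar_torus2 (\<lambda>p. complex_of_real ((cmod (F p))\<^sup>2)) (of_real (\<Sum>\<gamma>\<in>\<Gamma>. (cmod (c \<gamma>))\<^sup>2))"
    unfolding F by simp
  then have "has_bochner_integral haar_torus2 (\<lambda>p. (cmod (F p))\<^sup>2) (\<Sum>\<gamma>\<in>\<Gamma>. (cmod (c \<gamma>))\<^sup>2)"
    by (simp only: has_bochner_integral_iff complex_of_real_integrable_eq integral_complex_of_real of_real_eq_iff)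
  then show ?thesis
    unfolding F_def[symmetric] has_bochner_integral_iff by (subst nn_integral_eq_integral) simp_all
qed

section \<open>The averaged kernel\<close>

text \<open>The Fock space norm, cut off at degree 2N in each variable, of the functional with
  moments \<open>\<Sum>i\<in>I. a i * w i ^ \<alpha>\<close>. It is matched to the index box of
  \<open>quad_kernel_truncation\<close>.\<close>

definition coeff_norm :: "nat \<Rightarrow> 'i set \<Rightarrow> ('i \<Rightarrow> complex) \<Rightarrow> ('i \<Rightarrow> complex^'n::finite) \<Rightarrow> real" where
  "coeff_norm N I a w = (\<Sum>\<alpha>\<in>PiE UNIV (\<lambda>_. {..<2 * N}).
     (cmod (\<Sum>i\<in>I. a i * (\<Prod>k\<in>UNIV. w i $ k ^ \<alpha> k)))\<^sup>2 / (\<Prod>k\<in>UNIV. fact (\<alpha> k)))"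

lemma exp_partial_sums: "(\<lambda>N. \<Sum>n<N. z ^ n /\<^sub>R fact n) \<longlonglongrightarrow> exp (z :: complex)"
  using exp_converges[of z] by (simp add: sums_def)

text \<open>Expanding the square recovers the partial sums of exp(w cnj(w')), so the limit is the
  Gram form of the coherent states, with their factor sqrt(pi) per coordinate divided out.\<close>

lemma coeff_norm_tendsto:
  fixes w :: "'i \<Rightarrow> complex^'n::finite"
  shows "(\<lambda>N. coeff_norm N I a w) \<longlonglongrightarrow>
    (L2_norm (\<lambda>x. \<Sum>i\<in>I. a i * coherent (w i) x))\<^sup>2 / sqrt pi ^ CARD('n)"
proof -
  define P where "P \<alpha> = complex_of_real (\<Prod>k\<in>UNIV. fact (\<alpha> k))" for \<alpha> :: "'n \<Rightarrow> nat"
  have eq: "complex_of_real (coeff_norm N I a w) =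
      (\<Sum>i\<in>I. \<Sum>j\<in>I. a i * cnj (a j) * (\<Prod>k\<in>UNIV. \<Sum>n<2 * N. (w i $ k * cnj (w j $ k)) ^ n /\<^sub>R fact n))" for N
  proof -
    have "complex_of_real (coeff_norm N I a w) = (\<Sum>\<alpha>\<in>PiE UNIV (\<lambda>_. {..<2 * N}).
        \<Sum>i\<in>I. \<Sum>j\<in>I. a i * cnj (a j) * (\<Prod>k\<in>UNIV. (w i $ k * cnj (w j $ k)) ^ \<alpha> k /\<^sub>R fact (\<alpha> k)))"
      unfolding coeff_norm_def of_real_sum of_real_divide complex_norm_square cnj_sum sum_product sum_divide_distrib
      by (intro sum.cong refl)
        (simp add: scaleR_conv_of_real prod.distrib power_mult_distrib prod_inversef[symmetric, unfolded o_def]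
          divide_inverse of_real_prod mult_ac)
    also have "\<dots> = (\<Sum>i\<in>I. \<Sum>j\<in>I. \<Sum>\<alpha>\<in>PiE UNIV (\<lambda>_. {..<2 * N}).
        a i * cnj (a j) * (\<Prod>k\<in>UNIV. (w i $ k * cnj (w j $ k)) ^ \<alpha> k /\<^sub>R fact (\<alpha> k)))"
      by (subst sum.swap, rule sum.cong[OF refl], subst sum.swap, rule refl)
    finally show ?thesis
      by (simp add: prod_sum_PiE sum_distrib_left)
  qed
  have "(\<lambda>N. \<Sum>n<2 * N. z ^ n /\<^sub>R fact n) \<longlonglongrightarrow> exp (z :: complex)" for z
    using LIMSEQ_subseq_LIMSEQ[OF exp_partial_sums, of "\<lambda>N. 2 * N" z] by (simp add: strict_mono_def o_def)
  then have "(\<lambda>N. complex_of_real (coeff_norm N I a w)) \<longlonglongrightarrow>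
      (\<Sum>i\<in>I. \<Sum>j\<in>I. a i * cnj (a j) * (\<Prod>k\<in>UNIV. exp (w i $ k * cnj (w j $ k))))"
    unfolding eq by (intro tendsto_intros)
  moreover have "(\<Sum>i\<in>I. \<Sum>j\<in>I. a i * cnj (a j) * (\<Prod>k\<in>UNIV. exp (w i $ k * cnj (w j $ k)))) =
      of_real ((L2_norm (\<lambda>x. \<Sum>i\<in>I. a i * coherent (w i) x))\<^sup>2 / sqrt pi ^ CARD('n))"
  proof -
    have L2: "(\<lambda>x. \<Sum>i\<in>I. a i * coherent (w i) x) \<in> L2"
      by (intro L2_sum L2_scale coherent_L2)
    have "of_real ((L2_norm (\<lambda>x. \<Sum>i\<in>I. a i * coherent (w i) x))\<^sup>2) =
      (\<Sum>i\<in>I. \<Sum>j\<in>I. a i * cnj (a j) * (of_real (sqrt pi ^ CARD('n)) * (\<Prod>k\<in>UNIV. exp (w i $ k * cnj (w j $ k)))))"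
      unfolding L2_inner_self[symmetric]
      by (simp add: L2_inner_sum_left L2_inner_sum_right coherent_L2 L2 L2_inner_coherent prod.distrib sum_distrib_left mult.assoc)
    also have "\<dots> = of_real (sqrt pi ^ CARD('n)) * (\<Sum>i\<in>I. \<Sum>j\<in>I. a i * cnj (a j) * (\<Prod>k\<in>UNIV. exp (w i $ k * cnj (w j $ k))))"
      by (simp add: sum_distrib_left mult_ac)
    finally show ?thesis unfolding of_real_divide by simp
  qed
  ultimately show ?thesis by (simp only: tendsto_of_real_iff)
qed

text \<open>For each truncation, Parseval leaves squared coefficients \<open>c \<gamma>\<close> that
  are products of a kernel coefficient and one moment of each combination. Bounding the kernel
  coefficient makes the sum factor into two \<open>coeff_norm\<close>s.\<close>

lemma averaged_kernel_bound:
  fixes w :: "'i \<Rightarrow> complex^'n::finite" and v :: "'j \<Rightarrow> complex^'n" and s \<tau> :: "'n \<Rightarrow> real"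
    and a :: "'i \<Rightarrow> complex" and b :: "'j \<Rightarrow> complex" and I :: "'i set" and J :: "'j set"
  assumes s: "\<And>k. 0 \<le> s k" "\<And>k. (s k)\<^sup>2 + (\<tau> k)\<^sup>2 = 1"
  defines "\<Phi> \<equiv> (\<lambda>p. \<Sum>i\<in>I. \<Sum>j\<in>J. a i * cnj (b j) * (\<Prod>k\<in>UNIV. of_real (sqrt (pi * s k)) *
      exp (of_real (s k) * ((torus_coord (snd p) k * w i $ k) * (torus_coord (fst p) k * cnj (v j $ k))) +
           of_real (\<tau> k) * ((torus_coord (fst p) k * cnj (v j $ k))\<^sup>2 - (torus_coord (snd p) k * w i $ k)\<^sup>2) / 2)))"
  shows "(\<integral>\<^sup>+p. ennreal ((cmod (\<Phi> p))\<^sup>2) \<partial>haar_torus2) \<le>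
    ennreal ((\<Prod>k\<in>UNIV. s k) * (L2_norm (\<lambda>x. \<Sum>i\<in>I. a i * coherent (w i) x))\<^sup>2 *
      (L2_norm (\<lambda>x. \<Sum>j\<in>J. b j * coherent (v j) x))\<^sup>2)"
proof -
  define e where "e p k i j = of_real (s k) * ((torus_coord (snd p) k * w i $ k) * (torus_coord (fst p) k * cnj (v j $ k))) +
           of_real (\<tau> k) * ((torus_coord (fst p) k * cnj (v j $ k))\<^sup>2 - (torus_coord (snd p) k * w i $ k)\<^sup>2) / 2"
    for p :: "(real^('n + 'n)^('n + 'n)) \<times> (real^('n + 'n)^('n + 'n))" and k i j
  define \<Psi> where "\<Psi> N p = (\<Sum>i\<in>I. \<Sum>j\<in>J. a i * cnj (b j) * (\<Prod>k\<in>UNIV. of_real (sqrt (pi * s k)) *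
      (\<Sum>d<N. e p k i j ^ d /\<^sub>R fact d)))" for N p
  have lim: "(\<lambda>N. \<Psi> N p) \<longlonglongrightarrow> \<Phi> p" for p
    unfolding \<Psi>_def \<Phi>_def e_def by (intro tendsto_intros exp_partial_sums)
  have meas [measurable]: "\<Psi> N \<in> borel_measurable haar_torus2" for N
    unfolding \<Psi>_def[abs_def] e_def by measurable
  have bound: "(\<integral>\<^sup>+p. ennreal ((cmod (\<Psi> N p))\<^sup>2) \<partial>haar_torus2) \<le>
      ennreal ((\<Prod>k\<in>UNIV. pi * s k) * coeff_norm N I a w * coeff_norm N J b v)" for N
  proof -
    have "\<exists>\<mu>. (\<forall>\<alpha> \<beta>. (\<mu> \<alpha> \<beta>)\<^sup>2 * (fact \<alpha> * fact \<beta>) \<le> 1) \<and>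
      (\<forall>p q :: complex. (\<Sum>d<N. (of_real (s k) * (p * q) + of_real (\<tau> k) * (q\<^sup>2 - p\<^sup>2) / 2) ^ d /\<^sub>R fact d) =
      (\<Sum>(\<alpha>, \<beta>)\<in>{..<2 * N} \<times> {..<2 * N}. of_real (\<mu> \<alpha> \<beta>) * p ^ \<alpha> * q ^ \<beta>))" for k
      by (rule quad_kernel_truncation[OF s(2)[of k], of N]) blast
    then have "\<forall>k. \<exists>\<mu>. (\<forall>\<alpha> \<beta>. (\<mu> \<alpha> \<beta>)\<^sup>2 * (fact \<alpha> * fact \<beta>) \<le> 1) \<and>
      (\<forall>p q :: complex. (\<Sum>d<N. (of_real (s k) * (p * q) + of_real (\<tau> k) * (q\<^sup>2 - p\<^sup>2) / 2) ^ d /\<^sub>R fact d) =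
      (\<Sum>(\<alpha>, \<beta>)\<in>{..<2 * N} \<times> {..<2 * N}. of_real (\<mu> \<alpha> \<beta>) * p ^ \<alpha> * q ^ \<beta>))"
      by (rule allI)
    from choice[OF this] obtain \<mu> :: "'n \<Rightarrow> nat \<Rightarrow> nat \<Rightarrow> real" where
      \<mu>: "\<And>k \<alpha> \<beta>. (\<mu> k \<alpha> \<beta>)\<^sup>2 * (fact \<alpha> * fact \<beta>) \<le> 1" and
      \<mu>_eq: "\<And>k p q. (\<Sum>d<N. (of_real (s k) * (p * q) + of_real (\<tau> k) * (q\<^sup>2 - p\<^sup>2) / 2) ^ d /\<^sub>R fact d) =
      (\<Sum>(\<alpha>, \<beta>)\<in>{..<2 * N} \<times> {..<2 * N}. complex_of_real (\<mu> k \<alpha> \<beta>) * p ^ \<alpha> * q ^ \<beta>)"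
      by blast
    \<comment> \<open>A multi-index \<gamma> assigns to each coordinate a pair of exponents, the
      first for the second torus element with \<open>w\<close>, the second for the first torus
      element with the conjugate of \<open>v\<close>. \<open>A\<close> and \<open>B\<close> are the
      moments, \<open>M\<close> the kernel coefficient.\<close>
    define Box where "Box = {..<2 * N} \<times> {..<2 * N}"
    define \<Gamma> where "\<Gamma> = PiE (UNIV :: 'n set) (\<lambda>_. Box)"
    define A where "A \<alpha> = (\<Sum>i\<in>I. a i * (\<Prod>k\<in>UNIV. w i $ k ^ \<alpha> k))" for \<alpha> :: "'n \<Rightarrow> nat"
    define B where "B \<beta> = (\<Sum>j\<in>J. b j * (\<Prod>k\<in>UNIV. v j $ k ^ \<beta> k))" for \<beta> :: "'n \<Rightarrow> nat"
    define M where "M \<gamma> = (\<Prod>k\<in>UNIV. sqrt (pi * s k) * \<mu> k (fst (\<gamma> k)) (snd (\<gamma> k)))" for \<gamma> :: "'n \<Rightarrow> nat \<times> nat"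
    define c where "c \<gamma> = of_real (M \<gamma>) * A (\<lambda>k. fst (\<gamma> k)) * cnj (B (\<lambda>k. snd (\<gamma> k)))" for \<gamma>
    have fin: "finite \<Gamma>" unfolding \<Gamma>_def Box_def by (intro finite_PiE) auto
    have inj: "inj_on (\<lambda>\<gamma>. (\<lambda>k. fst (\<gamma> k), \<lambda>k. snd (\<gamma> k))) \<Gamma>"
      by (auto simp: inj_on_def fun_eq_iff prod_eq_iff)
    have \<Psi>: "\<Psi> N p = (\<Sum>\<gamma>\<in>\<Gamma>. c \<gamma> * (\<Prod>k\<in>UNIV. torus_coord (snd p) k ^ fst (\<gamma> k)) *
        (\<Prod>k\<in>UNIV. torus_coord (fst p) k ^ snd (\<gamma> k)))" for p
    proof -
      define x where "x = torus_coord (snd p)"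
      define y where "y = torus_coord (fst p)"
      have "(\<Prod>k\<in>UNIV. of_real (sqrt (pi * s k)) * (\<Sum>d<N. e p k i j ^ d /\<^sub>R fact d)) =
          (\<Sum>\<gamma>\<in>\<Gamma>. of_real (M \<gamma>) * (\<Prod>k\<in>UNIV. x k ^ fst (\<gamma> k)) * (\<Prod>k\<in>UNIV. y k ^ snd (\<gamma> k)) *
            (\<Prod>k\<in>UNIV. w i $ k ^ fst (\<gamma> k)) * cnj (\<Prod>k\<in>UNIV. v j $ k ^ snd (\<gamma> k)))" for i j
      proof -
        have "(\<Prod>k\<in>UNIV. of_real (sqrt (pi * s k)) * (\<Sum>d<N. e p k i j ^ d /\<^sub>R fact d)) =
            (\<Prod>k\<in>UNIV. \<Sum>g\<in>Box. of_real (sqrt (pi * s k)) * (of_real (\<mu> k (fst g) (snd g)) *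
              (x k * w i $ k) ^ fst g * (y k * cnj (v j $ k)) ^ snd g))"
          unfolding e_def \<mu>_eq x_def[symmetric] y_def[symmetric] Box_def[symmetric]
          by (simp add: case_prod_beta sum_distrib_left)
        also have "\<dots> = (\<Sum>\<gamma>\<in>\<Gamma>. \<Prod>k\<in>UNIV. of_real (sqrt (pi * s k)) * (of_real (\<mu> k (fst (\<gamma> k)) (snd (\<gamma> k))) *
              (x k * w i $ k) ^ fst (\<gamma> k) * (y k * cnj (v j $ k)) ^ snd (\<gamma> k)))"
          unfolding \<Gamma>_def by (rule prod_sum_PiE) (auto simp: Box_def)
        also have "\<dots> = (\<Sum>\<gamma>\<in>\<Gamma>. of_real (M \<gamma>) * (\<Prod>k\<in>UNIV. x k ^ fst (\<gamma> k)) * (\<Prod>k\<in>UNIV. y k ^ snd (\<gamma> k)) *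
            (\<Prod>k\<in>UNIV. w i $ k ^ fst (\<gamma> k)) * cnj (\<Prod>k\<in>UNIV. v j $ k ^ snd (\<gamma> k)))"
          unfolding M_def
          by (intro sum.cong refl) (simp add: prod.distrib power_mult_distrib of_real_prod cnj_prod mult_ac)
        finally show ?thesis .
      qed
      then have "\<Psi> N p = (\<Sum>i\<in>I. \<Sum>j\<in>J. \<Sum>\<gamma>\<in>\<Gamma>. a i * cnj (b j) * (of_real (M \<gamma>) * (\<Prod>k\<in>UNIV. x k ^ fst (\<gamma> k)) * (\<Prod>k\<in>UNIV. y k ^ snd (\<gamma> k)) *
            (\<Prod>k\<in>UNIV. w i $ k ^ fst (\<gamma> k)) * cnj (\<Prod>k\<in>UNIV. v j $ k ^ snd (\<gamma> k))))"
        unfolding \<Psi>_def by (simp only: sum_distrib_left)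
      also have "\<dots> = (\<Sum>i\<in>I. \<Sum>\<gamma>\<in>\<Gamma>. \<Sum>j\<in>J. a i * cnj (b j) * (of_real (M \<gamma>) * (\<Prod>k\<in>UNIV. x k ^ fst (\<gamma> k)) * (\<Prod>k\<in>UNIV. y k ^ snd (\<gamma> k)) *
            (\<Prod>k\<in>UNIV. w i $ k ^ fst (\<gamma> k)) * cnj (\<Prod>k\<in>UNIV. v j $ k ^ snd (\<gamma> k))))"
        by (intro sum.cong refl) (rule sum.swap)
      also have "\<dots> = (\<Sum>\<gamma>\<in>\<Gamma>. \<Sum>i\<in>I. \<Sum>j\<in>J. a i * cnj (b j) * (of_real (M \<gamma>) * (\<Prod>k\<in>UNIV. x k ^ fst (\<gamma> k)) * (\<Prod>k\<in>UNIV. y k ^ snd (\<gamma> k)) *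
            (\<Prod>k\<in>UNIV. w i $ k ^ fst (\<gamma> k)) * cnj (\<Prod>k\<in>UNIV. v j $ k ^ snd (\<gamma> k))))"
        by (rule sum.swap)
      also have "\<dots> = (\<Sum>\<gamma>\<in>\<Gamma>. c \<gamma> * (\<Prod>k\<in>UNIV. x k ^ fst (\<gamma> k)) * (\<Prod>k\<in>UNIV. y k ^ snd (\<gamma> k)))"
        unfolding c_def A_def B_def cnj_sum
        by (intro sum.cong refl) (simp add: sum_distrib_left sum_distrib_right mult_ac)
      finally show ?thesis unfolding x_def y_def .
    qed
    have "(\<integral>\<^sup>+p. ennreal ((cmod (\<Psi> N p))\<^sup>2) \<partial>haar_torus2) = ennreal (\<Sum>\<gamma>\<in>\<Gamma>. (cmod (c \<gamma>))\<^sup>2)"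
      unfolding \<Psi> by (rule torus_Parseval[OF fin inj])
    \<comment> \<open>The absence of cross terms is decisive here: only the size of each
      \<open>M \<gamma>\<close> matters, and the factorials from its bound are the weights of the
      two norms.\<close>
    also have "(\<Sum>\<gamma>\<in>\<Gamma>. (cmod (c \<gamma>))\<^sup>2) \<le> (\<Sum>\<gamma>\<in>\<Gamma>. (\<Prod>k\<in>UNIV. pi * s k) *
        (((cmod (A (\<lambda>k. fst (\<gamma> k))))\<^sup>2 / (\<Prod>k\<in>UNIV. fact (fst (\<gamma> k)))) *
        ((cmod (B (\<lambda>k. snd (\<gamma> k))))\<^sup>2 / (\<Prod>k\<in>UNIV. fact (snd (\<gamma> k))))))"
    proof (rule sum_mono)
      fix \<gamma>
      have "(M \<gamma>)\<^sup>2 \<le> (\<Prod>k\<in>UNIV. pi * s k * (1 / (fact (fst (\<gamma> k)) * fact (snd (\<gamma> k)))))"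
        unfolding M_def prod_power_distrib
      proof (intro prod_mono conjI)
        fix k
        have "(\<mu> k (fst (\<gamma> k)) (snd (\<gamma> k)))\<^sup>2 \<le> 1 / (fact (fst (\<gamma> k)) * fact (snd (\<gamma> k)))"
          using \<mu>[of k "fst (\<gamma> k)" "snd (\<gamma> k)"] by (simp add: pos_le_divide_eq)
        then show "(sqrt (pi * s k) * \<mu> k (fst (\<gamma> k)) (snd (\<gamma> k)))\<^sup>2 \<le> pi * s k * (1 / (fact (fst (\<gamma> k)) * fact (snd (\<gamma> k))))"
          unfolding power_mult_distrib using s(1)[of k] by (simp only: real_sqrt_pow2 mult_nonneg_nonneg pi_ge_zero mult_left_mono)
      qed simp
      also have "\<dots> = (\<Prod>k\<in>UNIV. pi * s k) * (1 / ((\<Prod>k\<in>UNIV. fact (fst (\<gamma> k))) * (\<Prod>k\<in>UNIV. fact (snd (\<gamma> k)))))"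
        by (simp add: prod.distrib prod_dividef)
      finally have "(M \<gamma>)\<^sup>2 * ((cmod (A (\<lambda>k. fst (\<gamma> k))))\<^sup>2 * (cmod (B (\<lambda>k. snd (\<gamma> k))))\<^sup>2) \<le>
          (\<Prod>k\<in>UNIV. pi * s k) * (1 / ((\<Prod>k\<in>UNIV. fact (fst (\<gamma> k))) * (\<Prod>k\<in>UNIV. fact (snd (\<gamma> k))))) *
          ((cmod (A (\<lambda>k. fst (\<gamma> k))))\<^sup>2 * (cmod (B (\<lambda>k. snd (\<gamma> k))))\<^sup>2)"
        by (rule mult_right_mono) simp
      then show "(cmod (c \<gamma>))\<^sup>2 \<le> (\<Prod>k\<in>UNIV. pi * s k) *
        (((cmod (A (\<lambda>k. fst (\<gamma> k))))\<^sup>2 / (\<Prod>k\<in>UNIV. fact (fst (\<gamma> k)))) *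
        ((cmod (B (\<lambda>k. snd (\<gamma> k))))\<^sup>2 / (\<Prod>k\<in>UNIV. fact (snd (\<gamma> k)))))"
        unfolding c_def norm_mult power_mult_distrib by (simp add: mult.assoc)
    qed
    also have "\<dots> = (\<Prod>k\<in>UNIV. pi * s k) * (\<Sum>\<gamma>\<in>\<Gamma>.
        (((cmod (A (\<lambda>k. fst (\<gamma> k))))\<^sup>2 / (\<Prod>k\<in>UNIV. fact (fst (\<gamma> k)))) *
        ((cmod (B (\<lambda>k. snd (\<gamma> k))))\<^sup>2 / (\<Prod>k\<in>UNIV. fact (snd (\<gamma> k))))))"
      by (rule sum_distrib_left[symmetric])
    also have "(\<Sum>\<gamma>\<in>\<Gamma>.
        (((cmod (A (\<lambda>k. fst (\<gamma> k))))\<^sup>2 / (\<Prod>k\<in>UNIV. fact (fst (\<gamma> k)))) *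
        ((cmod (B (\<lambda>k. snd (\<gamma> k))))\<^sup>2 / (\<Prod>k\<in>UNIV. fact (snd (\<gamma> k)))))) =
        (\<Sum>(\<alpha>, \<beta>)\<in>PiE UNIV (\<lambda>_. {..<2 * N}) \<times> PiE UNIV (\<lambda>_. {..<2 * N}).
          ((cmod (A \<alpha>))\<^sup>2 / (\<Prod>k\<in>UNIV. fact (\<alpha> k))) * ((cmod (B \<beta>))\<^sup>2 / (\<Prod>k\<in>UNIV. fact (\<beta> k))))"
      \<comment> \<open>A function into pairs of exponents is the same as a pair of exponent
        functions; this separates the variables.\<close>
      by (rule sum.reindex_bij_witness[where i = "\<lambda>(\<alpha>, \<beta>) k. (\<alpha> k, \<beta> k)" and j = "\<lambda>\<gamma>. (\<lambda>k. fst (\<gamma> k), \<lambda>k. snd (\<gamma> k))"])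
        (auto simp: \<Gamma>_def Box_def PiE_UNIV_domain Pi_iff mem_Times_iff)
    also have "\<dots> = coeff_norm N I a w * coeff_norm N J b v"
      unfolding coeff_norm_def A_def[symmetric] B_def[symmetric]
      by (simp only: sum_product sum.cartesian_product case_prod_conv)
    finally show ?thesis by (simp add: ennreal_leI mult.assoc)
  qed
  have "(\<lambda>N. (\<Prod>k\<in>UNIV. pi * s k) * coeff_norm N I a w * coeff_norm N J b v) \<longlonglongrightarrow>
      (\<Prod>k\<in>UNIV. pi * s k) * ((L2_norm (\<lambda>x. \<Sum>i\<in>I. a i * coherent (w i) x))\<^sup>2 / sqrt pi ^ CARD('n)) *
      ((L2_norm (\<lambda>x. \<Sum>j\<in>J. b j * coherent (v j) x))\<^sup>2 / sqrt pi ^ CARD('n))"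
    by (intro tendsto_intros coeff_norm_tendsto)
  \<comment> \<open>The pi^n of the kernel cancels against one factor sqrt(pi)^n from each of the
    two limits.\<close>
  moreover have "(\<Prod>k\<in>UNIV. pi * s k) * (u / sqrt pi ^ CARD('n)) * (u' / sqrt pi ^ CARD('n)) =
      (\<Prod>k\<in>UNIV. s k) * u * u'" for u u'
    by (simp add: prod.distrib power_mult_distrib[symmetric] flip: power_mult_distrib)
  ultimately have "(\<lambda>N. (\<Prod>k\<in>UNIV. pi * s k) * coeff_norm N I a w * coeff_norm N J b v) \<longlonglongrightarrow>
      (\<Prod>k\<in>UNIV. s k) * (L2_norm (\<lambda>x. \<Sum>i\<in>I. a i * coherent (w i) x))\<^sup>2 *
      (L2_norm (\<lambda>x. \<Sum>j\<in>J. b j * coherent (v j) x))\<^sup>2"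
    by (simp only:)
  from Fatou_bound[where f = "\<lambda>N p. (cmod (\<Psi> N p))\<^sup>2", OF _ tendsto_power[OF tendsto_norm[OF lim]] bound this]
  show ?thesis by simp
qed

section \<open>Density of the coherent states\<close>

lemma L2_dominated_convergence:
  fixes f :: "'a::euclidean_space \<Rightarrow> complex"
  assumes F: "\<And>n. F n \<in> borel_measurable borel"
    and g: "integrable lborel (\<lambda>x. (g x)\<^sup>2)"
    and dom: "\<And>n x. cmod (F n x) \<le> g x"
    and lim: "\<And>x. (\<lambda>n. F n x) \<longlonglongrightarrow> f x"
  shows "f \<in> L2" and "(\<lambda>n. L2_norm (\<lambda>x. f x - F n x)) \<longlonglongrightarrow> 0"
proof -
  note [measurable] = F
  have fm [measurable]: "f \<in> borel_measurable borel"
    by (rule borel_measurable_LIMSEQ_metric[OF F lim])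
  have fg: "cmod (f x) \<le> g x" for x
    by (rule tendsto_upperbound[OF tendsto_norm[OF lim]]) (simp_all add: dom)
  have g0: "0 \<le> g x" for x using fg[of x] norm_ge_zero order_trans by blast
  show "f \<in> L2"
    by (rule L2_bound[OF g fm]) (simp add: fg power_mono)
  have "(\<lambda>n. LINT x|lborel. (cmod (f x - F n x))\<^sup>2) \<longlonglongrightarrow> (LINT x|(lborel :: 'a measure). 0)"
  proof (rule integral_dominated_convergence)
    show "integrable lborel (\<lambda>x. 4 * (g x)\<^sup>2)" using g by simp
    have "(\<lambda>n. (cmod (f x - F n x))\<^sup>2) \<longlonglongrightarrow> (cmod (f x - f x))\<^sup>2" for x
      by (intro tendsto_intros lim)
    then show "AE x in lborel. (\<lambda>n. (cmod (f x - F n x))\<^sup>2) \<longlonglongrightarrow> 0" by simp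
    have "(cmod (f x - F n x))\<^sup>2 \<le> (2 * g x)\<^sup>2" for n x
      using norm_triangle_ineq4[of "f x" "F n x"] fg[of x] dom[of n x] by (intro power_mono) auto
    then show "AE x in lborel. norm ((cmod (f x - F n x))\<^sup>2) \<le> 4 * (g x)\<^sup>2" for n
      by (simp add: power_mult_distrib)
  qed measurable
  then show "(\<lambda>n. L2_norm (\<lambda>x. f x - F n x)) \<longlonglongrightarrow> 0"
    unfolding L2_norm_def using tendsto_real_sqrt[where x = 0] by simp
qed

text \<open>Lists allow repeated labels, so that addition is concatenation and scaling is a
  map.\<close>

definition coherent_comb :: "(complex \<times> (complex^'n)) list \<Rightarrow> real^'n::finite \<Rightarrow> complex" where
  "coherent_comb cs x = (\<Sum>(c, w)\<leftarrow>cs. c * coherent w x)"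

lemma coherent_comb_sum: "coherent_comb cs = (\<lambda>x. \<Sum>i<length cs. fst (cs ! i) * coherent (snd (cs ! i)) x)"
  by (rule ext) (simp add: coherent_comb_def sum_list_sum_nth atLeast0LessThan case_prod_beta)

lemma coherent_comb_L2: "coherent_comb cs \<in> L2"
  unfolding coherent_comb_sum by (intro L2_sum L2_scale coherent_L2)

definition coherent_approx :: "(real^'n::finite \<Rightarrow> complex) \<Rightarrow> bool" where
  "coherent_approx f \<longleftrightarrow> f \<in> L2 \<and> (\<forall>\<epsilon>>0. \<exists>cs. L2_norm (\<lambda>x. f x - coherent_comb cs x) < \<epsilon>)"

lemma coherent_approx_coherent: "coherent_approx (\<lambda>x. c * coherent w x)"
proof -
  have "coherent_comb [(c, w)] = (\<lambda>x. c * coherent w x)"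
    by (simp add: coherent_comb_def fun_eq_iff)
  then have "L2_norm (\<lambda>x. c * coherent w x - coherent_comb [(c, w)] x) < \<epsilon>" if "\<epsilon> > 0" for \<epsilon>
    using that by (simp add: L2_norm_def)
  then show ?thesis unfolding coherent_approx_def by (blast intro: L2_scale coherent_L2)
qed

lemma coherent_approx_add:
  assumes "coherent_approx f" "coherent_approx g"
  shows "coherent_approx (\<lambda>x. f x + g x)"
  unfolding coherent_approx_def
proof (intro conjI allI impI)
  have L2: "f \<in> L2" "g \<in> L2" using assms unfolding coherent_approx_def by blast+
  then show "(\<lambda>x. f x + g x) \<in> L2" by (rule L2_add)
  fix \<epsilon> :: real assume "\<epsilon> > 0"
  then have "\<epsilon> / 2 > 0" by simp
  then obtain cs ds where cs: "L2_norm (\<lambda>x. f x - coherent_comb cs x) < \<epsilon> / 2"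
      and ds: "L2_norm (\<lambda>x. g x - coherent_comb ds x) < \<epsilon> / 2"
    using assms unfolding coherent_approx_def by meson
  have "L2_norm (\<lambda>x. f x + g x - coherent_comb (cs @ ds) x) =
      L2_norm (\<lambda>x. (f x - coherent_comb cs x) + (g x - coherent_comb ds x))"
    by (simp add: coherent_comb_def algebra_simps)
  also have "\<dots> \<le> L2_norm (\<lambda>x. f x - coherent_comb cs x) + L2_norm (\<lambda>x. g x - coherent_comb ds x)"
    by (intro L2_norm_triangle L2_diff L2 coherent_comb_L2)
  finally show "\<exists>cs. L2_norm (\<lambda>x. f x + g x - coherent_comb cs x) < \<epsilon>"
    using cs ds by (intro exI[of _ "cs @ ds"]) linarith
qed

lemma coherent_approx_scale:
  assumes "coherent_approx f"
  shows "coherent_approx (\<lambda>x. c * f x)"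
  unfolding coherent_approx_def
proof (intro conjI allI impI)
  show "(\<lambda>x. c * f x) \<in> L2" using assms unfolding coherent_approx_def by (blast intro: L2_scale)
  fix \<epsilon> :: real assume "\<epsilon> > 0"
  then have "\<epsilon> / (1 + cmod c) > 0" by (simp add: add_pos_nonneg)
  then obtain cs where cs: "L2_norm (\<lambda>x. f x - coherent_comb cs x) < \<epsilon> / (1 + cmod c)"
    using assms unfolding coherent_approx_def by meson
  have "coherent_comb (map (\<lambda>(a, w). (c * a, w)) cs) x = c * coherent_comb cs x" for x
    by (simp add: coherent_comb_def sum_list_const_mult[symmetric] o_def case_prod_beta mult.assoc)
  then have "L2_norm (\<lambda>x. c * f x - coherent_comb (map (\<lambda>(a, w). (c * a, w)) cs) x) =
      cmod c * L2_norm (\<lambda>x. f x - coherent_comb cs x)"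
    by (simp add: L2_norm_scale flip: right_diff_distrib)
  also have "\<dots> \<le> (1 + cmod c) * L2_norm (\<lambda>x. f x - coherent_comb cs x)"
    by (intro mult_right_mono) (simp_all add: L2_norm_nonneg)
  also have "\<dots> < \<epsilon>"
    using cs by (simp add: pos_less_divide_eq add_pos_nonneg mult.commute)
  finally show "\<exists>cs. L2_norm (\<lambda>x. c * f x - coherent_comb cs x) < \<epsilon>" by blast
qed

lemma coherent_approx_sum:
  assumes "finite A" "\<And>y. y \<in> A \<Longrightarrow> coherent_approx (f y)"
  shows "coherent_approx (\<lambda>x. \<Sum>y\<in>A. f y x)"
  using assms
proof (induction A)
  case empty
  then show ?case using coherent_approx_coherent[of 0] by simp
next
  case (insert y A)
  then show ?case using coherent_approx_add[of "f y" "\<lambda>x. \<Sum>y\<in>A. f y x"] by simp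
qed

lemma coherent_approx_limit:
  assumes f: "f \<in> L2" and F: "\<And>n. coherent_approx (F n)"
    and lim: "(\<lambda>n. L2_norm (\<lambda>x. f x - F n x)) \<longlonglongrightarrow> 0"
  shows "coherent_approx f"
  unfolding coherent_approx_def
proof (intro conjI allI impI f)
  fix \<epsilon> :: real assume "\<epsilon> > 0"
  then have \<epsilon>: "\<epsilon> / 2 > 0" by simp
  then obtain n where n: "L2_norm (\<lambda>x. f x - F n x) < \<epsilon> / 2"
    using order_tendstoD(2)[OF lim \<epsilon>] by (auto simp: eventually_at_top_linorder)
  obtain cs where cs: "L2_norm (\<lambda>x. F n x - coherent_comb cs x) < \<epsilon> / 2"
    using F[of n] \<epsilon> unfolding coherent_approx_def by meson
  have L2: "F n \<in> L2" using F[of n] unfolding coherent_approx_def by blast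
  have "L2_norm (\<lambda>x. f x - coherent_comb cs x) =
      L2_norm (\<lambda>x. (f x - F n x) + (F n x - coherent_comb cs x))" by simp
  also have "\<dots> \<le> L2_norm (\<lambda>x. f x - F n x) + L2_norm (\<lambda>x. F n x - coherent_comb cs x)"
    by (intro L2_norm_triangle L2_diff L2 f coherent_comb_L2)
  finally show "\<exists>cs. L2_norm (\<lambda>x. f x - coherent_comb cs x) < \<epsilon>"
    using cs n by (intro exI[of _ cs]) linarith
qed

definition gauss :: "real^'n::finite \<Rightarrow> real" where
  "gauss x = exp (- (x \<bullet> x) / 2)"

lemma gauss_pos: "0 < gauss x"
  by (simp add: gauss_def)

lemma gauss_measurable [measurable]: "gauss \<in> borel_measurable borel"
  unfolding gauss_def[abs_def] by measurable

text \<open>Purely imaginary labels turn the linear exponent into a frequency. The choice y /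
  sqrt(2) cancels the sqrt(2) in the exponent, and the prefactor removes the term y^2 / 4 coming
  from -w^2 / 2.\<close>

lemma coherent_imaginary:
  "gauss x * cis (y \<bullet> x) = (\<Prod>k\<in>UNIV. exp (- of_real ((y $ k)\<^sup>2 / 4))) * coherent (\<chi> k. \<i> * of_real (y $ k / sqrt 2)) x"
proof -
  have "gauss x * cis (y \<bullet> x) = (\<Prod>k\<in>UNIV. exp (\<i> * of_real (y $ k * x $ k) - of_real ((x $ k)\<^sup>2 / 2)))"
    unfolding gauss_def cis_conv_exp exp_of_real[symmetric] exp_add[symmetric] exp_sum[OF finite, symmetric]
    by (rule arg_cong[where f = exp])
      (simp add: inner_vec_def sum_subtractf sum_distrib_left sum_divide_distrib power2_eq_square)
  also have "\<dots> = (\<Prod>k\<in>UNIV. exp (- of_real ((y $ k)\<^sup>2 / 4))) * coherent (\<chi> k. \<i> * of_real (y $ k / sqrt 2)) x"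
    unfolding coherent_def squeezed_def prod.distrib[symmetric]
  proof (rule prod.cong[OF refl])
    fix k
    have "complex_of_real (sqrt 2) * (\<i> * of_real (y $ k / sqrt 2)) * of_real (x $ k) = \<i> * of_real (y $ k * x $ k)"
      by simp
    moreover have "(\<i> * complex_of_real (y $ k / sqrt 2))\<^sup>2 / 2 = - of_real ((y $ k)\<^sup>2 / 4)"
      by (simp add: power_mult_distrib power_divide flip: of_real_power)
    ultimately show "exp (\<i> * of_real (y $ k * x $ k) - of_real ((x $ k)\<^sup>2 / 2)) =
        exp (- of_real ((y $ k)\<^sup>2 / 4)) * (of_real (1 / sqrt ((1 :: real^'a) $ k)) *
        exp (of_real (sqrt 2) * (\<chi> k. \<i> * of_real (y $ k / sqrt 2)) $ k * of_real (x $ k / (1 :: real^'a) $ k) -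
          of_real ((x $ k / (1 :: real^'a) $ k)\<^sup>2 / 2) - ((\<chi> k. \<i> * of_real (y $ k / sqrt 2)) $ k)\<^sup>2 / 2))"
      by (simp add: exp_add[symmetric] mult.assoc)
  qed
  finally show ?thesis .
qed

lemma integrable_gauss_square: "integrable lborel (\<lambda>x :: real^'n::finite. (C * gauss x)\<^sup>2)"
proof -
  have eq: "coherent 0 x = of_real (gauss x)" for x :: "real^'n"
    using coherent_imaginary[of x 0] by (simp flip: zero_vec_def)
  have "integrable lborel (\<lambda>x :: real^'n. (cmod (of_real (gauss x)))\<^sup>2)"
    using L2_integrable[OF coherent_L2[of "0 :: complex^'n"]] unfolding eq .
  then show ?thesis by (simp add: power_mult_distrib)
qed

text \<open>The Gaussian weight turns bounded pointwise convergence into convergence in L^2, so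
  \<open>trig_class_indicator\<close> applies with the weighted exponentials of
  \<open>coherent_imaginary\<close> as starting point.\<close>

lemma coherent_approx_gauss_indicator:
  assumes "B \<in> sets borel"
  shows "coherent_approx (\<lambda>x. of_real (gauss x) * indicator B x)"
proof -
  define Q where "Q h \<longleftrightarrow> h \<in> borel_measurable borel \<and> coherent_approx (\<lambda>x. gauss x * h x)" for h :: "real^'a \<Rightarrow> complex"
  have "Q (indicator B)"
  proof (rule trig_class_indicator[OF _ _ _ _ assms])
    show "Q (\<lambda>x. cis (y \<bullet> x))" for y
      unfolding Q_def coherent_imaginary
      by (auto intro!: borel_measurable_continuous_onI continuous_intros coherent_approx_coherent simp: cis_conv_exp)
  next
    show "Q (\<lambda>x. f x + g x)" if "Q f" "Q g" for f g
      using that coherent_approx_add[of "\<lambda>x. gauss x * f x" "\<lambda>x. gauss x * g x"] unfolding Q_def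
      by (auto simp: distrib_left intro: borel_measurable_add)
  next
    show "Q (\<lambda>x. c * f x)" if "Q f" for f c
      using that coherent_approx_scale[of "\<lambda>x. gauss x * f x" c] unfolding Q_def
      by (auto simp: mult.left_commute intro: borel_measurable_times)
  next
    fix F :: "nat \<Rightarrow> real^'a \<Rightarrow> complex" and f C
    assume Q: "\<And>n. Q (F n)" and C: "\<And>n x. cmod (F n x) \<le> C" and lim: "\<And>x. (\<lambda>n. F n x) \<longlonglongrightarrow> f x"
    have Fm [measurable]: "F n \<in> borel_measurable borel" for n using Q unfolding Q_def by blast
    have "(\<lambda>x. gauss x * F n x) \<in> borel_measurable borel" for n by measurable
    moreover have "cmod (gauss x * F n x) \<le> C * gauss x" for n x
      using C[of n x] gauss_pos[of x] by (simp add: norm_mult mult.commute[of C])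
    moreover have "(\<lambda>n. gauss x * F n x) \<longlonglongrightarrow> gauss x * f x" for x
      by (intro tendsto_intros lim)
    ultimately have conv: "(\<lambda>x. gauss x * f x) \<in> L2" "(\<lambda>n. L2_norm (\<lambda>x. gauss x * f x - gauss x * F n x)) \<longlonglongrightarrow> 0"
      using L2_dominated_convergence[of "\<lambda>n x. gauss x * F n x" "\<lambda>x. C * gauss x" "\<lambda>x. gauss x * f x"] integrable_gauss_square
      by blast+
    have "coherent_approx (\<lambda>x. gauss x * F n x)" for n using Q unfolding Q_def by blast
    from coherent_approx_limit[OF conv(1) this conv(2)]
    have "coherent_approx (\<lambda>x. gauss x * f x)" .
    moreover have "f \<in> borel_measurable borel"
      by (rule borel_measurable_LIMSEQ_metric[OF Fm lim])
    ultimately show "Q f" unfolding Q_def by blast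
  qed
  then show ?thesis unfolding Q_def by blast
qed

text \<open>Simple functions approximate \<open>f / gauss\<close> with modulus at most twice that of
  the limit. Multiplying back by the positive \<open>gauss\<close> gives weighted indicators
  dominated by 2 |f|.\<close>

lemma coherent_approx_L2:
  assumes f: "f \<in> L2"
  shows "coherent_approx f"
proof -
  have fm [measurable]: "f \<in> borel_measurable borel" using f by (rule L2_measurable)
  have "(\<lambda>x. f x / gauss x) \<in> borel_measurable borel" by measurable
  from borel_measurable_implies_sequence_metric[OF this, of 0]
  obtain s where s: "\<And>i. simple_function borel (s i)" "\<And>x. (\<lambda>i. s i x) \<longlonglongrightarrow> f x / gauss x"
      "\<And>i x. dist (s i x) 0 \<le> 2 * dist (f x / gauss x) 0"
    by auto
  have g: "integrable lborel (\<lambda>x. (2 * cmod (f x))\<^sup>2)"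
    using L2_integrable[OF f] by (simp add: power_mult_distrib)
  have [measurable]: "s i \<in> borel_measurable borel" for i
    using s(1) by (rule borel_measurable_simple_function)
  have 1: "(\<lambda>x. gauss x * s i x) \<in> borel_measurable borel" for i by measurable
  have 2: "cmod (gauss x * s i x) \<le> 2 * cmod (f x)" for i x
    using s(3)[of i x] gauss_pos[of x] by (simp add: norm_mult norm_divide field_simps)

  have 3: "(\<lambda>i. gauss x * s i x) \<longlonglongrightarrow> f x" for x
  proof -
    have "gauss x \<noteq> 0" using gauss_pos[of x] by simp
    then have "gauss x * (f x / gauss x) = f x" by simp
    moreover have "(\<lambda>i. gauss x * s i x) \<longlonglongrightarrow> gauss x * (f x / gauss x)"
      by (intro tendsto_intros s)
    ultimately show ?thesis by (simp only:)
  qed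
  have "coherent_approx (\<lambda>x. gauss x * s i x)" for i
  proof -
    have fin: "finite (range (s i))" using simple_functionD(1)[OF s(1)[of i]] by simp
    have "gauss x * s i x = (\<Sum>y\<in>range (s i). y * (of_real (gauss x) * indicator (s i -` {y}) x))" for x
    proof -
      have "(\<Sum>y\<in>range (s i). y * (of_real (gauss x) * indicator (s i -` {y}) x)) = (\<Sum>y\<in>range (s i). if s i x = y then gauss x * y else 0)"
        by (intro sum.cong refl) (auto simp: indicator_def)
      then show ?thesis using fin by simp
    qed
    moreover have "s i -` {y} \<in> sets borel" for y
      using measurable_sets[of "s i" borel borel "{y}"] by simp
    ultimately show ?thesis
      using fin by (simp only:) (intro coherent_approx_sum coherent_approx_scale coherent_approx_gauss_indicator)
  qed
  then show ?thesis
    using L2_dominated_convergence[OF 1 g 2 3] by (intro coherent_approx_limit[OF f])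
qed

section \<open>Limits of coefficients of unitary operators\<close>

lemma coherent_comb_sequence:
  assumes "f \<in> L2"
  obtains cs where "(\<lambda>n. L2_norm (\<lambda>x. f x - coherent_comb (cs n) x)) \<longlonglongrightarrow> 0"
proof -
  have "\<forall>n. \<exists>cs. L2_norm (\<lambda>x. f x - coherent_comb cs x) < 1 / real (Suc n)"
    using coherent_approx_L2[OF assms] unfolding coherent_approx_def by simp
  from choice[OF this] obtain cs where cs: "\<And>n. L2_norm (\<lambda>x. f x - coherent_comb (cs n) x) < 1 / real (Suc n)"
    by blast
  have "(\<lambda>n. L2_norm (\<lambda>x. f x - coherent_comb (cs n) x)) \<longlonglongrightarrow> 0"
  proof (rule Lim_null_comparison)
    show "\<forall>\<^sub>F n in sequentially. norm (L2_norm (\<lambda>x. f x - coherent_comb (cs n) x)) \<le> 1 / real (Suc n)"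
      using cs by (simp add: L2_norm_nonneg less_imp_le)
    show "(\<lambda>n. 1 / real (Suc n)) \<longlonglongrightarrow> 0"
      using LIMSEQ_inverse_real_of_nat by (simp only: inverse_eq_divide)
  qed
  then show ?thesis by (rule that)
qed

lemma L2_norm_tendsto:
  assumes f: "f \<in> L2" and g: "\<And>n. g n \<in> L2" and lim: "(\<lambda>n. L2_norm (\<lambda>x. f x - g n x)) \<longlonglongrightarrow> 0"
  shows "(\<lambda>n. L2_norm (g n)) \<longlonglongrightarrow> L2_norm f"
proof (rule LIM_zero_cancel, rule Lim_null_comparison[OF _ lim], intro always_eventually allI)
  fix n
  have "L2_norm (\<lambda>x. (f x - g n x) + g n x) \<le> L2_norm (\<lambda>x. f x - g n x) + L2_norm (g n)"
    by (intro L2_norm_triangle L2_diff f g)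
  moreover have "L2_norm (\<lambda>x. (- 1) * (f x - g n x) + f x) \<le> L2_norm (\<lambda>x. (- 1) * (f x - g n x)) + L2_norm f"
    by (intro L2_norm_triangle L2_scale L2_diff f g)
  moreover have "L2_norm (\<lambda>x. (- 1) * (f x - g n x)) = L2_norm (\<lambda>x. f x - g n x)"
    by (simp only: L2_norm_scale) simp
  ultimately show "norm (L2_norm (g n) - L2_norm f) \<le> L2_norm (\<lambda>x. f x - g n x)"
    by simp
qed

lemma unitary_L2_diff:
  assumes U: "unitary_L2 U" and f: "f \<in> L2" and g: "g \<in> L2"
  shows "L2_norm (\<lambda>x. U f x - U g x) = L2_norm (\<lambda>x. f x - g x)"
proof -
  note D = unitary_L2_D[OF U]
  have g': "(\<lambda>x. (- 1) * g x) \<in> L2" by (rule L2_scale[OF g])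
  have "L2_eq (U (\<lambda>x. f x + (- 1) * g x)) (\<lambda>x. U f x + U (\<lambda>x. (- 1) * g x) x)"
    by (rule D(3)[OF f g'])
  moreover have "L2_eq (\<lambda>x. U f x + U (\<lambda>x. (- 1) * g x) x) (\<lambda>x. U f x - U g x)"
    using D(4)[OF g, of "- 1"] unfolding L2_eq_def by eventually_elim simp
  ultimately have eq: "L2_eq (U (\<lambda>x. f x - g x)) (\<lambda>x. U f x - U g x)"
    using L2_eq_trans by simp
  have "L2_norm (U (\<lambda>x. f x - g x)) = L2_norm (\<lambda>x. U f x - U g x)"
    by (intro L2_norm_cong eq D(1) L2_diff f g)
  moreover have "L2_norm (U h) = L2_norm h" if "h \<in> L2" for h
    using D(5)[OF that that] unfolding L2_inner_self of_real_eq_iff by (simp add: L2_norm_nonneg)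
  ultimately show ?thesis using L2_diff[OF f g] by simp
qed

lemma L2_inner_unitary_tendsto:
  assumes U: "unitary_L2 U" and f: "f \<in> L2" "\<And>n. f' n \<in> L2" and g: "g \<in> L2" "\<And>n. g' n \<in> L2"
    and lim: "(\<lambda>n. L2_norm (\<lambda>x. f x - f' n x)) \<longlonglongrightarrow> 0" "(\<lambda>n. L2_norm (\<lambda>x. g x - g' n x)) \<longlonglongrightarrow> 0"
  shows "(\<lambda>n. L2_inner (U (f' n)) (g' n)) \<longlonglongrightarrow> L2_inner (U f) g"
proof -
  note D = unitary_L2_D[OF U]
  have nU: "L2_norm (U h) = L2_norm h" if "h \<in> L2" for h
    using D(5)[OF that that] unfolding L2_inner_self of_real_eq_iff by (simp add: L2_norm_nonneg)
  have "(\<lambda>n. L2_inner (U f) g - L2_inner (U (f' n)) (g' n)) \<longlonglongrightarrow> 0"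
  proof (rule Lim_null_comparison)
    have "(\<lambda>n. L2_norm (\<lambda>x. f x - f' n x) * L2_norm g + L2_norm (f' n) * L2_norm (\<lambda>x. g x - g' n x)) \<longlonglongrightarrow>
        0 * L2_norm g + L2_norm f * 0"
      by (intro tendsto_intros lim L2_norm_tendsto f)
    then show "(\<lambda>n. L2_norm (\<lambda>x. f x - f' n x) * L2_norm g + L2_norm (f' n) * L2_norm (\<lambda>x. g x - g' n x)) \<longlonglongrightarrow> 0"
      by simp
    show "\<forall>\<^sub>F n in sequentially. norm (L2_inner (U f) g - L2_inner (U (f' n)) (g' n)) \<le>
      L2_norm (\<lambda>x. f x - f' n x) * L2_norm g + L2_norm (f' n) * L2_norm (\<lambda>x. g x - g' n x)"
    proof (intro always_eventually allI)
      fix n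
      note L = D(1)[OF f(1)] D(1)[OF f(2)[of n]] g(1) g(2)[of n]
      have "L2_inner (U f) g - L2_inner (U (f' n)) (g' n) =
          L2_inner (\<lambda>x. U f x - U (f' n) x) g + L2_inner (U (f' n)) (\<lambda>x. g x - g' n x)"
        by (simp add: L2_inner_diff_left L2_inner_diff_right L)
      also have "cmod \<dots> \<le> cmod (L2_inner (\<lambda>x. U f x - U (f' n) x) g) + cmod (L2_inner (U (f' n)) (\<lambda>x. g x - g' n x))"
        by (rule norm_triangle_ineq)
      also have "\<dots> \<le> L2_norm (\<lambda>x. U f x - U (f' n) x) * L2_norm g + L2_norm (U (f' n)) * L2_norm (\<lambda>x. g x - g' n x)"
        by (intro add_mono L2_Cauchy_Schwarz L2_diff L)
      finally show "norm (L2_inner (U f) g - L2_inner (U (f' n)) (g' n)) \<le>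
          L2_norm (\<lambda>x. f x - f' n x) * L2_norm g + L2_norm (f' n) * L2_norm (\<lambda>x. g x - g' n x)"
        by (simp add: unitary_L2_diff[OF U f(1) f(2)] nU[OF f(2)])
    qed
  qed
  from tendsto_diff[OF tendsto_const[of "L2_inner (U f) g"] this] show ?thesis by simp
qed

section \<open>The averaged coefficient bound\<close>

text \<open>The coefficient of two combinations up to a phase, written through
  \<open>torus_coord\<close> alone. In this form it is visibly measurable in the pair, whatever
  phases \<open>\<rho>\<close> carries.\<close>

definition coherent_kernel :: "real^'n \<Rightarrow> (complex \<times> (complex^'n)) list \<Rightarrow> (complex \<times> (complex^'n)) list \<Rightarrow>
    (real^('n::finite + 'n)^('n + 'n)) \<times> (real^('n + 'n)^('n + 'n)) \<Rightarrow> complex" where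
  "coherent_kernel l cs ds p = (\<Sum>i<length cs. \<Sum>j<length ds. fst (cs ! i) * cnj (fst (ds ! j)) *
     (\<Prod>k\<in>UNIV. of_real (sqrt (pi * (2 * l $ k / ((l $ k)\<^sup>2 + 1)))) *
      exp (of_real (2 * l $ k / ((l $ k)\<^sup>2 + 1)) *
             ((torus_coord (snd p) k * snd (cs ! i) $ k) * (torus_coord (fst p) k * cnj (snd (ds ! j) $ k))) +
           of_real (((l $ k)\<^sup>2 - 1) / ((l $ k)\<^sup>2 + 1)) *
             ((torus_coord (fst p) k * cnj (snd (ds ! j) $ k))\<^sup>2 - (torus_coord (snd p) k * snd (cs ! i) $ k)\<^sup>2) / 2)))"

lemma coherent_kernel_measurable [measurable]: "coherent_kernel l cs ds \<in> borel_measurable haar_torus2"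
  unfolding coherent_kernel_def[abs_def] by measurable

text \<open>The label of the second vector is rotated by -\<theta>1 and then conjugated by the inner
  product, so the first torus coordinate appears without conjugation and the kernel is a power
  series in both coordinates.\<close>

lemma metaplectic_coefficient_coherent_comb:
  assumes rep: "metaplectic_rep \<rho>" and l: "\<And>k. 0 < l $ k" and t: "t1 \<in> torus" "t2 \<in> torus"
  shows "cmod (L2_inner (\<rho> (t1 ** diag_symp l ** t2) (coherent_comb cs)) (coherent_comb ds)) =
    cmod (coherent_kernel l cs ds (t1, t2))"
proof -
  obtain \<theta>1 \<theta>2 where \<theta>: "t1 = torus_elem \<theta>1" "t2 = torus_elem \<theta>2"
    using t unfolding torus_def by blast
  show ?thesis
    unfolding \<theta> coherent_comb_sum metaplectic_coefficient_combination[OF rep l] coherent_kernel_def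
      L2_inner_squeezed_coherent[OF l]
    by (simp add: rotate_vec_def torus_coord_torus_elem cis_cnj)
qed

lemma averaged_coherent_kernel_bound:
  fixes l :: "real^'n::finite"
  assumes l: "\<And>k. 0 < l $ k"
  shows "(\<integral>\<^sup>+p. ennreal ((cmod (coherent_kernel l cs ds p))\<^sup>2) \<partial>haar_torus2) \<le>
    ennreal ((\<Prod>k\<in>UNIV. 2 * l $ k / ((l $ k)\<^sup>2 + 1)) * (L2_norm (coherent_comb cs))\<^sup>2 * (L2_norm (coherent_comb ds))\<^sup>2)"
  unfolding coherent_kernel_def coherent_comb_sum
proof (rule averaged_kernel_bound)
  fix k
  show "0 \<le> 2 * l $ k / ((l $ k)\<^sup>2 + 1)" using l[of k] by simp
  have "(l $ k)\<^sup>2 + 1 \<noteq> 0" using zero_le_power2[of "l $ k"] by linarith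
  then show "(2 * l $ k / ((l $ k)\<^sup>2 + 1))\<^sup>2 + (((l $ k)\<^sup>2 - 1) / ((l $ k)\<^sup>2 + 1))\<^sup>2 = 1"
    by (simp add: power_divide add_divide_distrib[symmetric] divide_eq_eq) (simp add: power2_eq_square algebra_simps)
qed

text \<open>At each fixed pair of torus elements, unitarity makes the coefficients of approximating
  combinations converge. Their moduli are the explicit kernels, so the integrand is a pointwise
  limit of measurable functions and inherits their bound.\<close>

lemma metaplectic_averaged_bound:
  fixes \<rho> :: "real^('n::finite + 'n)^('n + 'n) \<Rightarrow> (real^'n \<Rightarrow> complex) \<Rightarrow> (real^'n \<Rightarrow> complex)"
  assumes rep: "metaplectic_rep \<rho>" and l: "\<And>k. 0 < l $ k" and f: "f \<in> L2" and g: "g \<in> L2"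
  defines "F \<equiv> (\<lambda>p. (cmod (L2_inner (\<rho> (fst p ** diag_symp l ** snd p) f) g))\<^sup>2)"
  shows "F \<in> borel_measurable haar_torus2"
    and "(\<integral>\<^sup>+p. ennreal (F p) \<partial>haar_torus2) \<le>
      ennreal ((\<Prod>k\<in>UNIV. 2 * l $ k / ((l $ k)\<^sup>2 + 1)) * (L2_norm f)\<^sup>2 * (L2_norm g)\<^sup>2)"
proof -
  obtain cs where cs: "(\<lambda>n. L2_norm (\<lambda>x. f x - coherent_comb (cs n) x)) \<longlonglongrightarrow> 0"
    using coherent_comb_sequence[OF f] by blast
  obtain ds where ds: "(\<lambda>n. L2_norm (\<lambda>x. g x - coherent_comb (ds n) x)) \<longlonglongrightarrow> 0"
    using coherent_comb_sequence[OF g] by blast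
  have lim: "(\<lambda>n. (cmod (coherent_kernel l (cs n) (ds n) p))\<^sup>2) \<longlonglongrightarrow> F p" if pp: "p \<in> space haar_torus2" for p
  proof -
    obtain t1 t2 where p: "p = (t1, t2)" "t1 \<in> torus" "t2 \<in> torus"
      using pp by (auto simp: space_pair_measure space_haar_torus)
    obtain \<theta>1 \<theta>2 where \<theta>: "t1 = torus_elem \<theta>1" "t2 = torus_elem \<theta>2"
      using p(2,3) unfolding torus_def by blast
    have "l $ k \<noteq> 0" for k using l[of k] by simp
    then have "t1 ** diag_symp l ** t2 \<in> Sp"
      unfolding \<theta> by (intro Sp_mult torus_elem_in_Sp diag_symp_in_Sp)
    then have U: "unitary_L2 (\<rho> (t1 ** diag_symp l ** t2))"
      using rep unfolding metaplectic_rep_def metaplectic_op_def by blast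
    have "(\<lambda>n. L2_inner (\<rho> (t1 ** diag_symp l ** t2) (coherent_comb (cs n))) (coherent_comb (ds n))) \<longlonglongrightarrow>
        L2_inner (\<rho> (t1 ** diag_symp l ** t2) f) g"
      by (rule L2_inner_unitary_tendsto[OF U f coherent_comb_L2 g coherent_comb_L2 cs ds])
    then have "(\<lambda>n. (cmod (L2_inner (\<rho> (t1 ** diag_symp l ** t2) (coherent_comb (cs n))) (coherent_comb (ds n))))\<^sup>2) \<longlonglongrightarrow> F p"
      unfolding F_def p(1) fst_conv snd_conv by (intro tendsto_intros)
    then show ?thesis
      unfolding metaplectic_coefficient_coherent_comb[OF rep l p(2,3)] p(1) .
  qed
  show "F \<in> borel_measurable haar_torus2"
    by (rule borel_measurable_LIMSEQ_metric[OF _ lim]) measurable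
  have r: "(\<lambda>n. (\<Prod>k\<in>UNIV. 2 * l $ k / ((l $ k)\<^sup>2 + 1)) * (L2_norm (coherent_comb (cs n)))\<^sup>2 * (L2_norm (coherent_comb (ds n)))\<^sup>2) \<longlonglongrightarrow>
      (\<Prod>k\<in>UNIV. 2 * l $ k / ((l $ k)\<^sup>2 + 1)) * (L2_norm f)\<^sup>2 * (L2_norm g)\<^sup>2"
    by (intro tendsto_intros L2_norm_tendsto[OF f coherent_comb_L2 cs] L2_norm_tendsto[OF g coherent_comb_L2 ds])
  show "(\<integral>\<^sup>+p. ennreal (F p) \<partial>haar_torus2) \<le>
      ennreal ((\<Prod>k\<in>UNIV. 2 * l $ k / ((l $ k)\<^sup>2 + 1)) * (L2_norm f)\<^sup>2 * (L2_norm g)\<^sup>2)"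
    by (rule Fatou_bound[OF _ lim averaged_coherent_kernel_bound[OF l] r]) measurable
qed

theorem theorem5p1:
  "\<exists>C>0. \<forall>(\<rho> :: real^('n::finite + 'n)^('n + 'n) \<Rightarrow> (real^'n \<Rightarrow> complex) \<Rightarrow> (real^'n \<Rightarrow> complex))
          (l :: real^'n) \<phi>1 \<phi>2.
     metaplectic_rep \<rho> \<longrightarrow> (\<forall>i. 1 \<le> l $ i) \<longrightarrow> \<phi>1 \<in> L2 \<longrightarrow> \<phi>2 \<in> L2 \<longrightarrow>
     (let F = (\<lambda>t1 t2. (cmod (L2_inner (\<rho> (t1 ** diag_symp l ** t2) \<phi>1) \<phi>2))\<^sup>2) in
        integrable (haar_torus \<Otimes>\<^sub>M haar_torus) (\<lambda>(t1, t2). F t1 t2) \<and>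
        sqrt (LINT t1|haar_torus. LINT t2|haar_torus. F t1 t2)
          \<le> C * (\<Prod>i\<in>UNIV. l $ i) powr (- 1 / 2) * L2_norm \<phi>1 * L2_norm \<phi>2)"
\<comment> \<open>The constant is 2^(n/2): the averaged bound carries the product of 2l / (l^2 + 1)
  before the square root is taken, and each factor is at most 2 / l.\<close>
proof (intro exI[of _ "sqrt (2 ^ CARD('n))"] conjI allI impI)
  fix \<rho> :: "real^('n + 'n)^('n + 'n) \<Rightarrow> (real^'n \<Rightarrow> complex) \<Rightarrow> (real^'n \<Rightarrow> complex)"
    and l :: "real^'n" and \<phi>1 \<phi>2 :: "real^'n \<Rightarrow> complex"
  assume rep: "metaplectic_rep \<rho>" and l1: "\<forall>i. 1 \<le> l $ i" and \<phi>: "\<phi>1 \<in> L2" "\<phi>2 \<in> L2"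
  have l: "0 < l $ k" for k using l1[rule_format, of k] by linarith
  define F where "F p = (cmod (L2_inner (\<rho> (fst p ** diag_symp l ** snd p) \<phi>1) \<phi>2))\<^sup>2" for p
  define S where "S = (\<Prod>k\<in>UNIV. 2 * l $ k / ((l $ k)\<^sup>2 + 1))"
  define P where "P = (\<Prod>i\<in>UNIV. l $ i)"
  note bound = metaplectic_averaged_bound[OF rep l \<phi>, folded S_def, folded F_def]
  have S0: "0 \<le> S" unfolding S_def by (intro prod_nonneg) (use l in \<open>simp add: less_imp_le\<close>)
  have P0: "0 < P" unfolding P_def by (intro prod_pos) (use l in simp)
  interpret pair_prob_space "haar_torus :: (real^('n + 'n)^('n + 'n)) measure" "haar_torus :: (real^('n + 'n)^('n + 'n)) measure"
    by (intro pair_prob_space.intro pair_sigma_finite.intro prob_haar_torus prob_space_imp_sigma_finite)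
  have F0: "0 \<le> F p" for p by (simp add: F_def)
  \<comment> \<open>Finiteness comes before any Bochner integral is estimated, because that integral
    is 0 by convention for a non-integrable function. It also justifies passing to the iterated
    integral.\<close>
  have "(\<integral>\<^sup>+p. ennreal (norm (F p)) \<partial>haar_torus2) < \<infinity>"
    using le_less_trans[OF bound(2) ennreal_less_top] by (simp add: F0)
  then have int: "integrable haar_torus2 F"
    using bound(1) by (intro integrableI_bounded)
  have "(LINT p|haar_torus2. F p) \<le> S * (L2_norm \<phi>1)\<^sup>2 * (L2_norm \<phi>2)\<^sup>2"
    using bound(2) S0 by (subst (asm) nn_integral_eq_integral[OF int]) (simp_all add: F0)
  moreover have "(LINT t1|haar_torus. LINT t2|haar_torus. F (t1, t2)) = (LINT p|haar_torus2. F p)"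
    using integral_fst'[of F] int by simp
  moreover have "S \<le> 2 ^ CARD('n) / P"
  proof -
    have "S \<le> (\<Prod>k\<in>UNIV. 2 / l $ k)"
      unfolding S_def
    proof (intro prod_mono conjI)
      fix k
      show "0 \<le> 2 * l $ k / ((l $ k)\<^sup>2 + 1)" using l[of k] by simp
      have "2 * l $ k / ((l $ k)\<^sup>2 + 1) \<le> 2 * l $ k / (l $ k)\<^sup>2"
        using l[of k] by (intro divide_left_mono) (auto simp: add_pos_pos)
      then show "2 * l $ k / ((l $ k)\<^sup>2 + 1) \<le> 2 / l $ k"
        using l[of k] by (simp add: power2_eq_square)
    qed
    then show ?thesis by (simp add: prod_dividef P_def)
  qed
  ultimately have "(LINT t1|haar_torus. LINT t2|haar_torus. F (t1, t2)) \<le> 2 ^ CARD('n) / P * (L2_norm \<phi>1)\<^sup>2 * (L2_norm \<phi>2)\<^sup>2"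
    by (smt (verit) mult_right_mono zero_le_power2)
  then have "sqrt (LINT t1|haar_torus. LINT t2|haar_torus. F (t1, t2)) \<le> sqrt (2 ^ CARD('n) / P * (L2_norm \<phi>1)\<^sup>2 * (L2_norm \<phi>2)\<^sup>2)"
    by (rule real_sqrt_le_mono)
  also have "\<dots> = sqrt (2 ^ CARD('n)) * P powr (- 1 / 2) * L2_norm \<phi>1 * L2_norm \<phi>2"
    using P0 by (simp add: real_sqrt_mult real_sqrt_divide L2_norm_nonneg powr_minus_divide powr_half_sqrt)
  finally have le: "sqrt (LINT t1|haar_torus. LINT t2|haar_torus. F (t1, t2)) \<le>
      sqrt (2 ^ CARD('n)) * P powr (- 1 / 2) * L2_norm \<phi>1 * L2_norm \<phi>2" .
  have "F = (\<lambda>(t1, t2). (cmod (L2_inner (\<rho> (t1 ** diag_symp l ** t2) \<phi>1) \<phi>2))\<^sup>2)"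
    by (simp add: F_def fun_eq_iff)
  with int le show "let F = (\<lambda>t1 t2. (cmod (L2_inner (\<rho> (t1 ** diag_symp l ** t2) \<phi>1) \<phi>2))\<^sup>2) in
        integrable (haar_torus \<Otimes>\<^sub>M haar_torus) (\<lambda>(t1, t2). F t1 t2) \<and>
        sqrt (LINT t1|haar_torus. LINT t2|haar_torus. F t1 t2)
          \<le> sqrt (2 ^ CARD('n)) * (\<Prod>i\<in>UNIV. l $ i) powr (- 1 / 2) * L2_norm \<phi>1 * L2_norm \<phi>2"
    by (simp add: Let_def P_def)
qed simp

end
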